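(* Let $a_1,a_2,a_3,b_1,b_2,b_3\in\mathbb R$ with $a_1\neq 0$, $b_1\ne 0$, and consider the cubic Kolmogorov system $$\dot x = -\frac{1}{b_1^2}\,x(y-1)\bigl(a_2b_1\,x+a_1a_3\,y+a_1b_1-a_1a_3-a_2b_1\bigr),$$ $$\dot y = \frac{1}{a_1^2}\,y(x-1)\bigl(b_1b_2\,x+a_1b_3\,y+a_1b_1-a_1b_3-b_1b_2\bigr).$$ The equilibrium point $(1,1)$ is a center if and only if at least one of the following conditions holds: $(\mathcal C_1)$ $a_2=b_2=0$; $(\mathcal C_2)$ $a_2=b_3=0$; $(\mathcal C_3)$ $a_3=b_2=0$; $(\mathcal C_4)$ $a_3=b_3=0$; $(\mathcal C_5)$ $a_2-b_2=b_3-a_3=0$; $(\mathcal C_6)$ $a_3-b_2=b_1-a_1=b_3-a_2=0$; $(\mathcal C_7)$ $a_3+b_2=b_1+a_1=a_2+b_3=0$; $(\mathcal C_8)$ $a_3\neq0$, $b_2\ne 0$ and $a_1+\dfrac{a_3^2-b_2^2}{b_2}=a_2+b_2=b_1-\dfrac{a_3^2-b_2^2}{a_3}=b_3+a_3=0$.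
   Context: An equilibrium point of a planar real differential system is a center if it has a punctured neighbourhood filled with periodic orbits surrounding it. *)

theory Defs
  imports "HOL-Analysis.Analysis"
begin

definition periodic_orbit :: "(real \<times> real \<Rightarrow> real \<times> real) \<Rightarrow> (real \<times> real) set \<Rightarrow> bool" where
  "periodic_orbit F \<gamma> \<longleftrightarrow>
     (\<exists>\<phi> T. (\<forall>t. (\<phi> has_vector_derivative F (\<phi> t)) (at t)) \<and>
            T > 0 \<and> (\<forall>t. \<phi> (t + T) = \<phi> t) \<and>
            (\<exists>s t. \<phi> s \<noteq> \<phi> t) \<and>
            \<gamma> = range \<phi>)"

text \<open>The set \<open>N\<close> below is a neighbourhood of \<open>p\<close> such that \<open>N\<close> without \<open>p\<close> is a union of periodic
  orbits. An orbit surrounds \<open>p\<close> if \<open>p\<close> lies in a bounded component of its complement.\<close>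

definition is_center :: "(real \<times> real \<Rightarrow> real \<times> real) \<Rightarrow> real \<times> real \<Rightarrow> bool" where
  "is_center F p \<longleftrightarrow>
     F p = 0 \<and>
     (\<exists>N \<P>. p \<in> interior N \<and>
            (\<forall>\<gamma>\<in>\<P>. periodic_orbit F \<gamma> \<and> p \<in> inside \<gamma>) \<and>
            N - {p} = \<Union>\<P>)"

definition kolmogorov_field ::
    "real \<Rightarrow> real \<Rightarrow> real \<Rightarrow> real \<Rightarrow> real \<Rightarrow> real \<Rightarrow> real \<times> real \<Rightarrow> real \<times> real" where
  "kolmogorov_field a1 a2 a3 b1 b2 b3 = (\<lambda>(x, y).
     (- (1 / b1\<^sup>2) * x * (y - 1) * (a2 * b1 * x + a1 * a3 * y + a1 * b1 - a1 * a3 - a2 * b1),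
      1 / a1\<^sup>2 * y * (x - 1) * (b1 * b2 * x + a1 * b3 * y + a1 * b1 - a1 * b3 - b1 * b2)))"

end

theory Submission
  imports Defs
begin

text \<open>Put \<open>x = 1 + a1 X\<close>, \<open>y = 1 + b1 Y\<close>; the system becomes \<open>X' = - Y (1 + a1 X) (1 + a2 X + a3 Y)\<close>,
  \<open>Y' = X (1 + b1 Y) (1 + b2 X + b3 Y)\<close>, a perturbation of a rotation.

  Necessity: a periodic orbit near the point excludes strict Lyapunov functions, so at a center the
  formal first integral \<open>X\<^sup>2 + Y\<^sup>2 + \<dots>\<close> exists to every order, that is, all focal values vanish.
  The first one is \<open>a2 a3 - b2 b3\<close>. If \<open>b2 \<noteq> 0\<close>, scaling gives \<open>b2 = 1\<close>, and the second and third ones are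
  linear in \<open>a1\<close> and \<open>b1\<close>; the fourth and fifth then leave, besides the listed conditions, two
  polynomial equations in \<open>a2\<close> and \<open>a3\<^sup>2\<close> which have no common real solution. A focal value of order \<open>N\<close> is
  the pairing of the low coefficients of the integral with a weight that annihilates, from degree 7
  up to degree \<open>N\<close>, the adjoint of the derivation along the field; this avoids the large high-order coefficients.

  Sufficiency: in polar coordinates orbits are solutions of a scalar equation, and the point is a
  center if its return map is the identity. This holds if there is a first integral with a
  nondegenerate minimum (separable cases and the Darboux case) or a reversing reflection.\<close>

section \<open>Coefficients of the derivative along the field\<close>

text \<open>Why two degrees of the integral suffice for each focal value: the derivation raises
  degrees by 0, 1 or 2, so its transpose lowers them by at most 2. A weight in degrees
  \<open>k + 2\<close> to \<open>N\<close> whose transpose vanishes in these degrees therefore sees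
  the integral only in degrees \<open>k\<close> and \<open>k + 1\<close>. The weights grow with
  \<open>N\<close>, but coefficients of the integral beyond degree 6 are never computed. The
  elimination does not end with an algebraic identity: the resultant keeps a factor of degree 10 in
  one variable, and only its sign for real arguments with \<open>a3^2 > 0\<close> rules it out. For
  the converse, the definition of a center asks for solutions on the whole time axis and for a point
  inside each orbit. The equation for the radius as a function of the angle is therefore clipped to
  become bounded and globally Lipschitz, time is recovered by inverting an integral over the angle,
  and star-shapedness of the orbits takes the place of the Jordan curve theorem.\<close>

definition shX :: "(nat \<Rightarrow> nat \<Rightarrow> real) \<Rightarrow> nat \<Rightarrow> nat \<Rightarrow> real" where
  "shX c p q = (case p of 0 \<Rightarrow> 0 | Suc k \<Rightarrow> c k q)"

definition shY :: "(nat \<Rightarrow> nat \<Rightarrow> real) \<Rightarrow> nat \<Rightarrow> nat \<Rightarrow> real" where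
  "shY c p q = (case q of 0 \<Rightarrow> 0 | Suc k \<Rightarrow> c p k)"

definition dX :: "(nat \<Rightarrow> nat \<Rightarrow> real) \<Rightarrow> nat \<Rightarrow> nat \<Rightarrow> real" where
  "dX c p q = real (Suc p) * c (Suc p) q"

definition dY :: "(nat \<Rightarrow> nat \<Rightarrow> real) \<Rightarrow> nat \<Rightarrow> nat \<Rightarrow> real" where
  "dY c p q = real (Suc q) * c p (Suc q)"

text \<open>A polynomial is its array of coefficients, \<open>c p q\<close> belonging to
  \<open>X^p Y^q\<close>; \<open>shX\<close> and \<open>shY\<close> multiply by a variable,
  \<open>dX\<close> and \<open>dY\<close> differentiate. The ten summands are the monomials of the
  expanded field.\<close>

definition lie_coeff ::
    "real \<Rightarrow> real \<Rightarrow> real \<Rightarrow> real \<Rightarrow> real \<Rightarrow> real \<Rightarrow> (nat \<Rightarrow> nat \<Rightarrow> real) \<Rightarrow> nat \<Rightarrow> nat \<Rightarrow> real" where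
  "lie_coeff a1 a2 a3 b1 b2 b3 c p q =
     - shY (dX c) p q - (a1 + a2) * shX (shY (dX c)) p q - a3 * shY (shY (dX c)) p q
     - a1 * a2 * shX (shX (shY (dX c))) p q - a1 * a3 * shX (shY (shY (dX c))) p q
     + shX (dY c) p q + b2 * shX (shX (dY c)) p q + (b1 + b3) * shX (shY (dY c)) p q
     + b1 * b2 * shX (shX (shY (dY c))) p q + b1 * b3 * shX (shY (shY (dY c))) p q"

text \<open>The transpose of \<open>lie_coeff\<close> for \<open>pairing\<close>: multiplication by
  a variable becomes a shift of the index. The truncated \<open>q - 1\<close> and
  \<open>p - 1\<close> do no harm at 0 because of the factors \<open>real q\<close> and
  \<open>real p\<close>.\<close>

definition lie_adjoint ::
    "real \<Rightarrow> real \<Rightarrow> real \<Rightarrow> real \<Rightarrow> real \<Rightarrow> real \<Rightarrow> (nat \<Rightarrow> nat \<Rightarrow> real) \<Rightarrow> nat \<Rightarrow> nat \<Rightarrow> real" where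
  "lie_adjoint a1 a2 a3 b1 b2 b3 l p q =
     real q * (l (p + 1) (q - 1) + b2 * l (p + 2) (q - 1) + (b1 + b3) * l (p + 1) q
               + b1 * b2 * l (p + 2) q + b1 * b3 * l (p + 1) (q + 1))
   - real p * (l (p - 1) (q + 1) + (a1 + a2) * l p (q + 1) + a3 * l (p - 1) (q + 2)
               + a1 * a2 * l (p + 1) (q + 1) + a1 * a3 * l p (q + 2))"

definition pairing :: "nat \<Rightarrow> (nat \<Rightarrow> nat \<Rightarrow> real) \<Rightarrow> (nat \<Rightarrow> nat \<Rightarrow> real) \<Rightarrow> real" where
  "pairing M l c = (\<Sum>p\<le>M. \<Sum>q\<le>M. l p q * c p q)"

definition bounded_support :: "nat \<Rightarrow> (nat \<Rightarrow> nat \<Rightarrow> real) \<Rightarrow> bool" where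
  "bounded_support n c \<longleftrightarrow> (\<forall>p q. n < p + q \<longrightarrow> c p q = 0)"

text \<open>Reindexing yields the rows below \<open>M\<close>; the row that completes the box is
  zero because the support of \<open>c\<close> stays strictly inside the box.\<close>

lemma pairing_shX:
  assumes "bounded_support n c" "n < M"
  shows "pairing M l (shX c) = pairing M (\<lambda>p q. l (Suc p) q) c"
proof -
  obtain M' where M: "M = Suc M'" using assms(2) by (cases M) auto
  have z: "(\<Sum>q\<le>M. l (Suc M) q * c M q) = 0"
    using assms by (intro sum.neutral) (auto simp: bounded_support_def)
  have "pairing M l (shX c) = (\<Sum>p\<le>M'. \<Sum>q\<le>M. l (Suc p) q * c p q)"
    unfolding pairing_def M by (simp add: sum.atMost_Suc_shift shX_def del: sum.atMost_Suc)
  also have "\<dots> = pairing M (\<lambda>p q. l (Suc p) q) c"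
    unfolding pairing_def using z by (simp add: M)
  finally show ?thesis .
qed

lemma pairing_transpose: "pairing M l c = pairing M (\<lambda>p q. l q p) (\<lambda>p q. c q p)"
  unfolding pairing_def by (rule sum.swap)

lemma pairing_shY:
  assumes "bounded_support n c" "n < M"
  shows "pairing M l (shY c) = pairing M (\<lambda>p q. l p (Suc q)) c"
proof -
  have b: "bounded_support n (\<lambda>p q. c q p)"
    using assms(1) by (auto simp: bounded_support_def add.commute)
  have "pairing M l (shY c) = pairing M (\<lambda>p q. l q p) (shX (\<lambda>p q. c q p))"
    by (subst pairing_transpose) (simp add: shX_def shY_def pairing_def)
  then show ?thesis
    using pairing_shX[OF b assms(2), of "\<lambda>p q. l q p"] by (subst pairing_transpose) simp
qed

lemma pairing_dX:
  assumes "bounded_support n c" "n < M"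
  shows "pairing M l (dX c) = pairing M (\<lambda>p q. real p * l (p - 1) q) c"
proof -
  obtain M' where M: "M = Suc M'" using assms(2) by (cases M) auto
  have "c (Suc M) q = 0" for q
    using assms by (auto simp: bounded_support_def)
  then have z: "(\<Sum>q\<le>M. l M q * (real (Suc M) * c (Suc M) q)) = 0"
    by simp
  have "pairing M (\<lambda>p q. real p * l (p - 1) q) c = (\<Sum>p\<le>M'. \<Sum>q\<le>M. l p q * (real (Suc p) * c (Suc p) q))"
    unfolding pairing_def M
    by (simp add: sum.atMost_Suc_shift mult_ac del: sum.atMost_Suc of_nat_Suc)
  also have "\<dots> = pairing M l (dX c)"
    unfolding pairing_def dX_def using z by (simp add: M)
  finally show ?thesis ..
qed

lemma pairing_dY:
  assumes "bounded_support n c" "n < M"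
  shows "pairing M l (dY c) = pairing M (\<lambda>p q. real q * l p (q - 1)) c"
proof -
  have b: "bounded_support n (\<lambda>p q. c q p)"
    using assms(1) by (auto simp: bounded_support_def add.commute)
  have "pairing M l (dY c) = pairing M (\<lambda>p q. l q p) (dX (\<lambda>p q. c q p))"
    by (subst pairing_transpose) (simp add: dX_def dY_def pairing_def)
  then show ?thesis
    using pairing_dX[OF b assms(2), of "\<lambda>p q. l q p"] by (subst pairing_transpose) simp
qed

lemma bounded_support_shX: "bounded_support n c \<Longrightarrow> bounded_support (Suc n) (shX c)"
  by (auto simp: bounded_support_def shX_def split: nat.split)

lemma bounded_support_shY: "bounded_support n c \<Longrightarrow> bounded_support (Suc n) (shY c)"
  by (auto simp: bounded_support_def shY_def split: nat.split)

lemma bounded_support_dX: "bounded_support n c \<Longrightarrow> bounded_support n (dX c)"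
  by (auto simp: bounded_support_def dX_def)

lemma bounded_support_dY: "bounded_support n c \<Longrightarrow> bounded_support n (dY c)"
  by (auto simp: bounded_support_def dY_def)

lemma bounded_support_mono: "bounded_support n c \<Longrightarrow> n \<le> m \<Longrightarrow> bounded_support m c"
  by (auto simp: bounded_support_def)

text \<open>Transposition operator by operator. Before its last shift a term is a derivative shifted
  at most twice, supported up to degree \<open>n + 2\<close>, and this must stay strictly inside the
  box.\<close>

lemma pairing_lie_coeff:
  assumes c: "bounded_support n c" and M: "n + 3 \<le> M"
  shows "pairing M l (lie_coeff a1 a2 a3 b1 b2 b3 c) = pairing M (lie_adjoint a1 a2 a3 b1 b2 b3 l) c"
proof -
  note dX = bounded_support_dX[OF c] and dY = bounded_support_dY[OF c]
  have b: "bounded_support (M - 1) (dX c)" "bounded_support (M - 1) (dY c)"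
    "bounded_support (M - 1) (shY (dX c))" "bounded_support (M - 1) (shX (shY (dX c)))"
    "bounded_support (M - 1) (shY (shY (dX c)))" "bounded_support (M - 1) (shX (dY c))"
    "bounded_support (M - 1) (shY (dY c))" "bounded_support (M - 1) (shX (shY (dY c)))"
    "bounded_support (M - 1) (shY (shY (dY c)))"
    using M by (auto intro!: bounded_support_mono[OF dX] bounded_support_mono[OF dY]
        bounded_support_mono[OF bounded_support_shY[OF dX]]
        bounded_support_mono[OF bounded_support_shY[OF dY]]
        bounded_support_mono[OF bounded_support_shX[OF dY]]
        bounded_support_mono[OF bounded_support_shX[OF bounded_support_shY[OF dX]]]
        bounded_support_mono[OF bounded_support_shX[OF bounded_support_shY[OF dY]]]
        bounded_support_mono[OF bounded_support_shY[OF bounded_support_shY[OF dX]]]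
        bounded_support_mono[OF bounded_support_shY[OF bounded_support_shY[OF dY]]])
  have M1: "M - 1 < M" "n < M" using M by auto
  note sh = b[THEN pairing_shX[OF _ M1(1)]] b[THEN pairing_shY[OF _ M1(1)]]
    pairing_dX[OF c M1(2)] pairing_dY[OF c M1(2)]
  have "pairing M l (lie_coeff a1 a2 a3 b1 b2 b3 c) =
     - pairing M l (shY (dX c)) - (a1 + a2) * pairing M l (shX (shY (dX c))) - a3 * pairing M l (shY (shY (dX c)))
     - a1 * a2 * pairing M l (shX (shX (shY (dX c)))) - a1 * a3 * pairing M l (shX (shY (shY (dX c))))
     + pairing M l (shX (dY c)) + b2 * pairing M l (shX (shX (dY c))) + (b1 + b3) * pairing M l (shX (shY (dY c)))
     + b1 * b2 * pairing M l (shX (shX (shY (dY c)))) + b1 * b3 * pairing M l (shX (shY (shY (dY c))))"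
    unfolding pairing_def lie_coeff_def
    by (simp add: algebra_simps sum.distrib sum_subtractf sum_negf sum_distrib_left)
  also have "\<dots> = pairing M (lie_adjoint a1 a2 a3 b1 b2 b3 l) c"
    unfolding sh unfolding pairing_def sum_distrib_left sum_negf[symmetric] sum.distrib[symmetric] sum_subtractf[symmetric]
  proof (intro sum.cong refl)
    fix p q
    show "- (real p * l (p - 1) (Suc q) * c p q) - (a1 + a2) * (real p * l (Suc (p - 1)) (Suc q) * c p q)
       - a3 * (real p * l (p - 1) (Suc (Suc q)) * c p q)
       - a1 * a2 * (real p * l (Suc (Suc (p - 1))) (Suc q) * c p q)
       - a1 * a3 * (real p * l (Suc (p - 1)) (Suc (Suc q)) * c p q)
       + real q * l (Suc p) (q - 1) * c p q + b2 * (real q * l (Suc (Suc p)) (q - 1) * c p q)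
       + (b1 + b3) * (real q * l (Suc p) (Suc (q - 1)) * c p q)
       + b1 * b2 * (real q * l (Suc (Suc p)) (Suc (q - 1)) * c p q)
       + b1 * b3 * (real q * l (Suc p) (Suc (Suc (q - 1))) * c p q)
      = lie_adjoint a1 a2 a3 b1 b2 b3 l p q * c p q"
      by (cases p; cases q) (simp_all add: lie_adjoint_def algebra_simps)
  qed
  finally show ?thesis .
qed

lemma sum_box_diagonal:
  fixes f :: "nat \<Rightarrow> nat \<Rightarrow> real"
  assumes "\<And>p q. p + q \<noteq> k \<Longrightarrow> p + q \<noteq> Suc k \<Longrightarrow> f p q = 0" and "Suc k \<le> M"
  shows "(\<Sum>p\<le>M. \<Sum>q\<le>M. f p q) = (\<Sum>q\<le>k. f (k - q) q) + (\<Sum>q\<le>Suc k. f (Suc k - q) q)"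
proof -
  let ?S = "\<lambda>j. (\<lambda>q. (j - q, q)) ` {..j}"
  have S: "sum (case_prod f) (?S j) = (\<Sum>q\<le>j. f (j - q) q)" for j
    by (subst sum.reindex) (auto simp: inj_on_def)
  have "(\<Sum>p\<le>M. \<Sum>q\<le>M. f p q) = sum (case_prod f) ({..M} \<times> {..M})"
    by (simp add: sum.cartesian_product)
  also have "\<dots> = sum (case_prod f) (?S k \<union> ?S (Suc k))"
  proof (rule sum.mono_neutral_right)
    show "?S k \<union> ?S (Suc k) \<subseteq> {..M} \<times> {..M}" using assms(2) by auto
    show "\<forall>i\<in>{..M} \<times> {..M} - (?S k \<union> ?S (Suc k)). case_prod f i = 0"
    proof
      fix i assume i: "i \<in> {..M} \<times> {..M} - (?S k \<union> ?S (Suc k))"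
      obtain p q where pq: "i = (p, q)" by (cases i)
      have "p + q \<noteq> k" "p + q \<noteq> Suc k"
        using i unfolding pq by (auto simp: image_iff)
      then show "case_prod f i = 0" using assms(1) pq by simp
    qed
  qed simp
  also have "\<dots> = sum (case_prod f) (?S k) + sum (case_prod f) (?S (Suc k))"
    by (rule sum.union_disjoint) (auto simp del: mult_Suc)
  finally show ?thesis unfolding S .
qed

text \<open>In total degree \<open>j\<close> the adjoint reads the weight in degrees
  \<open>j\<close> to \<open>j + 2\<close>. Hence it vanishes below \<open>k\<close> and above
  \<open>N\<close>, and by assumption in between; only the diagonals \<open>k\<close> and
  \<open>k + 1\<close> of the pairing with \<open>c\<close> remain.\<close>

lemma adjoint_functional:
  assumes c: "bounded_support n c"
    and lie: "\<And>p q. p + q \<le> n \<Longrightarrow> lie_coeff a1 a2 a3 b1 b2 b3 c p q = 0"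
    and l: "\<And>p q. p + q < k + 2 \<or> N < p + q \<Longrightarrow> l p q = 0"
    and adj: "\<And>p q. k + 2 \<le> p + q \<Longrightarrow> p + q \<le> N \<Longrightarrow> lie_adjoint a1 a2 a3 b1 b2 b3 l p q = 0"
    and N: "N \<le> n" "k \<le> n"
  shows "(\<Sum>q\<le>k. c (k - q) q * lie_adjoint a1 a2 a3 b1 b2 b3 l (k - q) q)
       + (\<Sum>q\<le>Suc k. c (Suc k - q) q * lie_adjoint a1 a2 a3 b1 b2 b3 l (Suc k - q) q) = 0"
proof -
  let ?\<mu> = "lie_adjoint a1 a2 a3 b1 b2 b3 l"
  have "?\<mu> p q = 0" if "p + q \<noteq> k" "p + q \<noteq> Suc k" for p q
  proof -
    have "p + q < k \<or> k + 2 \<le> p + q \<and> p + q \<le> N \<or> N < p + q" using that by linarith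
    then show ?thesis
    proof (elim disjE conjE)
      assume "p + q < k" then show ?thesis by (cases p; cases q) (simp_all add: lie_adjoint_def l)
    next
      assume "k + 2 \<le> p + q" "p + q \<le> N" then show ?thesis by (rule adj)
    next
      assume "N < p + q" then show ?thesis by (cases p; cases q) (simp_all add: lie_adjoint_def l)
    qed
  qed
  then have "(\<Sum>q\<le>k. ?\<mu> (k - q) q * c (k - q) q) + (\<Sum>q\<le>Suc k. ?\<mu> (Suc k - q) q * c (Suc k - q) q)
      = (\<Sum>p\<le>n+3. \<Sum>q\<le>n+3. ?\<mu> p q * c p q)"
    using N by (intro sum_box_diagonal[symmetric]) auto
  also have "\<dots> = pairing (n + 3) l (lie_coeff a1 a2 a3 b1 b2 b3 c)"
    using pairing_lie_coeff[OF c, of "n + 3" l] unfolding pairing_def by simp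
  also have "\<dots> = 0"
  proof -
    \<comment> \<open>Up to degree \<open>n\<close> the second factor vanishes, beyond
      \<open>n\<close> the weight does, since \<open>N \<le> n\<close>.\<close>
    have "l p q * lie_coeff a1 a2 a3 b1 b2 b3 c p q = 0" for p q
      using lie[of p q] l[of p q] N by (cases "p + q \<le> n") auto
    then show ?thesis unfolding pairing_def by (intro sum.neutral ballI) simp
  qed
  finally show ?thesis by (simp only: mult.commute)
qed

section \<open>Strict Lyapunov functions exclude centers\<close>

lemma periodic_orbit_not_mem:
  assumes "p \<in> inside \<gamma>" shows "p \<notin> \<gamma>"
  using assms by (auto simp: inside_def)

text \<open>Every point of a small punctured ball lies on one of the orbits, and a time shift makes
  it the initial point. The orbit avoids \<open>p\<close> because \<open>inside\<close> is a part of
  the complement.\<close>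

lemma center_periodic_solution:
  assumes "is_center F p"
  obtains d where "0 < d" "\<And>z. z \<noteq> p \<Longrightarrow> dist z p < d \<Longrightarrow>
     \<exists>\<phi> T. (\<forall>t. (\<phi> has_vector_derivative F (\<phi> t)) (at t)) \<and> T > 0 \<and> (\<forall>t. \<phi> (t + T) = \<phi> t) \<and>
        (\<forall>t. \<phi> t \<noteq> p) \<and> \<phi> 0 = z"
proof -
  obtain N \<P> where N: "p \<in> interior N" "\<And>\<gamma>. \<gamma> \<in> \<P> \<Longrightarrow> periodic_orbit F \<gamma> \<and> p \<in> inside \<gamma>" "N - {p} = \<Union>\<P>"
    using assms unfolding is_center_def by blast
  obtain d where d: "0 < d" "ball p d \<subseteq> N"
    using N(1) by (meson mem_interior)
  show ?thesis
  proof (rule that[OF d(1)])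
    fix z assume z: "z \<noteq> p" "dist z p < d"
    then have "z \<in> N - {p}" using d by (auto simp: dist_commute)
    then obtain \<gamma> where g: "\<gamma> \<in> \<P>" "z \<in> \<gamma>" using N(3) by blast
    then obtain \<phi> T where phi: "\<forall>t. (\<phi> has_vector_derivative F (\<phi> t)) (at t)" "T > 0"
      "\<forall>t. \<phi> (t + T) = \<phi> t" "\<gamma> = range \<phi>"
      using N(2) unfolding periodic_orbit_def by blast
    obtain t0 where t0: "z = \<phi> t0" using g phi by blast
    have "((\<lambda>t. \<phi> (t + t0)) has_vector_derivative F (\<phi> (t + t0))) (at t)" for t
    proof -
      have "((\<lambda>t. t + t0) has_vector_derivative 1) (at t)"
        by (auto intro!: derivative_eq_intros)
      from vector_diff_chain_at[OF this, of \<phi> "F (\<phi> (t + t0))"] phi(1)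
      show ?thesis by (simp add: o_def)
    qed
    moreover have "p \<notin> \<gamma>" using N(2)[OF g(1)] periodic_orbit_not_mem by blast
    moreover have per: "\<phi> (t + T + t0) = \<phi> (t + t0)" for t
      using phi(3)[rule_format, of "t + t0"] by (simp add: ac_simps)
    ultimately show "\<exists>\<phi> T. (\<forall>t. (\<phi> has_vector_derivative F (\<phi> t)) (at t)) \<and> T > 0 \<and>
        (\<forall>t. \<phi> (t + T) = \<phi> t) \<and> (\<forall>t. \<phi> t \<noteq> p) \<and> \<phi> 0 = z"
      using phi(2,4) t0 per by (intro exI[of _ "\<lambda>t. \<phi> (t + t0)"] exI[of _ T]) auto
  qed
qed

text \<open>Until a first exit from the ball \<open>V\<close> decreases, while on the sphere it is
  at least \<open>m\<close>, which exceeds its initial value. So the solution stays in the ball and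
  \<open>V\<close> decreases over a whole period, against \<open>w T = w 0\<close>.\<close>

lemma strict_lyapunov_trap:
  fixes w :: "real \<Rightarrow> real \<times> real" and V :: "real \<times> real \<Rightarrow> real"
  assumes e: "0 < e" and T: "0 < T" "w T = w 0"
    and w: "continuous_on UNIV w" "\<And>t. w t \<noteq> 0"
    and V: "continuous_on UNIV V" "\<And>z. norm z = e \<Longrightarrow> m \<le> V z"
    and start: "norm (w 0) < e" "V (w 0) < m"
    and dec: "\<And>t. norm (w t) \<le> e \<Longrightarrow> \<exists>D. ((\<lambda>t. V (w t)) has_real_derivative D) (at t) \<and> D < 0"
  shows False
proof -
  have cw: "continuous_on A (\<lambda>t. norm (w t))" for A
    using w(1) by (intro continuous_intros) (auto intro: continuous_on_subset)
  have small: "norm (w t) < e" if "0 \<le> t" for t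
  proof (rule ccontr)
    assume "\<not> norm (w t) < e"
    \<comment> \<open>The least element of this compact set is the first time at which the sphere is
      reached.\<close>
    define S where "S = {s\<in>{0..t}. e \<le> norm (w s)}"
    have "S = {0..t} \<inter> (\<lambda>s. norm (w s)) -` {e..}" by (auto simp: S_def)
    moreover have "closed ({0..t} \<inter> (\<lambda>s. norm (w s)) -` {e..})"
      by (rule continuous_closed_preimage[OF cw]) auto
    moreover have "bounded S" by (rule bounded_subset[of "{0..t}"]) (auto simp: S_def)
    ultimately have "compact S" by (simp add: compact_eq_bounded_closed)
    have "t \<in> S" using that \<open>\<not> norm (w t) < e\<close> by (auto simp: S_def)
    then obtain s where s: "s \<in> S" "\<And>r. r \<in> S \<Longrightarrow> s \<le> r"
      using compact_attains_inf[OF \<open>compact S\<close>] by blast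
    have s0: "0 < s" using s(1) start(1) by (cases "s = 0") (auto simp: S_def)
    have lt: "norm (w r) < e" if "0 \<le> r" "r < s" for r
      using s(2)[of r] that s(1) by (force simp: S_def)
    have "norm (w s) \<le> e"
    proof (rule ccontr)
      assume "\<not> norm (w s) \<le> e"
      then obtain r where "0 \<le> r" "r \<le> s" "norm (w r) = e"
        using IVT'[of "\<lambda>t. norm (w t)" 0 e s] start(1) s0 cw by force
      then show False using lt[of r] \<open>\<not> norm (w s) \<le> e\<close> by (cases "r = s") auto
    qed
    then have eq: "norm (w s) = e" using s(1) by (simp add: S_def)
    have "V (w s) < V (w 0)"
    proof (rule DERIV_neg_imp_decreasing[OF s0])
      fix r assume "0 \<le> r" "r \<le> s"
      then have "norm (w r) \<le> e" using lt[of r] eq by (cases "r = s") auto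
      then show "\<exists>y. ((\<lambda>t. V (w t)) has_real_derivative y) (at r) \<and> y < 0" by (rule dec)
    qed
    then show False using V(2)[OF eq] start by simp
  qed
  have "V (w T) < V (w 0)"
    by (rule DERIV_neg_imp_decreasing[OF T(1)]) (use small less_imp_le in \<open>blast intro: dec\<close>)
  then show False using T by simp
qed

text \<open>The sign \<open>s\<close> is a direction of time: where \<open>V\<close> increases along
  the field, the periodic solution is run backwards, so the same trap covers both cases.\<close>

lemma strict_lyapunov_not_center:
  fixes f g V VX VY :: "real \<Rightarrow> real \<Rightarrow> real"
  assumes center: "is_center F (x0, y0)" and ab: "\<alpha> \<noteq> 0" "\<beta> \<noteq> 0"
    and F: "\<And>X Y. F (x0 + \<alpha> * X, y0 + \<beta> * Y) = (\<alpha> * f X Y, \<beta> * g X Y)"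
    and V: "\<And>X Y. ((\<lambda>z. V (fst z) (snd z)) has_derivative (\<lambda>h. VX X Y * fst h + VY X Y * snd h)) (at (X, Y))"
    and V0: "V 0 0 = 0" and e: "0 < e"
    and pos: "\<And>X Y. (X, Y) \<noteq> 0 \<Longrightarrow> norm (X, Y) \<le> e \<Longrightarrow> 0 < V X Y"
    and s: "s = 1 \<or> s = -1"
    and neg: "\<And>X Y. (X, Y) \<noteq> 0 \<Longrightarrow> norm (X, Y) \<le> e \<Longrightarrow> s * (VX X Y * f X Y + VY X Y * g X Y) < 0"
  shows False
proof -
  define U where "U = (\<lambda>z. V (fst z) (snd z))"
  have Ucont: "isCont U z" for z
    using has_derivative_continuous[OF V[of "fst z" "snd z"]] by (simp add: U_def)
  then have Uc: "continuous_on UNIV U" by (intro continuous_at_imp_continuous_on ballI)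
  have "sphere (0::real \<times> real) e \<noteq> {}" using e by simp
  from continuous_attains_inf[OF compact_sphere this continuous_on_subset[OF Uc]]
  obtain z0 where z0: "norm z0 = e" "\<And>z. norm z = e \<Longrightarrow> U z0 \<le> U z" by auto
  define m where "m = U z0"
  have "z0 \<noteq> 0" using z0 e by auto
  then have m: "0 < m" using pos[of "fst z0" "snd z0"] z0 e by (simp add: m_def U_def)
  have "U 0 = 0" by (simp add: U_def V0)
  moreover have "isCont U 0" by (rule Ucont)
  ultimately obtain r where r: "0 < r" "\<And>z. norm z < r \<Longrightarrow> U z < m"
    using m unfolding continuous_at_eps_delta by (force simp: dist_norm)
  from center_periodic_solution[OF center] obtain d where d: "0 < d"
    and dd: "\<And>z. z \<noteq> (x0, y0) \<Longrightarrow> dist z (x0, y0) < d \<Longrightarrow>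
     \<exists>\<phi> T. (\<forall>t. (\<phi> has_vector_derivative F (\<phi> t)) (at t)) \<and> T > 0 \<and> (\<forall>t. \<phi> (t + T) = \<phi> t) \<and>
        (\<forall>t. \<phi> t \<noteq> (x0, y0)) \<and> \<phi> 0 = z" by blast
  \<comment> \<open>The starting point \<open>(h, 0)\<close> has to lie in the ball of radius
    \<open>e\<close>, below the minimum \<open>m\<close> of \<open>V\<close> on its sphere, and,
    after scaling by \<open>\<alpha>\<close>, in the punctured ball filled with periodic
    orbits.\<close>
  define h where "h = min (min (e / 2) (r / 2)) (d / (2 * \<bar>\<alpha>\<bar>))"
  have h: "0 < h" "h < e" "h < r" "h * \<bar>\<alpha>\<bar> < d"
  proof -
    show "0 < h" "h < e" "h < r" using e r d ab by (auto simp: h_def)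
    have "h * \<bar>\<alpha>\<bar> \<le> d / (2 * \<bar>\<alpha>\<bar>) * \<bar>\<alpha>\<bar>" by (intro mult_right_mono) (auto simp: h_def)
    then show "h * \<bar>\<alpha>\<bar> < d" using ab d by simp
  qed
  have "(x0 + \<alpha> * h, y0) \<noteq> (x0, y0)" "dist (x0 + \<alpha> * h, y0) (x0, y0) < d"
    using h ab by (auto simp: dist_Pair_Pair dist_norm abs_mult mult.commute)
  from dd[OF this] obtain \<phi> T where phi: "\<And>t. (\<phi> has_vector_derivative F (\<phi> t)) (at t)" "T > 0"
    "\<And>t. \<phi> (t + T) = \<phi> t" "\<And>t. \<phi> t \<noteq> (x0, y0)" "\<phi> 0 = (x0 + \<alpha> * h, y0)" by blast
  define w where "w = (\<lambda>t. ((fst (\<phi> (s * t)) - x0) / \<alpha>, (snd (\<phi> (s * t)) - y0) / \<beta>))"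
  have wphi: "\<phi> (s * t) = (x0 + \<alpha> * fst (w t), y0 + \<beta> * snd (w t))" for t
    using ab by (simp add: w_def)
  have wd: "(w has_vector_derivative (s * f (fst (w t)) (snd (w t)), s * g (fst (w t)) (snd (w t)))) (at t)" for t
  proof -
    have "((\<lambda>t. s * t) has_vector_derivative s) (at t)"
      by (auto intro!: derivative_eq_intros)
    from vector_diff_chain_at[OF this phi(1)]
    have D: "((\<lambda>t. \<phi> (s * t)) has_vector_derivative s *\<^sub>R F (\<phi> (s * t))) (at t)"
      by (simp add: o_def)
    have "((\<lambda>t. fst (\<phi> (s * t))) has_real_derivative s * (\<alpha> * f (fst (w t)) (snd (w t)))) (at t)"
      "((\<lambda>t. snd (\<phi> (s * t))) has_real_derivative s * (\<beta> * g (fst (w t)) (snd (w t)))) (at t)"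
      using bounded_linear.has_vector_derivative[OF bounded_linear_fst D]
        bounded_linear.has_vector_derivative[OF bounded_linear_snd D]
      unfolding has_real_derivative_iff_has_vector_derivative wphi F by simp_all
    note d = this
    have "((\<lambda>t. (fst (\<phi> (s * t)) - x0) / \<alpha>) has_vector_derivative s * f (fst (w t)) (snd (w t))) (at t)"
      unfolding has_real_derivative_iff_has_vector_derivative[symmetric]
      by (rule derivative_eq_intros d refl)+ (use ab in \<open>simp_all add: field_simps\<close>)
    moreover have "((\<lambda>t. (snd (\<phi> (s * t)) - y0) / \<beta>) has_vector_derivative s * g (fst (w t)) (snd (w t))) (at t)"
      unfolding has_real_derivative_iff_has_vector_derivative[symmetric]
      by (rule derivative_eq_intros d refl)+ (use ab in \<open>simp_all add: field_simps\<close>)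
    ultimately show ?thesis unfolding w_def by (rule has_vector_derivative_Pair)
  qed
  have "continuous (at t) w" for t
    using has_vector_derivative_continuous[OF wd] .
  then have wc: "continuous_on UNIV w" by (simp add: continuous_at_imp_continuous_on)
  have wn0: "w t \<noteq> 0" for t
    using phi(4)[of "s * t"] wphi[of t] by (auto simp: zero_prod_def)
  have w0: "w 0 = (h, 0)" using phi(5) ab by (simp add: w_def)
  show False
  proof (rule strict_lyapunov_trap[OF e phi(2) _ wc wn0 Uc z0(2)[folded m_def]])
    have "\<phi> (s * T) = \<phi> 0" using s phi(3)[of 0] phi(3)[of "-T"] by auto
    then show "w T = w 0" by (simp add: w_def)
    show "norm (w 0) < e" "U (w 0) < m" using h r(2)[of "w 0"] by (auto simp: w0 norm_Pair)
    fix t assume t: "norm (w t) \<le> e"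
    have "((\<lambda>t. U (w t)) has_derivative (\<lambda>k. VX (fst (w t)) (snd (w t)) * fst (k *\<^sub>R (s * f (fst (w t)) (snd (w t)), s * g (fst (w t)) (snd (w t))))
        + VY (fst (w t)) (snd (w t)) * snd (k *\<^sub>R (s * f (fst (w t)) (snd (w t)), s * g (fst (w t)) (snd (w t)))))) (at t)"
      by (rule has_derivative_compose[OF wd[of t, unfolded has_vector_derivative_def]])
        (use V[of "fst (w t)" "snd (w t)"] in \<open>simp add: U_def\<close>)
    then have "((\<lambda>t. U (w t)) has_real_derivative
        s * (VX (fst (w t)) (snd (w t)) * f (fst (w t)) (snd (w t)) + VY (fst (w t)) (snd (w t)) * g (fst (w t)) (snd (w t)))) (at t)"
      unfolding has_field_derivative_def by (rule has_derivative_eq_rhs) (auto simp: algebra_simps)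
    moreover have "s * (VX (fst (w t)) (snd (w t)) * f (fst (w t)) (snd (w t)) + VY (fst (w t)) (snd (w t)) * g (fst (w t)) (snd (w t))) < 0"
      using neg[of "fst (w t)" "snd (w t)"] wn0[of t] t by simp
    ultimately show "\<exists>D. ((\<lambda>t. U (w t)) has_real_derivative D) (at t) \<and> D < 0" by blast
  qed
qed

section \<open>Formal first integrals\<close>

text \<open>Used as a weight, this array turns \<open>pairing\<close> into evaluation of the
  polynomial \<open>c\<close> at \<open>(X, Y)\<close>.\<close>

definition monomial :: "real \<Rightarrow> real \<Rightarrow> nat \<Rightarrow> nat \<Rightarrow> real" where
  "monomial X Y p q = X ^ p * Y ^ q"

lemma pairing_add: "pairing M l (\<lambda>p q. c p q + e p q) = pairing M l c + pairing M l e"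
  by (simp add: pairing_def algebra_simps sum.distrib)

lemma pairing_scale: "pairing M l (\<lambda>p q. k * c p q) = k * pairing M l c"
  by (simp add: pairing_def algebra_simps sum_distrib_left)

lemma pairing_single:
  assumes "i \<le> M" "j \<le> M"
  shows "pairing M l (\<lambda>p q. if p = i \<and> q = j then v else 0) = l i j * v"
proof -
  have "(\<Sum>q\<le>M. l p q * (if p = i \<and> q = j then v else 0)) = (if p = i then l i j * v else 0)" for p
    using assms by (cases "p = i") (simp_all add: if_distrib[of "\<lambda>x. _ * x"] cong: if_cong)
  then show ?thesis using assms by (simp add: pairing_def)
qed

lemma pairing_monomial_bound:
  assumes low: "\<And>p q. p + q < m \<Longrightarrow> c p q = 0" and XY: "\<bar>X\<bar> \<le> r" "\<bar>Y\<bar> \<le> r" and r: "r \<le> 1"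
  shows "\<bar>pairing M (monomial X Y) c\<bar> \<le> (\<Sum>p\<le>M. \<Sum>q\<le>M. \<bar>c p q\<bar>) * r ^ m"
proof -
  have r0: "0 \<le> r" using XY by linarith
  have trm: "\<bar>monomial X Y p q * c p q\<bar> \<le> \<bar>c p q\<bar> * r ^ m" for p q
  proof (cases "p + q < m")
    case False
    have "\<bar>monomial X Y p q\<bar> \<le> r ^ p * r ^ q"
      unfolding monomial_def abs_mult power_abs
      using XY r0 by (intro mult_mono power_mono) auto
    also have "\<dots> \<le> r ^ m"
      using False r0 r unfolding power_add[symmetric] by (intro power_decreasing) auto
    finally have "\<bar>monomial X Y p q\<bar> * \<bar>c p q\<bar> \<le> r ^ m * \<bar>c p q\<bar>" by (rule mult_right_mono) simp
    then show ?thesis by (simp add: abs_mult mult.commute)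
  qed (simp add: low r0)
  have "\<bar>pairing M (monomial X Y) c\<bar> \<le> (\<Sum>p\<le>M. \<Sum>q\<le>M. \<bar>monomial X Y p q * c p q\<bar>)"
    unfolding pairing_def by (intro order_trans[OF sum_abs] sum_mono sum_abs)
  also have "\<dots> \<le> (\<Sum>p\<le>M. \<Sum>q\<le>M. \<bar>c p q\<bar> * r ^ m)"
    by (intro sum_mono trm)
  finally show ?thesis by (simp add: sum_distrib_right)
qed

lemma monomial_has_derivative:
  "((\<lambda>z. monomial (fst z) (snd z) p q * k) has_derivative
    (\<lambda>h. real p * X ^ (p - 1) * Y ^ q * k * fst h + real q * X ^ p * Y ^ (q - 1) * k * snd h)) (at (X, Y))"
  unfolding monomial_def by (rule derivative_eq_intros refl)+ (simp add: algebra_simps)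

lemma pairing_monomial_has_derivative:
  "((\<lambda>z. pairing M (monomial (fst z) (snd z)) c) has_derivative
    (\<lambda>h. pairing M (\<lambda>p q. real p * X ^ (p - 1) * Y ^ q) c * fst h
       + pairing M (\<lambda>p q. real q * X ^ p * Y ^ (q - 1)) c * snd h)) (at (X, Y))"
proof -
  have "((\<lambda>z. pairing M (monomial (fst z) (snd z)) c) has_derivative
      (\<lambda>h. \<Sum>p\<le>M. \<Sum>q\<le>M. real p * X ^ (p - 1) * Y ^ q * c p q * fst h + real q * X ^ p * Y ^ (q - 1) * c p q * snd h)) (at (X, Y))"
    unfolding pairing_def by (intro has_derivative_sum monomial_has_derivative)
  then show ?thesis
    by (rule has_derivative_eq_rhs) (simp add: pairing_def sum.distrib sum_distrib_right)
qed

lemma lie_adjoint_monomial: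
  "lie_adjoint a1 a2 a3 b1 b2 b3 (monomial X Y) p q =
     real p * X ^ (p - 1) * Y ^ q * (- Y * (1 + a1 * X) * (1 + a2 * X + a3 * Y))
   + real q * X ^ p * Y ^ (q - 1) * (X * (1 + b1 * Y) * (1 + b2 * X + b3 * Y))"
  by (cases p; cases q) (simp_all add: lie_adjoint_def monomial_def algebra_simps power2_eq_square)

text \<open>On the array of monomials the transpose is the field acting on \<open>X^p Y^q\<close>.
  So \<open>pairing_lie_coeff\<close> becomes the chain rule, and no products of polynomials have to
  be expanded.\<close>

lemma lie_derivative_pairing:
  assumes "bounded_support n c" "n + 3 \<le> M"
  shows "pairing M (\<lambda>p q. real p * X ^ (p - 1) * Y ^ q) c * (- Y * (1 + a1 * X) * (1 + a2 * X + a3 * Y))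
       + pairing M (\<lambda>p q. real q * X ^ p * Y ^ (q - 1)) c * (X * (1 + b1 * Y) * (1 + b2 * X + b3 * Y))
       = pairing M (monomial X Y) (lie_coeff a1 a2 a3 b1 b2 b3 c)"
proof -
  define F G where "F = - Y * (1 + a1 * X) * (1 + a2 * X + a3 * Y)" and "G = X * (1 + b1 * Y) * (1 + b2 * X + b3 * Y)"
  show ?thesis
    unfolding pairing_lie_coeff[OF assms] unfolding pairing_def lie_adjoint_monomial F_def[symmetric] G_def[symmetric]
    unfolding sum_distrib_right sum.distrib[symmetric] by (intro sum.cong refl) (simp add: algebra_simps)
qed

lemma lie_coeff_linear:
  "lie_coeff a1 a2 a3 b1 b2 b3 (\<lambda>p q. c p q + k * e p q) p q
   = lie_coeff a1 a2 a3 b1 b2 b3 c p q + k * lie_coeff a1 a2 a3 b1 b2 b3 e p q"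
  by (simp add: lie_coeff_def shX_def shY_def dX_def dY_def algebra_simps split: nat.split)

section \<open>The homological equation of the linear rotation\<close>

definition rotation_coeff :: "(nat \<Rightarrow> real) \<Rightarrow> nat \<Rightarrow> nat \<Rightarrow> real" where
  "rotation_coeff h p q = (if p = 0 then 0 else real (q + 1) * h (q + 1)) - (if q = 0 then 0 else real (p + 1) * h (q - 1))"

definition homogeneous :: "nat \<Rightarrow> (nat \<Rightarrow> real) \<Rightarrow> nat \<Rightarrow> nat \<Rightarrow> real" where
  "homogeneous n h p q = (if p + q = n then h q else 0)"

text \<open>The nonlinear terms of the field raise the degree, so a correction of degree
  \<open>n\<close> acts in its own degree through \<open>X d/dY - Y d/dX\<close> alone and leaves
  the lower degrees untouched. The argument of \<open>h\<close> is the exponent of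
  \<open>Y\<close>.\<close>

lemma lie_coeff_homogeneous:
  assumes "p + q \<le> n"
  shows "lie_coeff a1 a2 a3 b1 b2 b3 (homogeneous n h) p q = (if p + q = n then rotation_coeff h p q else 0)"
  using assms
  by (auto simp: lie_coeff_def shX_def shY_def dX_def dY_def homogeneous_def rotation_coeff_def split: nat.split)

text \<open>The equation \<open>rotation_coeff h p q = f q\<close> solved for its highest index; it
  links indices that differ by 2. Setting \<open>h 0 = 0\<close> is a normalization, and the
  equation at \<open>p = 0\<close> is the one left open.\<close>

fun rotation_solution :: "nat \<Rightarrow> (nat \<Rightarrow> real) \<Rightarrow> nat \<Rightarrow> real" where
  "rotation_solution n f 0 = 0"
| "rotation_solution n f (Suc 0) = f 0"
| "rotation_solution n f (Suc (Suc j)) = ((real n - real j) * rotation_solution n f j + f (Suc j)) / (real j + 2)"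

lemma rotation_coeff_solution:
  assumes "p + q = n" "p \<noteq> 0"
  shows "rotation_coeff (rotation_solution n f) p q = f q"
  using assms by (cases q) (auto simp: rotation_coeff_def field_simps)

text \<open>For even \<open>n\<close> the kernel of the rotation is spanned by a power of
  \<open>X^2 + Y^2\<close>, which permits \<open>h 0 = 0\<close>, and \<open>Y^n\<close> spans a
  complement of the image, which accounts for \<open>w\<close>. For odd \<open>n\<close> the
  rotation is bijective.\<close>

lemma rotation_solvable:
  assumes "n \<noteq> 0"
  shows "\<exists>h w. (even n \<longrightarrow> h 0 = 0) \<and> (odd n \<longrightarrow> w = 0) \<and>
     (\<forall>p q. p + q = n \<longrightarrow> rotation_coeff h p q = f q + (if p = 0 then w else 0))"
proof (cases "even n")
  case True
  let ?h = "rotation_solution n f"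
  have "rotation_coeff ?h p q = f q + (if p = 0 then - ?h (n - 1) - f n else 0)" if "p + q = n" for p q
    using rotation_coeff_solution[OF that] that assms by (cases "p = 0") (auto simp: rotation_coeff_def)
  then show ?thesis using True by (intro exI[of _ ?h] exI[of _ "- ?h (n - 1) - f n"]) auto
next
  case False
  \<comment> \<open>For odd \<open>n\<close> the recursion from 0 determines the odd indices. The
    even ones come from the other end: exchanging \<open>X\<close> and \<open>Y\<close> reverses the
    indices and changes the sign of the rotation.\<close>
  let ?k = "rotation_solution n (\<lambda>i. - f (n - i))"
  let ?h = "\<lambda>q. if odd q then rotation_solution n f q else ?k (n - q)"
  have "rotation_coeff ?h p q = f q" if pq: "p + q = n" for p q
  proof (cases "even q")
    case True
    then have "p \<noteq> 0" using pq False by (cases p) auto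
    have "rotation_coeff ?h p q = rotation_coeff (rotation_solution n f) p q"
      using True by (auto simp: rotation_coeff_def)
    then show ?thesis using rotation_coeff_solution[OF pq \<open>p \<noteq> 0\<close>] by simp
  next
    case q: False
    have "rotation_coeff ?h p q = - rotation_coeff ?k q p"
    proof (cases p)
      case 0
      then show ?thesis using q pq by (auto simp: rotation_coeff_def)
    next
      case (Suc j)
      moreover have "n - Suc q = j" "n - (q - 1) = Suc (Suc j)" using Suc pq q by (auto elim: oddE)
      ultimately show ?thesis using q pq by (auto simp: rotation_coeff_def)
    qed
    also have "\<dots> = f q"
      using rotation_coeff_solution[of q p n "\<lambda>i. - f (n - i)"] pq q odd_pos[of q] by (auto simp: add.commute)
    finally show ?thesis .
  qed
  then show ?thesis using False by (intro exI[of _ ?h] exI[of _ 0]) auto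
qed

text \<open>Modulo the image of the rotation, \<open>Y\<^sup>n\<close> is a positive multiple of the definite form \<open>X\<^sup>n + Y\<^sup>n\<close>.\<close>

lemma rotation_definite:
  assumes "even n" "n \<noteq> 0"
  shows "\<exists>h w. w < 0 \<and>
     (\<forall>p q. p + q = n \<longrightarrow> rotation_coeff h p q = (if p = 0 \<or> q = 0 then 1 else 0) + (if p = 0 then w else 0))"
proof -
  define f where "f = (\<lambda>q. if q = 0 \<or> q = n then 1 else (0::real))"
  let ?h = "rotation_solution n f"
  \<comment> \<open>All factors of the recursion are nonnegative in this range, which makes
    \<open>- ?h (n - 1) - 1\<close> negative.\<close>
  have nonneg: "0 \<le> ?h j" if "j \<le> n + 1" for j
    using that
  proof (induction j rule: less_induct)
    case (less j)
    show ?case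
    proof (cases "(n, f, j)" rule: rotation_solution.cases)
      case (3 n' f' i)
      then show ?thesis using less.IH[of i] less.prems
        by (auto simp: f_def intro!: divide_nonneg_nonneg add_nonneg_nonneg)
    qed (auto simp: f_def)
  qed
  have "rotation_coeff ?h p q = (if p = 0 \<or> q = 0 then 1 else 0) + (if p = 0 then - ?h (n - 1) - 1 else 0)"
    if "p + q = n" for p q
    using rotation_coeff_solution[OF that, of f] that assms
    by (cases "p = 0") (auto simp: rotation_coeff_def f_def)
  moreover have "- ?h (n - 1) - 1 < 0" using nonneg[of "n - 1"] by linarith
  ultimately show ?thesis by (intro exI[of _ ?h] exI[of _ "- ?h (n - 1) - 1"]) auto
qed

text \<open>Quantitative definiteness, from \<open>(X^2 + Y^2) / 4 \<le> max (X^2) (Y^2)\<close>. It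
  lets a leading form of degree \<open>n\<close> dominate remainders of degree
  \<open>n + 1\<close>.\<close>

lemma sum_even_powers_ge:
  fixes X Y :: real
  assumes "even n"
  shows "(norm (X, Y)) ^ n / 2 ^ n \<le> X ^ n + Y ^ n"
proof -
  obtain k where n: "n = 2 * k" using assms by blast
  have "(norm (X, Y)) ^ n / 2 ^ n = ((X\<^sup>2 + Y\<^sup>2) / 4) ^ k"
    by (simp add: n norm_Pair power_mult power_divide)
  also have "\<dots> \<le> (max (X\<^sup>2) (Y\<^sup>2)) ^ k"
  proof (rule power_mono)
    have "X\<^sup>2 \<le> max (X\<^sup>2) (Y\<^sup>2)" "Y\<^sup>2 \<le> max (X\<^sup>2) (Y\<^sup>2)" by simp_all
    then have "X\<^sup>2 + Y\<^sup>2 \<le> max (X\<^sup>2) (Y\<^sup>2) + max (X\<^sup>2) (Y\<^sup>2)" by (rule add_mono)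
    also have "\<dots> \<le> max (X\<^sup>2) (Y\<^sup>2) * 4"
    proof -
      have "m + m \<le> m * 4" if "0 \<le> m" for m :: real using that by simp
      then show ?thesis by (simp only: le_max_iff_disj zero_le_power2 simp_thms)
    qed
    finally show "(X\<^sup>2 + Y\<^sup>2) / 4 \<le> max (X\<^sup>2) (Y\<^sup>2)" by simp
  qed simp
  also have "\<dots> \<le> (X\<^sup>2) ^ k + (Y\<^sup>2) ^ k"
    by (auto simp: max_def)
  finally show ?thesis by (simp add: n power_mult)
qed

section \<open>Vanishing of all focal values at a center\<close>

definition normalized_to :: "nat \<Rightarrow> (nat \<Rightarrow> nat \<Rightarrow> real) \<Rightarrow> bool" where
  "normalized_to n c \<longleftrightarrow> bounded_support n c \<and> c 0 0 = 0 \<and> c 1 0 = 0 \<and> c 0 1 = 0 \<and> c 2 0 = 1 \<and> c 1 1 = 0 \<and> c 0 2 = 1"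

lemma pairing_quadratic_part:
  assumes "normalized_to n c" "3 \<le> M"
  shows "pairing M l c = l 2 0 + l 0 2 + pairing M l (\<lambda>p q. if p + q < 3 then 0 else c p q)"
proof -
  have low: "c p q = (if p = 2 \<and> q = 0 then 1 else 0) + (if p = 0 \<and> q = 2 then 1 else 0)" if "p + q < 3" for p q
  proof -
    have "p = 0 \<and> q = 0 \<or> p = 1 \<and> q = 0 \<or> p = 0 \<and> q = 1 \<or> p = 2 \<and> q = 0 \<or> p = 1 \<and> q = 1 \<or> p = 0 \<and> q = 2"
      using that by arith
    then show ?thesis using assms(1) unfolding normalized_to_def by auto
  qed
  have "c = (\<lambda>p q. ((if p = 2 \<and> q = 0 then 1 else 0) + (if p = 0 \<and> q = 2 then 1 else 0))
      + (if p + q < 3 then 0 else c p q))"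
    by (intro ext) (auto simp: low)
  then have "pairing M l c = pairing M l (\<lambda>p q. ((if p = 2 \<and> q = 0 then 1 else 0) + (if p = 0 \<and> q = 2 then 1 else 0))
      + (if p + q < 3 then 0 else c p q))" by simp
  also have "\<dots> = l 2 0 + l 0 2 + pairing M l (\<lambda>p q. if p + q < 3 then 0 else c p q)"
    using assms(2) by (simp add: pairing_add pairing_single)
  finally show ?thesis .
qed

text \<open>A derivative that begins with \<open>v (X^n + Y^n)\<close> has the sign of
  \<open>v\<close> near the origin, and the integral begins with \<open>X^2 + Y^2\<close>. For
  \<open>v \<noteq> 0\<close> it would be a strict Lyapunov function in one direction of
  time.\<close>

lemma center_no_focal_value:
  assumes center: "is_center F (x0, y0)" and ab: "\<alpha> \<noteq> 0" "\<beta> \<noteq> 0"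
    and F: "\<And>X Y. F (x0 + \<alpha> * X, y0 + \<beta> * Y)
      = (\<alpha> * (- Y * (1 + a1 * X) * (1 + a2 * X + a3 * Y)), \<beta> * (X * (1 + b1 * Y) * (1 + b2 * X + b3 * Y)))"
    and c: "normalized_to n c" and n: "even n" "3 \<le> n"
    and lie: "\<And>p q. p + q < n \<Longrightarrow> lie_coeff a1 a2 a3 b1 b2 b3 c p q = 0"
    and top: "\<And>p q. p + q = n \<Longrightarrow> lie_coeff a1 a2 a3 b1 b2 b3 c p q = (if p = 0 \<or> q = 0 then v else 0)"
  shows "v = 0"
proof (rule ccontr)
  assume v: "v \<noteq> 0"
  define M where "M = n + 3"
  let ?L = "lie_coeff a1 a2 a3 b1 b2 b3 c"
  define f where "f = (\<lambda>X Y. - Y * (1 + a1 * X) * (1 + a2 * X + a3 * Y))"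
  define g where "g = (\<lambda>X Y. X * (1 + b1 * Y) * (1 + b2 * X + b3 * Y))"
  define V where "V = (\<lambda>X Y. pairing M (monomial X Y) c)"
  define VX where "VX = (\<lambda>X Y. pairing M (\<lambda>p q. real p * X ^ (p - 1) * Y ^ q) c)"
  define VY where "VY = (\<lambda>X Y. pairing M (\<lambda>p q. real q * X ^ p * Y ^ (q - 1)) c)"
  define c3 where "c3 = (\<lambda>p q. if p + q < 3 then 0 else c p q)"
  define L1 where "L1 = (\<lambda>p q. if p + q < n + 1 then 0 else ?L p q)"
  define K1 where "K1 = (\<Sum>p\<le>M. \<Sum>q\<le>M. \<bar>c3 p q\<bar>)"
  define K2 where "K2 = (\<Sum>p\<le>M. \<Sum>q\<le>M. \<bar>L1 p q\<bar>)"
  have K: "0 \<le> K1" "0 \<le> K2" by (auto simp: K1_def K2_def intro!: sum_nonneg)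
  have supp: "bounded_support n c" using c by (simp add: normalized_to_def)
  have Lf: "?L = (\<lambda>p q. ((if p = n \<and> q = 0 then v else 0) + (if p = 0 \<and> q = n then v else 0)) + L1 p q)"
  proof (intro ext)
    fix p q
    show "?L p q = ((if p = n \<and> q = 0 then v else 0) + (if p = 0 \<and> q = n then v else 0)) + L1 p q"
      using lie[of p q] top[of p q] n by (cases "p + q" n rule: linorder_cases) (auto simp: L1_def)
  qed
  have dot: "VX X Y * f X Y + VY X Y * g X Y = v * (X ^ n + Y ^ n) + pairing M (monomial X Y) L1" for X Y
  proof -
    have "VX X Y * f X Y + VY X Y * g X Y = pairing M (monomial X Y) ?L"
      unfolding VX_def VY_def f_def g_def by (rule lie_derivative_pairing[OF supp]) (simp add: M_def)
    also have "\<dots> = v * (X ^ n + Y ^ n) + pairing M (monomial X Y) L1"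
      by (subst Lf) (simp add: pairing_add pairing_single M_def monomial_def algebra_simps)
    finally show ?thesis .
  qed
  have Veq: "V X Y = X\<^sup>2 + Y\<^sup>2 + pairing M (monomial X Y) c3" for X Y
    unfolding V_def c3_def by (subst pairing_quadratic_part[OF c]) (simp_all add: M_def monomial_def)
  \<comment> \<open>Up to radius \<open>e\<close> the part of \<open>V\<close> beyond its quadratic
    terms is smaller than \<open>X^2 + Y^2\<close>, and the part of the derivative of order
    \<open>n + 1\<close> is smaller than \<open>\<bar>v\<bar> * r^n / 2^n\<close>, the lower bound
    of its leading form.\<close>
  define e where "e = min 1 (min (1 / (2 * (K1 + 1))) (\<bar>v\<bar> / (2 ^ n * 2 * (K2 + 1))))"
  have e: "0 < e" "e \<le> 1" "e \<le> 1 / (2 * (K1 + 1))" "e \<le> \<bar>v\<bar> / (2 ^ n * 2 * (K2 + 1))"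
    using v K by (auto simp: e_def)
  have small1: "K1 * r < 1" if "0 < r" "r \<le> e" for r
  proof -
    have "r * (2 * (K1 + 1)) \<le> 1"
      using order_trans[OF that(2) e(3)] K by (simp add: pos_le_divide_eq)
    then have "2 * (K1 * r) + 2 * r \<le> 1" by (simp add: algebra_simps)
    moreover have "0 \<le> K1 * r" using K that by simp
    ultimately show ?thesis using that by linarith
  qed
  have small2: "K2 * r < \<bar>v\<bar> / 2 ^ n" if "0 < r" "r \<le> e" for r
  proof -
    have "r * (2 ^ n * 2 * (K2 + 1)) \<le> \<bar>v\<bar>"
      using order_trans[OF that(2) e(4)] K by (simp add: pos_le_divide_eq)
    then have "2 * (K2 * r) + 2 * r \<le> \<bar>v\<bar> / 2 ^ n" by (simp add: field_simps)
    moreover have "0 \<le> K2 * r" using K that by simp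
    ultimately show ?thesis using that by linarith
  qed
  have abs_le: "\<bar>X\<bar> \<le> norm (X, Y)" "\<bar>Y\<bar> \<le> norm (X, Y)" for X Y :: real
    using norm_fst_le[of X Y] norm_snd_le[of Y X] by simp_all
  show False
  proof (rule strict_lyapunov_not_center[OF center ab, of f g V VX VY e "- sgn v"])
    show "F (x0 + \<alpha> * X, y0 + \<beta> * Y) = (\<alpha> * f X Y, \<beta> * g X Y)" for X Y
      unfolding F f_def g_def ..
    show "((\<lambda>z. V (fst z) (snd z)) has_derivative (\<lambda>h. VX X Y * fst h + VY X Y * snd h)) (at (X, Y))" for X Y
      unfolding V_def VX_def VY_def by (rule pairing_monomial_has_derivative)
    have "pairing M (monomial 0 0) c3 = 0"
      unfolding pairing_def by (intro sum.neutral ballI) (auto simp: monomial_def c3_def power_0_left)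
    then show "V 0 0 = 0" by (simp add: Veq)
    show "0 < e" by (rule e)
    show "- sgn v = 1 \<or> - sgn v = - 1" using v by (auto simp: sgn_if)
    fix X Y :: real
    let ?r = "norm (X, Y)"
    assume XY: "(X, Y) \<noteq> 0" "?r \<le> e"
    have r: "0 < ?r" "?r \<le> 1" using XY e by auto
    have "\<bar>pairing M (monomial X Y) c3\<bar> \<le> K1 * ?r ^ 3"
      unfolding K1_def by (rule pairing_monomial_bound) (use abs_le r in \<open>auto simp: c3_def\<close>)
    also have "\<dots> < ?r\<^sup>2"
      using mult_strict_right_mono[OF small1[OF r(1) XY(2)], of "?r\<^sup>2"] r(1)
      by (simp add: power2_eq_square power3_eq_cube mult.assoc)
    also have "\<dots> = X\<^sup>2 + Y\<^sup>2" by (simp add: norm_Pair)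
    finally show "0 < V X Y" by (simp add: Veq abs_if split: if_splits)
    have "\<bar>pairing M (monomial X Y) L1\<bar> \<le> K2 * ?r ^ (n + 1)"
      unfolding K2_def by (rule pairing_monomial_bound) (use abs_le r in \<open>auto simp: L1_def\<close>)
    also have "\<dots> < \<bar>v\<bar> * (?r ^ n / 2 ^ n)"
      using mult_strict_right_mono[OF small2[OF r(1) XY(2)], of "?r ^ n"] r(1) by (simp add: mult_ac)
    also have "\<dots> \<le> \<bar>v\<bar> * (X ^ n + Y ^ n)"
      using sum_even_powers_ge[OF n(1)] by (intro mult_left_mono) auto
    finally have "\<bar>pairing M (monomial X Y) L1\<bar> < \<bar>v\<bar> * (X ^ n + Y ^ n)" .
    then show "- sgn v * (VX X Y * f X Y + VY X Y * g X Y) < 0"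
      unfolding dot using v by (cases "v > 0") (auto simp: algebra_simps)
  qed
qed

text \<open>Each degree receives a homogeneous correction, which in even degree may leave a multiple
  of the pure power of \<open>Y\<close>. Exchanging this power for a definite form turns the
  multiple into a focal value. Requiring \<open>c k 0 = 0\<close> for even \<open>k\<close> fixes
  the freedom of adding powers of \<open>X^2 + Y^2\<close>.\<close>

theorem center_formal_integral:
  assumes center: "is_center F (x0, y0)" and ab: "\<alpha> \<noteq> 0" "\<beta> \<noteq> 0"
    and F: "\<And>X Y. F (x0 + \<alpha> * X, y0 + \<beta> * Y)
      = (\<alpha> * (- Y * (1 + a1 * X) * (1 + a2 * X + a3 * Y)), \<beta> * (X * (1 + b1 * Y) * (1 + b2 * X + b3 * Y)))"
    and n: "2 \<le> n"
  shows "\<exists>c. normalized_to n c \<and> (\<forall>k>2. even k \<longrightarrow> c k 0 = 0) \<and>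
     (\<forall>p q. p + q \<le> n \<longrightarrow> lie_coeff a1 a2 a3 b1 b2 b3 c p q = 0)"
  using n
proof (induction n rule: dec_induct)
  case base
  let ?c = "homogeneous 2 (\<lambda>q. if q = 1 then 0 else 1)"
  have "normalized_to 2 ?c" by (auto simp: normalized_to_def bounded_support_def homogeneous_def)
  moreover have "lie_coeff a1 a2 a3 b1 b2 b3 ?c p q = 0" if "p + q \<le> 2" for p q
  proof -
    have "p + q = 2 \<Longrightarrow> (p = 0 \<and> q = 2) \<or> (p = 1 \<and> q = 1) \<or> (p = 2 \<and> q = 0)" by arith
    then show ?thesis
      unfolding lie_coeff_homogeneous[OF that] by (auto simp: rotation_coeff_def)
  qed
  moreover have "?c k 0 = 0" if "2 < k" for k using that by (simp add: homogeneous_def)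
  ultimately show ?case by blast
next
  case (step n)
  let ?L = "lie_coeff a1 a2 a3 b1 b2 b3"
  let ?n = "Suc n"
  from step.IH obtain c where c: "normalized_to n c" "\<And>k. 2 < k \<Longrightarrow> even k \<Longrightarrow> c k 0 = 0"
    "\<And>p q. p + q \<le> n \<Longrightarrow> ?L c p q = 0" by blast
  obtain h w where h: "even ?n \<Longrightarrow> h 0 = 0" "odd ?n \<Longrightarrow> w = 0"
    "\<And>p q. p + q = ?n \<Longrightarrow> rotation_coeff h p q = - ?L c (?n - q) q + (if p = 0 then w else 0)"
    using rotation_solvable[of ?n "\<lambda>q. - ?L c (?n - q) q"] by blast
  define c' where "c' = (\<lambda>p q. c p q + 1 * homogeneous ?n h p q)"
  have ext: "normalized_to ?n (\<lambda>p q. e p q + k * homogeneous ?n h' p q)" if "normalized_to ?n e" for e k h'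
    using that step.hyps by (auto simp: normalized_to_def bounded_support_def homogeneous_def)
  have "normalized_to ?n c"
    using c(1) by (auto simp: normalized_to_def intro: bounded_support_mono)
  note norm' = ext[OF this, of 1 h, folded c'_def]
  have lie': "?L c' p q = (if p + q = ?n \<and> p = 0 then w else 0)" if "p + q \<le> ?n" for p q
  proof (cases "p + q = ?n")
    case True
    then have "?n - q = p" by simp
    then show ?thesis
      unfolding c'_def lie_coeff_linear lie_coeff_homogeneous[OF that] using h(3)[OF True] True by simp
  next
    case False
    then show ?thesis
      unfolding c'_def lie_coeff_linear lie_coeff_homogeneous[OF that] using c(3)[of p q] that by simp
  qed
  have "w = 0"
  proof (cases "even ?n")
    case True
    obtain h' w' where h': "w' < 0" "\<And>p q. p + q = ?n \<Longrightarrow>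
        rotation_coeff h' p q = (if p = 0 \<or> q = 0 then 1 else 0) + (if p = 0 then w' else 0)"
      using rotation_definite[OF True] by auto
    \<comment> \<open>Chosen so that \<open>w + v * w' = 0\<close>: adding \<open>v\<close> times
      the solution \<open>h'\<close> cancels the pure power of \<open>Y\<close> and leaves
      \<open>v\<close> times the definite form.\<close>
    define v where "v = - w / w'"
    have "v = 0"
    proof (rule center_no_focal_value[OF center ab F, of ?n "\<lambda>p q. c' p q + v * homogeneous ?n h' p q"])
      show "normalized_to ?n (\<lambda>p q. c' p q + v * homogeneous ?n h' p q)" by (rule ext[OF norm'])
      show "even ?n" "3 \<le> ?n" using True step.hyps by auto
      fix p q
      show "?L (\<lambda>p q. c' p q + v * homogeneous ?n h' p q) p q = 0" if "p + q < ?n"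
        using that unfolding lie_coeff_linear by (simp add: lie_coeff_homogeneous lie')
      show "?L (\<lambda>p q. c' p q + v * homogeneous ?n h' p q) p q = (if p = 0 \<or> q = 0 then v else 0)" if "p + q = ?n"
        using that h'(1) unfolding lie_coeff_linear by (simp add: lie_coeff_homogeneous lie' h'(2) v_def field_simps)
    qed
    then show ?thesis using h'(1) by (simp add: v_def)
  qed (rule h(2))
  then have "?L c' p q = 0" if "p + q \<le> ?n" for p q using lie'[OF that] by simp
  moreover have "c' k 0 = 0" if "2 < k" "even k" for k
    using c(2)[OF that] h(1) that by (auto simp: c'_def homogeneous_def)
  ultimately show ?case using norm' by blast
qed

section \<open>Focal values\<close>

text \<open>In degree 4 the equations at \<open>X^4\<close>, \<open>X^2 Y^2\<close> and
  \<open>Y^4\<close> are three conditions on the two unknowns \<open>c 3 1\<close> and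
  \<open>c 1 3\<close>; the relation is their compatibility.\<close>

lemma first_focal_value:
  assumes lie: "\<And>p q. p + q \<le> 4 \<Longrightarrow> lie_coeff a1 a2 a3 b1 b2 b3 c p q = 0"
    and c: "c 0 0 = 0" "c 1 0 = 0" "c 0 1 = 0" "c 2 0 = 1" "c 1 1 = 0" "c 0 2 = 1"
  shows "a2 * a3 = b2 * b3"
proof -
  note d = lie_coeff_def shX_def shY_def dX_def dY_def eval_nat_numeral
  have "c 2 1 = 0" "c 1 2 = 0" "c 3 1 = 0" "c 1 3 = 0"
    using lie[of 3 0] lie[of 0 3] lie[of 4 0] lie[of 0 4] c by (simp_all add: d)
  moreover have "- (3 * c 3 0) + 2 * c 1 2 - 2 * (a1 + a2) + 2 * b2 = 0"
    using lie[of 2 1] c by (simp add: d algebra_simps)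
  moreover have "- (2 * c 2 1) + 3 * c 0 3 - 2 * a3 + 2 * (b1 + b3) = 0"
    using lie[of 1 2] c by (simp add: d algebra_simps)
  moreover have "- (3 * c 3 1) + 3 * c 1 3 - 2 * (a1 + a2) * c 2 1 - 3 * a3 * c 3 0
      - 2 * a1 * a3 + 3 * b2 * c 0 3 + 2 * (b1 + b3) * c 1 2 + 2 * b1 * b2 = 0"
    using lie[of 2 2] c by (simp add: d algebra_simps)
  ultimately show ?thesis by algebra
qed

text \<open>The situation after scaling to \<open>b2 = 1\<close>: the parameters \<open>a\<close>,
  \<open>b\<close>, \<open>u\<close>, \<open>d\<close> stand for \<open>a1\<close>,
  \<open>b1\<close>, \<open>a2\<close>, \<open>a3\<close> divided by \<open>b2\<close>, and the
  first focal value has already replaced \<open>b3\<close> by \<open>u * d\<close>. Degree 12 is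
  what the fifth focal value requires.\<close>

locale normalized_integral =
  fixes a b u d :: real and c :: "nat \<Rightarrow> nat \<Rightarrow> real"
  assumes supp: "bounded_support 12 c"
    and lie_zero: "p + q \<le> 12 \<Longrightarrow> lie_coeff a u d b 1 (u*d) c p q = 0"
    and low: "c 0 0 = 0" "c 1 0 = 0" "c 0 1 = 0" "c 2 0 = 1" "c 1 1 = 0" "c 0 2 = 1"
    and pure: "c 4 0 = 0" "c 6 0 = 0"
begin

abbreviation adj :: "(nat \<Rightarrow> nat \<Rightarrow> real) \<Rightarrow> nat \<Rightarrow> nat \<Rightarrow> real" where
  "adj \<equiv> lie_adjoint a u d b 1 (u*d)"

section \<open>Coefficients of the integral up to degree six\<close>

lemma eq30: "(1)*c 2 1+(1)*c 1 1 = 0"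
  using lie_zero[of 3 0]
  by (simp add: lie_coeff_def shX_def shY_def dX_def dY_def eval_nat_numeral algebra_simps)

lemma c21: "c 2 1 = 0"
  using eq30 unfolding low pure by simp

lemma eq12: "(- 2)*c 2 1+(3)*c 0 3+(- 1*a - u)*c 1 1+(- 2*d)*c 2 0+(- 1*a*d)*c 1 0+(2*b + 2*u*d)*c 0 2+(b*u*d)*c 0 1 = 0"
  using lie_zero[of 1 2]
  by (simp add: lie_coeff_def shX_def shY_def dX_def dY_def eval_nat_numeral algebra_simps)

text \<open>Such values are stated for an integer multiple of the coefficient, so that all
  polynomials have integer coefficients. The equation with the same two digits as an
  \<open>eq\<close> name is the one at that power of \<open>X\<close> and of
  \<open>Y\<close>.\<close>

lemma c03: "3*c 0 3 = - 2*b - 2*u*d + 2*d"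
  using eq12[unfolded low pure c21] by algebra

lemma eq03: "(- 1)*c 1 2+(- 1*d)*c 1 1 = 0"
  using lie_zero[of 0 3]
  by (simp add: lie_coeff_def shX_def shY_def dX_def dY_def eval_nat_numeral algebra_simps)

lemma c12: "c 1 2 = 0"
  using eq03 unfolding low pure by simp

lemma eq21: "(- 3)*c 3 0+(2)*c 1 2+(- 2*a - 2*u)*c 2 0+(- 1*a*u)*c 1 0+(2)*c 0 2+(b + u*d)*c 1 1+(b)*c 0 1 = 0"
  using lie_zero[of 2 1]
  by (simp add: lie_coeff_def shX_def shY_def dX_def dY_def eval_nat_numeral algebra_simps)

lemma c30: "3*c 3 0 = - 2*a - 2*u + 2"
  using eq21[unfolded low pure c12] by algebra

lemma eq40: "(1)*c 3 1+(1)*c 2 1 = 0"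
  using lie_zero[of 4 0]
  by (simp add: lie_coeff_def shX_def shY_def dX_def dY_def eval_nat_numeral algebra_simps)

lemma c31: "c 3 1 = 0"
  using eq40 unfolding low pure c21 by simp

lemma eq31: "(- 4)*c 4 0+(2)*c 2 2+(- 3*a - 3*u)*c 3 0+(- 2*a*u)*c 2 0+(2)*c 1 2+(b + u*d)*c 2 1+(b)*c 1 1 = 0"
  using lie_zero[of 3 1]
  by (simp add: lie_coeff_def shX_def shY_def dX_def dY_def eval_nat_numeral algebra_simps)

lemma c22: "c 2 2 = - 1*a^2 - a*u + a - u^2 + u" (is "_ = ?r")
proof -
  have "2*(c 2 2) = (a + u)*(3*c 3 0)+(2*a*u)"
    using eq31[unfolded low pure c12 c21] by algebra
  also have "\<dots> = 2*?r"
    unfolding c30 by algebra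
  finally show ?thesis by (metis mult_left_cancel zero_neq_numeral)
qed

lemma eq22: "(- 3)*c 3 1+(3)*c 1 3+(- 2*a - 2*u)*c 2 1+(- 3*d)*c 3 0+(- 1*a*u)*c 1 1+(- 2*a*d)*c 2 0+(3)*c 0 3+(2*b + 2*u*d)*c 1 2+(2*b)*c 0 2+(b*u*d)*c 1 1 = 0"
  using lie_zero[of 2 2]
  by (simp add: lie_coeff_def shX_def shY_def dX_def dY_def eval_nat_numeral algebra_simps)

text \<open>The right-hand side collapses to 0 because \<open>b3\<close> has been replaced by
  \<open>u * d\<close>, that is, because the first focal value vanishes.\<close>

lemma c13: "c 1 3 = 0" (is "_ = ?r")
proof -
  have "3*(c 1 3) = (d)*(3*c 3 0)+(2*a*d)+(- 1)*(3*c 0 3)+(- 2*b)"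
    using eq22[unfolded low pure c12 c21 c31] by algebra
  also have "\<dots> = 3*?r"
    unfolding c03 c30 by algebra
  finally show ?thesis by (metis mult_left_cancel zero_neq_numeral)
qed

lemma eq13: "(- 2)*c 2 2+(4)*c 0 4+(- 1*a - u)*c 1 2+(- 2*d)*c 2 1+(- 1*a*d)*c 1 1+(3*b + 3*u*d)*c 0 3+(2*b*u*d)*c 0 2 = 0"
  using lie_zero[of 1 3]
  by (simp add: lie_coeff_def shX_def shY_def dX_def dY_def eval_nat_numeral algebra_simps)

lemma c04: "2*c 0 4 = - 1*a^2 - a*u + a + b^2 + b*u*d - b*d + u^2*d^2 - u^2 - u*d^2 + u" (is "_ = ?r")
proof -
  have "2*(2*c 0 4) = (2)*(c 2 2)+(- 1*b - u*d)*(3*c 0 3)+(- 2*b*u*d)"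
    using eq13[unfolded low pure c12 c21] by algebra
  also have "\<dots> = 2*?r"
    unfolding c03 c22 by algebra
  finally show ?thesis by (metis mult_left_cancel zero_neq_numeral)
qed

lemma eq50: "(1)*c 4 1+(1)*c 3 1 = 0"
  using lie_zero[of 5 0]
  by (simp add: lie_coeff_def shX_def shY_def dX_def dY_def eval_nat_numeral algebra_simps)

lemma c41: "c 4 1 = 0"
  using eq50 unfolding low pure c31 by simp

lemma eq32: "(- 4)*c 4 1+(3)*c 2 3+(- 3*a - 3*u)*c 3 1+(- 4*d)*c 4 0+(- 2*a*u)*c 2 1+(- 3*a*d)*c 3 0+(3)*c 1 3+(2*b + 2*u*d)*c 2 2+(2*b)*c 1 2+(b*u*d)*c 2 1 = 0"
  using lie_zero[of 3 2]
  by (simp add: lie_coeff_def shX_def shY_def dX_def dY_def eval_nat_numeral algebra_simps)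

lemma c23: "3*c 2 3 = 2*a^2*b + 2*a^2*u*d - 2*a^2*d + 2*a*b*u - 2*a*b + 2*a*u^2*d - 4*a*u*d + 2*a*d + 2*b*u^2 - 2*b*u + 2*u^3*d - 2*u^2*d" (is "_ = ?r")
proof -
  have "3*c 2 3 = (a*d)*(3*c 3 0)+(- 2*b - 2*u*d)*(c 2 2)"
    using eq32[unfolded low pure c12 c13 c21 c31 c41] by algebra
  also have "\<dots> = ?r"
    unfolding c22 c30 by algebra
  finally show ?thesis .
qed

lemma eq14: "(- 2)*c 2 3+(5)*c 0 5+(- 1*a - u)*c 1 3+(- 2*d)*c 2 2+(- 1*a*d)*c 1 2+(4*b + 4*u*d)*c 0 4+(3*b*u*d)*c 0 3 = 0"
  using lie_zero[of 1 4]
  by (simp add: lie_coeff_def shX_def shY_def dX_def dY_def eval_nat_numeral algebra_simps)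

lemma c05: "15*c 0 5 = 10*a^2*b + 10*a^2*u*d - 10*a^2*d + 10*a*b*u - 10*a*b + 10*a*u^2*d - 20*a*u*d + 10*a*d - 6*b^3 - 6*b^2*u*d + 6*b^2*d - 6*b*u^2*d^2 + 10*b*u^2 + 6*b*u*d^2 - 10*b*u - 6*u^3*d^3 + 10*u^3*d + 6*u^2*d^3 - 16*u^2*d + 6*u*d" (is "_ = ?r")
proof -
  have "15*c 0 5 = (2)*(3*c 2 3)+(6*d)*(c 2 2)+(- 6*b - 6*u*d)*(2*c 0 4)+(- 3*b*u*d)*(3*c 0 3)"
    using eq14[unfolded low pure c12 c13] by algebra
  also have "\<dots> = ?r"
    unfolding c03 c04 c22 c23 by algebra
  finally show ?thesis .
qed

lemma eq05: "(- 1)*c 1 4+(- 1*d)*c 1 3 = 0"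
  using lie_zero[of 0 5]
  by (simp add: lie_coeff_def shX_def shY_def dX_def dY_def eval_nat_numeral algebra_simps)

lemma c14: "c 1 4 = 0"
  using eq05 unfolding low pure c13 by simp

lemma eq23: "(- 3)*c 3 2+(4)*c 1 4+(- 2*a - 2*u)*c 2 2+(- 3*d)*c 3 1+(- 1*a*u)*c 1 2+(- 2*a*d)*c 2 1+(4)*c 0 4+(3*b + 3*u*d)*c 1 3+(3*b)*c 0 3+(2*b*u*d)*c 1 2 = 0"
  using lie_zero[of 2 3]
  by (simp add: lie_coeff_def shX_def shY_def dX_def dY_def eval_nat_numeral algebra_simps)

lemma c32: "3*c 3 2 = 2*a^3 + 4*a^2*u - 4*a^2 + 4*a*u^2 - 6*a*u + 2*a + 2*u^3 + 2*u^2*d^2 - 4*u^2 - 2*u*d^2 + 2*u" (is "_ = ?r")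
proof -
  have "3*c 3 2 = (- 2*a - 2*u)*(c 2 2)+(2)*(2*c 0 4)+(b)*(3*c 0 3)"
    using eq23[unfolded low pure c12 c13 c14 c21 c31] by algebra
  also have "\<dots> = ?r"
    unfolding c03 c04 c22 by algebra
  finally show ?thesis .
qed

lemma eq41: "(- 5)*c 5 0+(2)*c 3 2+(- 4*a - 4*u)*c 4 0+(- 3*a*u)*c 3 0+(2)*c 2 2+(b + u*d)*c 3 1+(b)*c 2 1 = 0"
  using lie_zero[of 4 1]
  by (simp add: lie_coeff_def shX_def shY_def dX_def dY_def eval_nat_numeral algebra_simps)

lemma c50: "15*c 5 0 = 4*a^3 + 14*a^2*u - 14*a^2 + 14*a*u^2 - 24*a*u + 10*a + 4*u^3 + 4*u^2*d^2 - 14*u^2 - 4*u*d^2 + 10*u" (is "_ = ?r")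
proof -
  have "15*c 5 0 = (2)*(3*c 3 2)+(- 3*a*u)*(3*c 3 0)+(6)*(c 2 2)"
    using eq41[unfolded low pure c21 c31] by algebra
  also have "\<dots> = ?r"
    unfolding c22 c30 c32 by algebra
  finally show ?thesis .
qed

lemma eq60: "(1)*c 5 1+(1)*c 4 1 = 0"
  using lie_zero[of 6 0]
  by (simp add: lie_coeff_def shX_def shY_def dX_def dY_def eval_nat_numeral algebra_simps)

lemma c51: "c 5 1 = 0"
  using eq60 unfolding low pure c41 by simp

lemma eq51: "(- 6)*c 6 0+(2)*c 4 2+(- 5*a - 5*u)*c 5 0+(- 4*a*u)*c 4 0+(2)*c 3 2+(b + u*d)*c 4 1+(b)*c 3 1 = 0"
  using lie_zero[of 5 1]
  by (simp add: lie_coeff_def shX_def shY_def dX_def dY_def eval_nat_numeral algebra_simps)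

lemma c42: "3*c 4 2 = 2*a^4 + 9*a^3*u - 9*a^3 + 14*a^2*u^2 - 23*a^2*u + 9*a^2 + 9*a*u^3 + 2*a*u^2*d^2 - 23*a*u^2 - 2*a*u*d^2 + 16*a*u - 2*a + 2*u^4 + 2*u^3*d^2 - 9*u^3 - 4*u^2*d^2 + 9*u^2 + 2*u*d^2 - 2*u" (is "_ = ?r")
proof -
  have "2*(3*c 4 2) = (a + u)*(15*c 5 0)+(- 2)*(3*c 3 2)"
    using eq51[unfolded low pure c31 c41] by algebra
  also have "\<dots> = 2*?r"
    unfolding c32 c50 by algebra
  finally show ?thesis by (metis mult_left_cancel zero_neq_numeral)
qed

lemma eq42: "(- 5)*c 5 1+(3)*c 3 3+(- 4*a - 4*u)*c 4 1+(- 5*d)*c 5 0+(- 3*a*u)*c 3 1+(- 4*a*d)*c 4 0+(3)*c 2 3+(2*b + 2*u*d)*c 3 2+(2*b)*c 2 2+(b*u*d)*c 3 1 = 0"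
  using lie_zero[of 4 2]
  by (simp add: lie_coeff_def shX_def shY_def dX_def dY_def eval_nat_numeral algebra_simps)

lemma c33: "9*c 3 3 = - 4*a^3*b - 4*a^3*u*d + 4*a^3*d - 8*a^2*b*u + 8*a^2*b - 8*a^2*u^2*d + 16*a^2*u*d - 8*a^2*d - 8*a*b*u^2 + 12*a*b*u - 4*a*b - 8*a*u^3*d + 20*a*u^2*d - 16*a*u*d + 4*a*d - 4*b*u^3 - 4*b*u^2*d^2 + 8*b*u^2 + 4*b*u*d^2 - 4*b*u - 4*u^4*d - 4*u^3*d^3 + 6*u^3*d + 8*u^2*d^3 - 12*u^2*d - 4*u*d^3 + 10*u*d" (is "_ = ?r")
proof -
  have "9*c 3 3 = (d)*(15*c 5 0)+(- 3)*(3*c 2 3)+(- 2*b - 2*u*d)*(3*c 3 2)+(- 6*b)*(c 2 2)"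
    using eq42[unfolded low pure c31 c41 c51] by algebra
  also have "\<dots> = ?r"
    unfolding c22 c23 c32 c50 by algebra
  finally show ?thesis .
qed

lemma eq33: "(- 4)*c 4 2+(4)*c 2 4+(- 3*a - 3*u)*c 3 2+(- 4*d)*c 4 1+(- 2*a*u)*c 2 2+(- 3*a*d)*c 3 1+(4)*c 1 4+(3*b + 3*u*d)*c 2 3+(3*b)*c 1 3+(2*b*u*d)*c 2 2 = 0"
  using lie_zero[of 3 3]
  by (simp add: lie_coeff_def shX_def shY_def dX_def dY_def eval_nat_numeral algebra_simps)

lemma c24: "6*c 2 4 = 7*a^4 + 24*a^3*u - 24*a^3 - 3*a^2*b^2 - 3*a^2*b*u*d + 3*a^2*b*d - 3*a^2*u^2*d^2 + 37*a^2*u^2 + 3*a^2*u*d^2 - 58*a^2*u + 21*a^2 - 3*a*b^2*u + 3*a*b^2 - 3*a*b*u^2*d + 6*a*b*u*d - 3*a*b*d - 3*a*u^3*d^2 + 24*a*u^3 + 13*a*u^2*d^2 - 58*a*u^2 - 10*a*u*d^2 + 38*a*u - 4*a - 3*b^2*u^2 + 3*b^2*u - 3*b*u^3*d + 3*b*u^2*d - 3*u^4*d^2 + 7*u^4 + 10*u^3*d^2 - 24*u^3 - 11*u^2*d^2 + 21*u^2 + 4*u*d^2 - 4*u" (is "_ = ?r")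
proof -
  have "2*(6*c 2 4) = (4)*(3*c 4 2)+(3*a + 3*u)*(3*c 3 2)+(6*a*u)*(c 2 2)+(- 3*b - 3*u*d)*(3*c 2 3)+(- 6*b*u*d)*(c 2 2)"
    using eq33[unfolded low pure c13 c14 c31 c41] by algebra
  also have "\<dots> = 2*?r"
    unfolding c22 c23 c32 c42 by algebra
  finally show ?thesis by (metis mult_left_cancel zero_neq_numeral)
qed

lemma eq24: "(- 3)*c 3 3+(5)*c 1 5+(- 2*a - 2*u)*c 2 3+(- 3*d)*c 3 2+(- 1*a*u)*c 1 3+(- 2*a*d)*c 2 2+(5)*c 0 5+(4*b + 4*u*d)*c 1 4+(4*b)*c 0 4+(3*b*u*d)*c 1 3 = 0"
  using lie_zero[of 2 4]
  by (simp add: lie_coeff_def shX_def shY_def dX_def dY_def eval_nat_numeral algebra_simps)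

text \<open>The right-hand side equals
  \<open>- 2 * (u*d*(u - 1)*(2*b*d - (d^2 - 1)*(u + 5) - 2*a))\<close>, a multiple of the second
  focal value, which is not yet known to vanish here.\<close>

lemma c15: "15*c 1 5 = 4*a*u^2*d - 4*a*u*d - 4*b*u^2*d^2 + 4*b*u*d^2 + 2*u^3*d^3 - 2*u^3*d + 8*u^2*d^3 - 8*u^2*d - 10*u*d^3 + 10*u*d" (is "_ = ?r")
proof -
  have "15*c 1 5 = (1)*(9*c 3 3)+(2*a + 2*u)*(3*c 2 3)+(3*d)*(3*c 3 2)+(6*a*d)*(c 2 2)+(- 1)*(15*c 0 5)+(- 6*b)*(2*c 0 4)"
    using eq24[unfolded low pure c13 c14] by algebra
  also have "\<dots> = ?r"
    unfolding c04 c05 c22 c23 c32 c33 by algebra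
  finally show ?thesis .
qed

lemma eq15: "(- 2)*c 2 4+(6)*c 0 6+(- 1*a - u)*c 1 4+(- 2*d)*c 2 3+(- 1*a*d)*c 1 3+(5*b + 5*u*d)*c 0 5+(4*b*u*d)*c 0 4 = 0"
  using lie_zero[of 1 5]
  by (simp add: lie_coeff_def shX_def shY_def dX_def dY_def eval_nat_numeral algebra_simps)

lemma c06: "18*c 0 6 = 7*a^4 + 24*a^3*u - 24*a^3 - 13*a^2*b^2 - 17*a^2*b*u*d + 17*a^2*b*d - 13*a^2*u^2*d^2 + 37*a^2*u^2 + 17*a^2*u*d^2 - 58*a^2*u - 4*a^2*d^2 + 21*a^2 - 13*a*b^2*u + 13*a*b^2 - 17*a*b*u^2*d + 34*a*b*u*d - 17*a*b*d - 13*a*u^3*d^2 + 24*a*u^3 + 37*a*u^2*d^2 - 58*a*u^2 - 28*a*u*d^2 + 38*a*u + 4*a*d^2 - 4*a + 6*b^4 + 6*b^3*u*d - 6*b^3*d + 6*b^2*u^2*d^2 - 13*b^2*u^2 - 6*b^2*u*d^2 + 13*b^2*u + 6*b*u^3*d^3 - 17*b*u^3*d - 6*b*u^2*d^3 + 27*b*u^2*d - 10*b*u*d + 6*u^4*d^4 - 13*u^4*d^2 + 7*u^4 - 6*u^3*d^4 + 30*u^3*d^2 - 24*u^3 - 21*u^2*d^2 + 21*u^2 + 4*u*d^2 - 4*u" (is "_ = ?r")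
proof -
  have "18*c 0 6 = (1)*(6*c 2 4)+(2*d)*(3*c 2 3)+(- 1*b - u*d)*(15*c 0 5)+(- 6*b*u*d)*(2*c 0 4)"
    using eq15[unfolded low pure c13 c14] by algebra
  also have "\<dots> = ?r"
    unfolding c04 c05 c23 c24 by algebra
  finally show ?thesis .
qed

section \<open>Weight for the second focal value\<close>

text \<open>The weights solve the triangular linear system \<open>adj = 0\<close> downwards, starting in the top degree from
  the moments of the unit circle. Solvability in the even degrees is the vanishing of lower focal values.\<close>

definition "l5_0 = 20*a + 20*u - 35"
definition "l4_1 = - 3*d"
definition "l3_2 = 2*a + 2*u - 5"
definition "l2_3 = 2*b + 2*u*d - 5*d"
definition "l1_4 = - 3"
definition "l0_5 = 20*b + 20*u*d - 35*d"
definition "l6_0 = 15"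
definition "l4_2 = 3"
definition "l2_4 = 3"
definition "l0_6 = 15"

lemmas l_defs = l5_0_def l4_1_def l3_2_def l2_3_def l1_4_def l0_5_def l6_0_def l4_2_def l2_4_def l0_6_def

text \<open>A row is a total degree, beginning with 5, and a column an exponent of \<open>Y\<close>.
  The top entries at even exponents are \<open>(p - 1)!! (q - 1)!!\<close>, proportional to the
  means of \<open>X^p Y^q\<close> over the unit circle; at odd exponents these means vanish.\<close>

definition "l p q = (if 5 \<le> p + q \<and> p + q \<le> 6 then
    [[l5_0, l4_1, l3_2, l2_3, l1_4, l0_5],
     [l6_0, 0, l4_2, 0, l2_4, 0, l0_6]] ! (p + q - 5) ! q else 0)"

lemma l_adj6_0:
  "adj l 6 0 = 0"
  by (simp add: lie_adjoint_def l_def)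

lemma l_adj5_1:
  "adj l 5 1 = 0"
proof -
  have "adj l 5 1 = 1*(l6_0) - 5*(l4_2)"
    by (simp add: lie_adjoint_def l_def)
  also have "\<dots> = 0"
    unfolding l_defs by algebra
  finally show ?thesis .
qed

lemma l_adj4_2:
  "adj l 4 2 = 0"
  by (simp add: lie_adjoint_def l_def)

lemma l_adj3_3:
  "adj l 3 3 = 0"
proof -
  have "adj l 3 3 = 3*(l4_2) - 3*(l2_4)"
    by (simp add: lie_adjoint_def l_def)
  also have "\<dots> = 0"
    unfolding l_defs by algebra
  finally show ?thesis .
qed

lemma l_adj2_4:
  "adj l 2 4 = 0"
  by (simp add: lie_adjoint_def l_def)

lemma l_adj1_5:
  "adj l 1 5 = 0"
proof -
  have "adj l 1 5 = 5*(l2_4) - 1*(l0_6)"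
    by (simp add: lie_adjoint_def l_def)
  also have "\<dots> = 0"
    unfolding l_defs by algebra
  finally show ?thesis .
qed

lemma l_adj0_6:
  "adj l 0 6 = 0"
  by (simp add: lie_adjoint_def l_def)

lemma l_adj5_0:
  "adj l 5 0 = 0"
proof -
  have "adj l 5 0 = - 5*(l4_1 + d*l4_2)"
    by (simp add: lie_adjoint_def l_def)
  also have "\<dots> = 0"
    unfolding l_defs by algebra
  finally show ?thesis .
qed

lemma l_adj4_1:
  "adj l 4 1 = 0"
proof -
  have "adj l 4 1 = 1*(l5_0 + l6_0) - 4*(l3_2 + (a + u)*l4_2)"
    by (simp add: lie_adjoint_def l_def)
  also have "\<dots> = 0"
    unfolding l_defs by algebra
  finally show ?thesis .
qed

lemma l_adj3_2:
  "adj l 3 2 = 0"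
proof -
  have "adj l 3 2 = 2*(l4_1 + (b + u*d)*l4_2) - 3*(l2_3 + d*l2_4)"
    by (simp add: lie_adjoint_def l_def)
  also have "\<dots> = 0"
    unfolding l_defs by algebra
  finally show ?thesis .
qed

lemma l_adj2_3:
  "adj l 2 3 = 0"
proof -
  have "adj l 2 3 = 3*(l3_2 + l4_2) - 2*(l1_4 + (a + u)*l2_4)"
    by (simp add: lie_adjoint_def l_def)
  also have "\<dots> = 0"
    unfolding l_defs by algebra
  finally show ?thesis .
qed

lemma l_adj1_4:
  "adj l 1 4 = 0"
proof -
  have "adj l 1 4 = 4*(l2_3 + (b + u*d)*l2_4) - 1*(l0_5 + d*l0_6)"
    by (simp add: lie_adjoint_def l_def)
  also have "\<dots> = 0"
    unfolding l_defs by algebra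
  finally show ?thesis .
qed

lemma l_adj0_5:
  "adj l 0 5 = 0"
proof -
  have "adj l 0 5 = 5*(l1_4 + l2_4)"
    by (simp add: lie_adjoint_def l_def)
  also have "\<dots> = 0"
    unfolding l_defs by algebra
  finally show ?thesis .
qed

text \<open>With \<open>k = 3\<close> and \<open>N = 6\<close> the weight relates the coefficients
  of degrees 3 and 4, all of which are known as polynomials in the parameters; inserting them leaves
  a multiple of the second focal value.\<close>

lemma l_functional:
  shows "u*d*(u - 1)*(2*b*d - (d^2 - 1)*(u + 5) - 2*a) = 0" (is "?v = 0")
proof -
  have lz: "l p q = 0" if "p + q < 5 \<or> 6 < p + q" for p q
    using that by (auto simp: l_def)
  have adj: "adj l p q = 0" if "5 \<le> p + q" "p + q \<le> 6" for p q
  proof -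
    have "p + q = 5 \<or> p + q = 6"
      using that by linarith
    moreover have "q = 0 \<or> q = 1 \<or> q = 2 \<or> q = 3 \<or> q = 4 \<or> q = 5 \<or> q = 6"
      using that by presburger
    ultimately show ?thesis
      by (elim disjE) (simp_all add: l_adj5_0 l_adj4_1[unfolded One_nat_def] l_adj3_2 l_adj2_3 l_adj1_4[unfolded One_nat_def] l_adj0_5 l_adj6_0 l_adj5_1[unfolded One_nat_def] l_adj4_2 l_adj3_3 l_adj2_4 l_adj1_5[unfolded One_nat_def] l_adj0_6)
  qed
  have "(\<Sum>q\<le>3. c (3 - q) q * adj l (3 - q) q)
     + (\<Sum>q\<le>Suc 3. c (Suc 3 - q) q * adj l (Suc 3 - q) q) = 0"
    by (rule adjoint_functional[OF supp lie_zero, where N = 6]) (auto intro!: lz adj)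
  then have "c 3 0 * adj l 3 0 + c 2 1 * adj l 2 1 + c 1 2 * adj l 1 2 + c 0 3 * adj l 0 3 + c 4 0 * adj l 4 0 + c 3 1 * adj l 3 1 + c 2 2 * adj l 2 2 + c 1 3 * adj l 1 3 + c 0 4 * adj l 0 4 = 0"
    by (simp add: eval_nat_numeral add.assoc)
  then have S: "c 3 0 * adj l 3 0 + c 0 3 * adj l 0 3 + c 2 2 * adj l 2 2 + c 0 4 * adj l 0 4 = 0"
    unfolding low pure c12 c13 c21 c31 by simp
  have e30: "adj l 3 0 = - 3*(a*u*l4_1 + a*d*l3_2)"
    by (simp add: lie_adjoint_def l_def)
  have e03: "adj l 0 3 = 3*(b*l2_3 + b*(u*d)*l1_4)"
    by (simp add: lie_adjoint_def l_def)
  have e22: "adj l 2 2 = 2*(l4_1 + (b + u*d)*l3_2 + b*l4_2) - 2*((a + u)*l2_3 + d*l1_4 + a*d*l2_4)"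
    by (simp add: lie_adjoint_def l_def)
  have e04: "adj l 0 4 = 4*(l2_3 + (b + u*d)*l1_4 + b*l2_4)"
    by (simp add: lie_adjoint_def l_def)
  \<comment> \<open>The relation times 6, written in the integer multiples for which the
    coefficients are known.\<close>
  have "2*(3*c 3 0)*adj l 3 0 + 2*(3*c 0 3)*adj l 0 3 + 6*(c 2 2)*adj l 2 2 + 3*(2*c 0 4)*adj l 0 4 = 0" (is "?s = 0")
    using S by algebra
  moreover have "?s - 12*?v = 0"
    unfolding e30 e03 e22 e04 unfolding c30 c03 c22 c04 l_defs  by algebra
  ultimately show ?thesis by simp
qed

section \<open>Weight for the third focal value\<close>

definition "m7_0 = 210*a + 210*u - 315"
definition "m6_1 = - 15*d"
definition "m5_2 = 20*a + 20*u - 35"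
definition "m4_3 = 6*b + 6*u*d - 15*d"
definition "m3_4 = 6*a + 6*u - 15"
definition "m2_5 = 20*b + 20*u*d - 35*d"
definition "m1_6 = - 15"
definition "m0_7 = 210*b + 210*u*d - 315*d"
definition "m8_0 = 105"
definition "m6_2 = 15"
definition "m4_4 = 9"
definition "m2_6 = 15"
definition "m0_8 = 105"

lemmas m_defs = m7_0_def m6_1_def m5_2_def m4_3_def m3_4_def m2_5_def m1_6_def m0_7_def m8_0_def m6_2_def m4_4_def m2_6_def m0_8_def

definition "m p q = (if 7 \<le> p + q \<and> p + q \<le> 8 then
    [[m7_0, m6_1, m5_2, m4_3, m3_4, m2_5, m1_6, m0_7],
     [m8_0, 0, m6_2, 0, m4_4, 0, m2_6, 0, m0_8]] ! (p + q - 7) ! q else 0)"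

lemma m_adj8_0:
  "adj m 8 0 = 0"
  by (simp add: lie_adjoint_def m_def)

lemma m_adj7_1:
  "adj m 7 1 = 0"
proof -
  have "adj m 7 1 = 1*(m8_0) - 7*(m6_2)"
    by (simp add: lie_adjoint_def m_def)
  also have "\<dots> = 0"
    unfolding m_defs by algebra
  finally show ?thesis .
qed

lemma m_adj6_2:
  "adj m 6 2 = 0"
  by (simp add: lie_adjoint_def m_def)

lemma m_adj5_3:
  "adj m 5 3 = 0"
proof -
  have "adj m 5 3 = 3*(m6_2) - 5*(m4_4)"
    by (simp add: lie_adjoint_def m_def)
  also have "\<dots> = 0"
    unfolding m_defs by algebra
  finally show ?thesis .
qed

lemma m_adj4_4:
  "adj m 4 4 = 0"
  by (simp add: lie_adjoint_def m_def)

lemma m_adj3_5: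
  "adj m 3 5 = 0"
proof -
  have "adj m 3 5 = 5*(m4_4) - 3*(m2_6)"
    by (simp add: lie_adjoint_def m_def)
  also have "\<dots> = 0"
    unfolding m_defs by algebra
  finally show ?thesis .
qed

lemma m_adj2_6:
  "adj m 2 6 = 0"
  by (simp add: lie_adjoint_def m_def)

lemma m_adj1_7:
  "adj m 1 7 = 0"
proof -
  have "adj m 1 7 = 7*(m2_6) - 1*(m0_8)"
    by (simp add: lie_adjoint_def m_def)
  also have "\<dots> = 0"
    unfolding m_defs by algebra
  finally show ?thesis .
qed

lemma m_adj0_8:
  "adj m 0 8 = 0"
  by (simp add: lie_adjoint_def m_def)

lemma m_adj7_0:
  "adj m 7 0 = 0"
proof -
  have "adj m 7 0 = - 7*(m6_1 + d*m6_2)"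
    by (simp add: lie_adjoint_def m_def)
  also have "\<dots> = 0"
    unfolding m_defs by algebra
  finally show ?thesis .
qed

lemma m_adj6_1:
  "adj m 6 1 = 0"
proof -
  have "adj m 6 1 = 1*(m7_0 + m8_0) - 6*(m5_2 + (a + u)*m6_2)"
    by (simp add: lie_adjoint_def m_def)
  also have "\<dots> = 0"
    unfolding m_defs by algebra
  finally show ?thesis .
qed

lemma m_adj5_2:
  "adj m 5 2 = 0"
proof -
  have "adj m 5 2 = 2*(m6_1 + (b + u*d)*m6_2) - 5*(m4_3 + d*m4_4)"
    by (simp add: lie_adjoint_def m_def)
  also have "\<dots> = 0"
    unfolding m_defs by algebra
  finally show ?thesis .
qed

lemma m_adj4_3:
  "adj m 4 3 = 0"
proof -
  have "adj m 4 3 = 3*(m5_2 + m6_2) - 4*(m3_4 + (a + u)*m4_4)"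
    by (simp add: lie_adjoint_def m_def)
  also have "\<dots> = 0"
    unfolding m_defs by algebra
  finally show ?thesis .
qed

lemma m_adj3_4:
  "adj m 3 4 = 0"
proof -
  have "adj m 3 4 = 4*(m4_3 + (b + u*d)*m4_4) - 3*(m2_5 + d*m2_6)"
    by (simp add: lie_adjoint_def m_def)
  also have "\<dots> = 0"
    unfolding m_defs by algebra
  finally show ?thesis .
qed

lemma m_adj2_5:
  "adj m 2 5 = 0"
proof -
  have "adj m 2 5 = 5*(m3_4 + m4_4) - 2*(m1_6 + (a + u)*m2_6)"
    by (simp add: lie_adjoint_def m_def)
  also have "\<dots> = 0"
    unfolding m_defs by algebra
  finally show ?thesis .
qed

lemma m_adj1_6:
  "adj m 1 6 = 0"
proof -
  have "adj m 1 6 = 6*(m2_5 + (b + u*d)*m2_6) - 1*(m0_7 + d*m0_8)"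
    by (simp add: lie_adjoint_def m_def)
  also have "\<dots> = 0"
    unfolding m_defs by algebra
  finally show ?thesis .
qed

lemma m_adj0_7:
  "adj m 0 7 = 0"
proof -
  have "adj m 0 7 = 7*(m1_6 + m2_6)"
    by (simp add: lie_adjoint_def m_def)
  also have "\<dots> = 0"
    unfolding m_defs by algebra
  finally show ?thesis .
qed

text \<open>The hypotheses are the second focal value solved for \<open>a\<close>, with
  \<open>t = (u + 5) / 2\<close> in place of \<open>u\<close> to avoid a denominator. Up to a
  constant the factor \<open>u*d*(u - 1)*(d^2 - 1)\<close> then splits off, and the cofactor is
  linear in \<open>b\<close>.\<close>

lemma m_functional:
  assumes a_eq: "a = b*d - (d^2 - 1)*t" and u_eq: "u = 2*t - 5"
  shows "d*(d^2 - 1)*(2*t - 5)*(t - 3)*(b*t^2*d - 8*b*t*d + 15*b*d - t^3*d^2 + 5*t^2*d^2 - 3*t^2 + 15*t - 15*d^2 - 15) = 0" (is "?v = 0")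
proof -
  have v2: "2*a = 2*b*d - (d^2 - 1)*(u + 5)" using a_eq u_eq by (simp add: algebra_simps)
  have lz: "m p q = 0" if "p + q < 7 \<or> 8 < p + q" for p q
    using that by (auto simp: m_def)
  have adj: "adj m p q = 0" if "7 \<le> p + q" "p + q \<le> 8" for p q
  proof -
    have "p + q = 7 \<or> p + q = 8"
      using that by linarith
    moreover have "q = 0 \<or> q = 1 \<or> q = 2 \<or> q = 3 \<or> q = 4 \<or> q = 5 \<or> q = 6 \<or> q = 7 \<or> q = 8"
      using that by presburger
    ultimately show ?thesis
      by (elim disjE) (simp_all add: m_adj7_0 m_adj6_1[unfolded One_nat_def] m_adj5_2 m_adj4_3 m_adj3_4 m_adj2_5 m_adj1_6[unfolded One_nat_def] m_adj0_7 m_adj8_0 m_adj7_1[unfolded One_nat_def] m_adj6_2 m_adj5_3 m_adj4_4 m_adj3_5 m_adj2_6 m_adj1_7[unfolded One_nat_def] m_adj0_8)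
  qed
  have "(\<Sum>q\<le>5. c (5 - q) q * adj m (5 - q) q)
     + (\<Sum>q\<le>Suc 5. c (Suc 5 - q) q * adj m (Suc 5 - q) q) = 0"
    by (rule adjoint_functional[OF supp lie_zero, where N = 8]) (auto intro!: lz adj)
  then have "c 5 0 * adj m 5 0 + c 4 1 * adj m 4 1 + c 3 2 * adj m 3 2 + c 2 3 * adj m 2 3 + c 1 4 * adj m 1 4 + c 0 5 * adj m 0 5 + c 6 0 * adj m 6 0 + c 5 1 * adj m 5 1 + c 4 2 * adj m 4 2 + c 3 3 * adj m 3 3 + c 2 4 * adj m 2 4 + c 1 5 * adj m 1 5 + c 0 6 * adj m 0 6 = 0"
    by (simp add: eval_nat_numeral add.assoc)
  then have S: "c 5 0 * adj m 5 0 + c 3 2 * adj m 3 2 + c 2 3 * adj m 2 3 + c 0 5 * adj m 0 5 + c 4 2 * adj m 4 2 + c 3 3 * adj m 3 3 + c 2 4 * adj m 2 4 + c 1 5 * adj m 1 5 + c 0 6 * adj m 0 6 = 0"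
    unfolding low pure c14 c41 c51 by simp
  have e50: "adj m 5 0 = - 5*(a*u*m6_1 + a*d*m5_2)"
    by (simp add: lie_adjoint_def m_def)
  have e32: "adj m 3 2 = 2*(b*m5_2 + b*(u*d)*m4_3) - 3*(a*u*m4_3 + a*d*m3_4)"
    by (simp add: lie_adjoint_def m_def)
  have e23: "adj m 2 3 = 3*(b*m4_3 + b*(u*d)*m3_4) - 2*(a*u*m3_4 + a*d*m2_5)"
    by (simp add: lie_adjoint_def m_def)
  have e05: "adj m 0 5 = 5*(b*m2_5 + b*(u*d)*m1_6)"
    by (simp add: lie_adjoint_def m_def)
  have e42: "adj m 4 2 = 2*(m6_1 + (b + u*d)*m5_2 + b*m6_2) - 4*((a + u)*m4_3 + d*m3_4 + a*d*m4_4)"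
    by (simp add: lie_adjoint_def m_def)
  have e33: "adj m 3 3 = 3*(m5_2 + (b + u*d)*m4_3 + b*(u*d)*m4_4) - 3*((a + u)*m3_4 + d*m2_5 + a*u*m4_4)"
    by (simp add: lie_adjoint_def m_def)
  have e24: "adj m 2 4 = 4*(m4_3 + (b + u*d)*m3_4 + b*m4_4) - 2*((a + u)*m2_5 + d*m1_6 + a*d*m2_6)"
    by (simp add: lie_adjoint_def m_def)
  have e15: "adj m 1 5 = 5*(m3_4 + (b + u*d)*m2_5 + b*(u*d)*m2_6) - 1*((a + u)*m1_6 + d*m0_7 + a*u*m2_6)"
    by (simp add: lie_adjoint_def m_def)
  have e06: "adj m 0 6 = 6*(m2_5 + (b + u*d)*m1_6 + b*m2_6)"
    by (simp add: lie_adjoint_def m_def)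
  have "6*(15*c 5 0)*adj m 5 0 + 30*(3*c 3 2)*adj m 3 2 + 30*(3*c 2 3)*adj m 2 3 + 6*(15*c 0 5)*adj m 0 5 + 30*(3*c 4 2)*adj m 4 2 + 10*(9*c 3 3)*adj m 3 3 + 15*(6*c 2 4)*adj m 2 4 + 6*(15*c 1 5)*adj m 1 5 + 5*(18*c 0 6)*adj m 0 6 = 0" (is "?s = 0")
    using S by algebra
  moreover have "?s - 1440*?v = 0"
    unfolding e50 e32 e23 e05 e42 e33 e24 e15 e06 unfolding c50 c32 c23 c05 c42 c33 c24 c15 c06 m_defs unfolding a_eq u_eq by algebra
  ultimately show ?thesis by simp
qed

section \<open>Weight for the fourth focal value\<close>

definition "n7_0 = - 11508*a^3 - 35658*a^2*u + 50778*a^2 - 35658*a*u^2 + 99288*a*u - 69300*a - 11508*u^3 - 3213*u^2*d^2 + 50778*u^2 + 2583*u*d^2 - 69300*u + 30030"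
definition "n6_1 = 630*a^2*d + 2205*a*u*d - 2025*a*d - 45*b*u*d^2 + 135*b*d^2 + 945*u^2*d + 135*u*d^3 - 2970*u*d - 225*d^3 + 1485*d"
definition "n5_2 = - 1288*a^3 - 4368*a^2*u + 6438*a^2 + 60*a*b*u*d - 180*a*b*d - 4368*a*u^2 - 180*a*u*d^2 + 13443*a*u + 300*a*d^2 - 10065*a + 60*b*u^2*d - 195*b*u*d + 315*b*d - 1288*u^3 - 573*u^2*d^2 + 6438*u^2 + 738*u*d^2 - 10065*u - 525*d^2 + 5005"
definition "n4_3 = - 372*a^2*b - 372*a^2*u*d + 930*a^2*d - 960*a*b*u + 1272*a*b - 960*a*u^2*d + 3852*a*u*d - 3180*a*d + 54*b^2*u*d - 108*b^2*d + 54*b*u^2*d^2 - 372*b*u^2 - 432*b*u*d^2 + 1272*b*u + 540*b*d^2 - 972*b - 372*u^3*d - 108*u^2*d^3 + 2121*u^2*d + 540*u*d^3 - 4341*u*d - 540*d^3 + 2430*d"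
definition "n3_4 = - 408*a^3 - 1458*a^2*u + 2448*a^2 + 36*a*b^2 + 144*a*b*u*d - 264*a*b*d + 36*a*u^2*d^2 - 1458*a*u^2 - 264*a*u*d^2 + 5400*a*u + 300*a*d^2 - 4572*a + 36*b^2*u - 90*b^2 + 144*b*u^2*d - 444*b*u*d + 660*b*d + 36*u^3*d^2 - 408*u^3 - 435*u^2*d^2 + 2448*u^2 + 771*u*d^2 - 4572*u - 750*d^2 + 2640"
definition "n2_5 = - 1360*a^2*b - 1360*a^2*u*d + 2380*a^2*d - 3620*a*b*u + 4940*a*b - 3620*a*u^2*d + 11365*a*u*d - 8645*a*d + 72*b^3 + 672*b^2*u*d - 1062*b^2*d + 672*b*u^2*d^2 - 1360*b*u^2 - 3237*b*u*d^2 + 4940*b*u + 3135*b*d^2 - 3940*b + 72*u^3*d^3 - 1360*u^3*d - 1062*u^2*d^3 + 6927*u^2*d + 3135*u*d^3 - 12462*u*d - 2415*d^3 + 6895*d"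
definition "n1_6 = 1020*a^2 + 2715*a*u - 3705*a - 390*b^2 - 555*b*u*d + 1815*b*d - 75*u^2*d^2 + 1020*u^2 + 870*u*d^2 - 3705*u - 1695*d^2 + 2955"
definition "n0_7 = - 14280*a^2*b - 14280*a^2*u*d + 21420*a^2*d - 38640*a*b*u + 53760*a*b - 38640*a*u^2*d + 111720*a*u*d - 80640*a*d + 2772*b^3 + 17262*b^2*u*d - 24402*b^2*d + 17262*b*u^2*d^2 - 14280*b*u^2 - 66192*b*u*d^2 + 53760*b*u + 55860*b*d^2 - 44520*b + 2772*u^3*d^3 - 14280*u^3*d - 24402*u^2*d^3 + 71967*u^2*d + 55860*u*d^3 - 122577*u*d - 36750*d^3 + 66780*d"
definition "n7_1 = - 630*a*d - 315*u*d + 945*d"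
definition "n6_2 = - 630*a^2 - 1575*a*u + 2025*a + 45*b*u*d - 135*b*d - 630*u^2 - 135*u*d^2 + 2025*u + 225*d^2 - 1485"
definition "n5_3 = 120*a*b + 120*a*u*d - 300*a*d + 120*b*u - 210*b + 120*u^2*d - 375*u*d + 525*d"
definition "n4_4 = - 558*a^2 - 1440*a*u + 1908*a + 54*b^2 + 216*b*u*d - 396*b*d + 54*u^2*d^2 - 558*u^2 - 396*u*d^2 + 1908*u + 450*d^2 - 1458"
definition "n3_5 = 120*a*b + 120*a*u*d - 210*a*d + 120*b*u - 300*b + 120*u^2*d - 375*u*d + 525*d"
definition "n2_6 = - 1020*a^2 - 2715*a*u + 3705*a + 390*b^2 + 1185*b*u*d - 1815*b*d + 390*u^2*d^2 - 1020*u^2 - 1815*u*d^2 + 3705*u + 1695*d^2 - 2955"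
definition "n1_7 = - 630*b - 315*u*d + 945*d"
definition "n0_8 = - 7140*a^2 - 19320*a*u + 26880*a + 7140*b^2 + 19320*b*u*d - 26880*b*d + 7140*u^2*d^2 - 7140*u^2 - 26880*u*d^2 + 26880*u + 22260*d^2 - 22260"
definition "n9_0 = 7560*a + 7560*u - 10395"
definition "n8_1 = - 315*d"
definition "n7_2 = 630*a + 630*u - 945"
definition "n6_3 = 90*b + 90*u*d - 225*d"
definition "n5_4 = 180*a + 180*u - 315"
definition "n4_5 = 180*b + 180*u*d - 315*d"
definition "n3_6 = 90*a + 90*u - 225"
definition "n2_7 = 630*b + 630*u*d - 945*d"
definition "n1_8 = - 315"
definition "n0_9 = 7560*b + 7560*u*d - 10395*d"
definition "n10_0 = 2835"
definition "n8_2 = 315"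
definition "n6_4 = 135"
definition "n4_6 = 135"
definition "n2_8 = 315"
definition "n0_10 = 2835"

lemmas n_defs = n7_0_def n6_1_def n5_2_def n4_3_def n3_4_def n2_5_def n1_6_def n0_7_def n7_1_def n6_2_def n5_3_def n4_4_def n3_5_def n2_6_def n1_7_def n0_8_def n9_0_def n8_1_def n7_2_def n6_3_def n5_4_def n4_5_def n3_6_def n2_7_def n1_8_def n0_9_def n10_0_def n8_2_def n6_4_def n4_6_def n2_8_def n0_10_def

text \<open>The top row consists of the double factorial products of degree 10 times 3, which keeps
  the lower rows integral. In degree 8 compatibility amounts to the first focal value and so holds
  identically in the parameters.\<close>

definition "n p q = (if 7 \<le> p + q \<and> p + q \<le> 10 then
    [[n7_0, n6_1, n5_2, n4_3, n3_4, n2_5, n1_6, n0_7],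
     [0, n7_1, n6_2, n5_3, n4_4, n3_5, n2_6, n1_7, n0_8],
     [n9_0, n8_1, n7_2, n6_3, n5_4, n4_5, n3_6, n2_7, n1_8, n0_9],
     [n10_0, 0, n8_2, 0, n6_4, 0, n4_6, 0, n2_8, 0, n0_10]] ! (p + q - 7) ! q else 0)"

lemma n_adj10_0:
  "adj n 10 0 = 0"
  by (simp add: lie_adjoint_def n_def)

lemma n_adj9_1:
  "adj n 9 1 = 0"
proof -
  have "adj n 9 1 = 1*(n10_0) - 9*(n8_2)"
    by (simp add: lie_adjoint_def n_def)
  also have "\<dots> = 0"
    unfolding n_defs by algebra
  finally show ?thesis .
qed

lemma n_adj8_2:
  "adj n 8 2 = 0"
  by (simp add: lie_adjoint_def n_def)

lemma n_adj7_3: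
  "adj n 7 3 = 0"
proof -
  have "adj n 7 3 = 3*(n8_2) - 7*(n6_4)"
    by (simp add: lie_adjoint_def n_def)
  also have "\<dots> = 0"
    unfolding n_defs by algebra
  finally show ?thesis .
qed

lemma n_adj6_4:
  "adj n 6 4 = 0"
  by (simp add: lie_adjoint_def n_def)

lemma n_adj5_5:
  "adj n 5 5 = 0"
proof -
  have "adj n 5 5 = 5*(n6_4) - 5*(n4_6)"
    by (simp add: lie_adjoint_def n_def)
  also have "\<dots> = 0"
    unfolding n_defs by algebra
  finally show ?thesis .
qed

lemma n_adj4_6:
  "adj n 4 6 = 0"
  by (simp add: lie_adjoint_def n_def)

lemma n_adj3_7:
  "adj n 3 7 = 0"
proof -
  have "adj n 3 7 = 7*(n4_6) - 3*(n2_8)"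
    by (simp add: lie_adjoint_def n_def)
  also have "\<dots> = 0"
    unfolding n_defs by algebra
  finally show ?thesis .
qed

lemma n_adj2_8:
  "adj n 2 8 = 0"
  by (simp add: lie_adjoint_def n_def)

lemma n_adj1_9:
  "adj n 1 9 = 0"
proof -
  have "adj n 1 9 = 9*(n2_8) - 1*(n0_10)"
    by (simp add: lie_adjoint_def n_def)
  also have "\<dots> = 0"
    unfolding n_defs by algebra
  finally show ?thesis .
qed

lemma n_adj0_10:
  "adj n 0 10 = 0"
  by (simp add: lie_adjoint_def n_def)

lemma n_adj9_0:
  "adj n 9 0 = 0"
proof -
  have "adj n 9 0 = - 9*(n8_1 + d*n8_2)"
    by (simp add: lie_adjoint_def n_def)
  also have "\<dots> = 0"
    unfolding n_defs by algebra
  finally show ?thesis .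
qed

lemma n_adj8_1:
  "adj n 8 1 = 0"
proof -
  have "adj n 8 1 = 1*(n9_0 + n10_0) - 8*(n7_2 + (a + u)*n8_2)"
    by (simp add: lie_adjoint_def n_def)
  also have "\<dots> = 0"
    unfolding n_defs by algebra
  finally show ?thesis .
qed

lemma n_adj7_2:
  "adj n 7 2 = 0"
proof -
  have "adj n 7 2 = 2*(n8_1 + (b + u*d)*n8_2) - 7*(n6_3 + d*n6_4)"
    by (simp add: lie_adjoint_def n_def)
  also have "\<dots> = 0"
    unfolding n_defs by algebra
  finally show ?thesis .
qed

lemma n_adj6_3:
  "adj n 6 3 = 0"
proof -
  have "adj n 6 3 = 3*(n7_2 + n8_2) - 6*(n5_4 + (a + u)*n6_4)"
    by (simp add: lie_adjoint_def n_def)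
  also have "\<dots> = 0"
    unfolding n_defs by algebra
  finally show ?thesis .
qed

lemma n_adj5_4:
  "adj n 5 4 = 0"
proof -
  have "adj n 5 4 = 4*(n6_3 + (b + u*d)*n6_4) - 5*(n4_5 + d*n4_6)"
    by (simp add: lie_adjoint_def n_def)
  also have "\<dots> = 0"
    unfolding n_defs by algebra
  finally show ?thesis .
qed

lemma n_adj4_5:
  "adj n 4 5 = 0"
proof -
  have "adj n 4 5 = 5*(n5_4 + n6_4) - 4*(n3_6 + (a + u)*n4_6)"
    by (simp add: lie_adjoint_def n_def)
  also have "\<dots> = 0"
    unfolding n_defs by algebra
  finally show ?thesis .
qed

lemma n_adj3_6:
  "adj n 3 6 = 0"
proof -
  have "adj n 3 6 = 6*(n4_5 + (b + u*d)*n4_6) - 3*(n2_7 + d*n2_8)"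
    by (simp add: lie_adjoint_def n_def)
  also have "\<dots> = 0"
    unfolding n_defs by algebra
  finally show ?thesis .
qed

lemma n_adj2_7:
  "adj n 2 7 = 0"
proof -
  have "adj n 2 7 = 7*(n3_6 + n4_6) - 2*(n1_8 + (a + u)*n2_8)"
    by (simp add: lie_adjoint_def n_def)
  also have "\<dots> = 0"
    unfolding n_defs by algebra
  finally show ?thesis .
qed

lemma n_adj1_8:
  "adj n 1 8 = 0"
proof -
  have "adj n 1 8 = 8*(n2_7 + (b + u*d)*n2_8) - 1*(n0_9 + d*n0_10)"
    by (simp add: lie_adjoint_def n_def)
  also have "\<dots> = 0"
    unfolding n_defs by algebra
  finally show ?thesis .
qed

lemma n_adj0_9:
  "adj n 0 9 = 0"
proof -
  have "adj n 0 9 = 9*(n1_8 + n2_8)"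
    by (simp add: lie_adjoint_def n_def)
  also have "\<dots> = 0"
    unfolding n_defs by algebra
  finally show ?thesis .
qed

lemma n_adj8_0:
  "adj n 8 0 = 0"
proof -
  have "adj n 8 0 = - 8*(n7_1 + (a + u)*n8_1 + d*n7_2 + a*d*n8_2)"
    by (simp add: lie_adjoint_def n_def)
  also have "\<dots> = 0"
    unfolding n_defs by algebra
  finally show ?thesis .
qed

lemma n_adj7_1:
  "adj n 7 1 = 0"
proof -
  have "adj n 7 1 = 1*(n9_0 + (b + u*d)*n8_1 + b*(u*d)*n8_2) - 7*(n6_2 + (a + u)*n7_2 + d*n6_3 + a*u*n8_2)"
    by (simp add: lie_adjoint_def n_def)
  also have "\<dots> = 0"
    unfolding n_defs by algebra
  finally show ?thesis .
qed

lemma n_adj6_2: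
  "adj n 6 2 = 0"
proof -
  have "adj n 6 2 = 2*(n7_1 + n8_1 + (b + u*d)*n7_2 + b*n8_2) - 6*(n5_3 + (a + u)*n6_3 + d*n5_4 + a*d*n6_4)"
    by (simp add: lie_adjoint_def n_def)
  also have "\<dots> = 0"
    unfolding n_defs by algebra
  finally show ?thesis .
qed

lemma n_adj5_3:
  "adj n 5 3 = 0"
proof -
  have "adj n 5 3 = 3*(n6_2 + n7_2 + (b + u*d)*n6_3 + b*(u*d)*n6_4) - 5*(n4_4 + (a + u)*n5_4 + d*n4_5 + a*u*n6_4)"
    by (simp add: lie_adjoint_def n_def)
  also have "\<dots> = 0"
    unfolding n_defs by algebra
  finally show ?thesis .
qed

lemma n_adj4_4:
  "adj n 4 4 = 0"
proof -
  have "adj n 4 4 = 4*(n5_3 + n6_3 + (b + u*d)*n5_4 + b*n6_4) - 4*(n3_5 + (a + u)*n4_5 + d*n3_6 + a*d*n4_6)"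
    by (simp add: lie_adjoint_def n_def)
  also have "\<dots> = 0"
    unfolding n_defs by algebra
  finally show ?thesis .
qed

lemma n_adj3_5:
  "adj n 3 5 = 0"
proof -
  have "adj n 3 5 = 5*(n4_4 + n5_4 + (b + u*d)*n4_5 + b*(u*d)*n4_6) - 3*(n2_6 + (a + u)*n3_6 + d*n2_7 + a*u*n4_6)"
    by (simp add: lie_adjoint_def n_def)
  also have "\<dots> = 0"
    unfolding n_defs by algebra
  finally show ?thesis .
qed

lemma n_adj2_6:
  "adj n 2 6 = 0"
proof -
  have "adj n 2 6 = 6*(n3_5 + n4_5 + (b + u*d)*n3_6 + b*n4_6) - 2*(n1_7 + (a + u)*n2_7 + d*n1_8 + a*d*n2_8)"
    by (simp add: lie_adjoint_def n_def)
  also have "\<dots> = 0"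
    unfolding n_defs by algebra
  finally show ?thesis .
qed

lemma n_adj1_7:
  "adj n 1 7 = 0"
proof -
  have "adj n 1 7 = 7*(n2_6 + n3_6 + (b + u*d)*n2_7 + b*(u*d)*n2_8) - 1*(n0_8 + (a + u)*n1_8 + d*n0_9 + a*u*n2_8)"
    by (simp add: lie_adjoint_def n_def)
  also have "\<dots> = 0"
    unfolding n_defs by algebra
  finally show ?thesis .
qed

lemma n_adj0_8:
  "adj n 0 8 = 0"
proof -
  have "adj n 0 8 = 8*(n1_7 + n2_7 + (b + u*d)*n1_8 + b*n2_8)"
    by (simp add: lie_adjoint_def n_def)
  also have "\<dots> = 0"
    unfolding n_defs by algebra
  finally show ?thesis .
qed

lemma n_adj7_0:
  "adj n 7 0 = 0"
proof -
  have "adj n 7 0 = - 7*(n6_1 + (a + u)*n7_1 + d*n6_2 + a*u*n8_1 + a*d*n7_2)"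
    by (simp add: lie_adjoint_def n_def)
  also have "\<dots> = 0"
    unfolding n_defs by algebra
  finally show ?thesis .
qed

lemma n_adj6_1:
  "adj n 6 1 = 0"
proof -
  have "adj n 6 1 = 1*(n7_0 + (b + u*d)*n7_1 + b*n8_1 + b*(u*d)*n7_2) - 6*(n5_2 + (a + u)*n6_2 + d*n5_3 + a*u*n7_2 + a*d*n6_3)"
    by (simp add: lie_adjoint_def n_def)
  also have "\<dots> = 0"
    unfolding n_defs by algebra
  finally show ?thesis .
qed

lemma n_adj5_2:
  "adj n 5 2 = 0"
proof -
  have "adj n 5 2 = 2*(n6_1 + n7_1 + (b + u*d)*n6_2 + b*n7_2 + b*(u*d)*n6_3) - 5*(n4_3 + (a + u)*n5_3 + d*n4_4 + a*u*n6_3 + a*d*n5_4)"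
    by (simp add: lie_adjoint_def n_def)
  also have "\<dots> = 0"
    unfolding n_defs by algebra
  finally show ?thesis .
qed

lemma n_adj4_3:
  "adj n 4 3 = 0"
proof -
  have "adj n 4 3 = 3*(n5_2 + n6_2 + (b + u*d)*n5_3 + b*n6_3 + b*(u*d)*n5_4) - 4*(n3_4 + (a + u)*n4_4 + d*n3_5 + a*u*n5_4 + a*d*n4_5)"
    by (simp add: lie_adjoint_def n_def)
  also have "\<dots> = 0"
    unfolding n_defs by algebra
  finally show ?thesis .
qed

lemma n_adj3_4:
  "adj n 3 4 = 0"
proof -
  have "adj n 3 4 = 4*(n4_3 + n5_3 + (b + u*d)*n4_4 + b*n5_4 + b*(u*d)*n4_5) - 3*(n2_5 + (a + u)*n3_5 + d*n2_6 + a*u*n4_5 + a*d*n3_6)"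
    by (simp add: lie_adjoint_def n_def)
  also have "\<dots> = 0"
    unfolding n_defs by algebra
  finally show ?thesis .
qed

lemma n_adj2_5:
  "adj n 2 5 = 0"
proof -
  have "adj n 2 5 = 5*(n3_4 + n4_4 + (b + u*d)*n3_5 + b*n4_5 + b*(u*d)*n3_6) - 2*(n1_6 + (a + u)*n2_6 + d*n1_7 + a*u*n3_6 + a*d*n2_7)"
    by (simp add: lie_adjoint_def n_def)
  also have "\<dots> = 0"
    unfolding n_defs by algebra
  finally show ?thesis .
qed

lemma n_adj1_6:
  "adj n 1 6 = 0"
proof -
  have "adj n 1 6 = 6*(n2_5 + n3_5 + (b + u*d)*n2_6 + b*n3_6 + b*(u*d)*n2_7) - 1*(n0_7 + (a + u)*n1_7 + d*n0_8 + a*u*n2_7 + a*d*n1_8)"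
    by (simp add: lie_adjoint_def n_def)
  also have "\<dots> = 0"
    unfolding n_defs by algebra
  finally show ?thesis .
qed

lemma n_adj0_7:
  "adj n 0 7 = 0"
proof -
  have "adj n 0 7 = 7*(n1_6 + n2_6 + (b + u*d)*n1_7 + b*n2_7 + b*(u*d)*n1_8)"
    by (simp add: lie_adjoint_def n_def)
  also have "\<dots> = 0"
    unfolding n_defs by algebra
  finally show ?thesis .
qed

text \<open>The weight starts in degree 7, as for the third focal value, so again only the known
  degrees 5 and 6 of the integral enter. The same factors split off, with a cofactor cubic in
  \<open>b\<close>.\<close>

lemma n_functional:
  assumes a_eq: "a = b*d - (d^2 - 1)*t" and u_eq: "u = 2*t - 5"
  shows "d*(d^2 - 1)*(2*t - 5)*(t - 3)*(- 98*b^3*t^2*d^3 + 784*b^3*t*d^3 - 1470*b^3*d^3 + 294*b^2*t^3*d^4 - 624*b^2*t^3*d^2 - 2058*b^2*t^2*d^4 + 6552*b^2*t^2*d^2 + 2940*b^2*t*d^4 - 21012*b^2*t*d^2 + 1470*b^2*d^4 + 20622*b^2*d^2 - 294*b*t^4*d^5 + 1260*b*t^4*d^3 - 906*b*t^4*d + 1764*b*t^3*d^5 - 11496*b*t^3*d^3 + 12840*b*t^3*d - 1470*b*t^2*d^5 + 30534*b*t^2*d^3 - 60456*b*t^2*d - 2940*b*t*d^5 - 17016*b*t*d^3 + 115284*b*t*d - 15390*b*d^3 - 76770*b*d + 98*t^5*d^6 - 636*t^5*d^4 + 906*t^5*d^2 - 490*t^4*d^6 + 4872*t^4*d^4 - 10218*t^4*d^2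 + 2682*t^4 - 8577*t^3*d^4 + 36768*t^3*d^2 - 24489*t^3 + 1470*t^2*d^6 - 7782*t^2*d^4 - 38742*t^2*d^2 + 80190*t^2 + 22770*t*d^4 - 28746*t*d^2 - 112320*t - 4410*d^4 + 52560*d^2 + 56970) = 0" (is "?v = 0")
proof -
  have v2: "2*a = 2*b*d - (d^2 - 1)*(u + 5)" using a_eq u_eq by (simp add: algebra_simps)
  have lz: "n p q = 0" if "p + q < 7 \<or> 10 < p + q" for p q
    using that by (auto simp: n_def)
  have adj: "adj n p q = 0" if "7 \<le> p + q" "p + q \<le> 10" for p q
  proof -
    have "p + q = 7 \<or> p + q = 8 \<or> p + q = 9 \<or> p + q = 10"
      using that by linarith
    moreover have "q = 0 \<or> q = 1 \<or> q = 2 \<or> q = 3 \<or> q = 4 \<or> q = 5 \<or> q = 6 \<or> q = 7 \<or> q = 8 \<or> q = 9 \<or> q = 10"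
      using that by presburger
    ultimately show ?thesis
      by (elim disjE) (simp_all add: n_adj7_0 n_adj6_1[unfolded One_nat_def] n_adj5_2 n_adj4_3 n_adj3_4 n_adj2_5 n_adj1_6[unfolded One_nat_def] n_adj0_7 n_adj8_0 n_adj7_1[unfolded One_nat_def] n_adj6_2 n_adj5_3 n_adj4_4 n_adj3_5 n_adj2_6 n_adj1_7[unfolded One_nat_def] n_adj0_8 n_adj9_0 n_adj8_1[unfolded One_nat_def] n_adj7_2 n_adj6_3 n_adj5_4 n_adj4_5 n_adj3_6 n_adj2_7 n_adj1_8[unfolded One_nat_def] n_adj0_9 n_adj10_0 n_adj9_1[unfolded One_nat_def] n_adj8_2 n_adj7_3 n_adj6_4 n_adj5_5 n_adj4_6 n_adj3_7 n_adj2_8 n_adj1_9[unfolded One_nat_def] n_adj0_10)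
  qed
  have "(\<Sum>q\<le>5. c (5 - q) q * adj n (5 - q) q)
     + (\<Sum>q\<le>Suc 5. c (Suc 5 - q) q * adj n (Suc 5 - q) q) = 0"
    by (rule adjoint_functional[OF supp lie_zero, where N = 10]) (auto intro!: lz adj)
  then have "c 5 0 * adj n 5 0 + c 4 1 * adj n 4 1 + c 3 2 * adj n 3 2 + c 2 3 * adj n 2 3 + c 1 4 * adj n 1 4 + c 0 5 * adj n 0 5 + c 6 0 * adj n 6 0 + c 5 1 * adj n 5 1 + c 4 2 * adj n 4 2 + c 3 3 * adj n 3 3 + c 2 4 * adj n 2 4 + c 1 5 * adj n 1 5 + c 0 6 * adj n 0 6 = 0"
    by (simp add: eval_nat_numeral add.assoc)
  then have S: "c 5 0 * adj n 5 0 + c 3 2 * adj n 3 2 + c 2 3 * adj n 2 3 + c 0 5 * adj n 0 5 + c 4 2 * adj n 4 2 + c 3 3 * adj n 3 3 + c 2 4 * adj n 2 4 + c 1 5 * adj n 1 5 + c 0 6 * adj n 0 6 = 0"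
    unfolding low pure c14 c41 c51 by simp
  have e50: "adj n 5 0 = - 5*(a*u*n6_1 + a*d*n5_2)"
    by (simp add: lie_adjoint_def n_def)
  have e32: "adj n 3 2 = 2*(b*n5_2 + b*(u*d)*n4_3) - 3*(a*u*n4_3 + a*d*n3_4)"
    by (simp add: lie_adjoint_def n_def)
  have e23: "adj n 2 3 = 3*(b*n4_3 + b*(u*d)*n3_4) - 2*(a*u*n3_4 + a*d*n2_5)"
    by (simp add: lie_adjoint_def n_def)
  have e05: "adj n 0 5 = 5*(b*n2_5 + b*(u*d)*n1_6)"
    by (simp add: lie_adjoint_def n_def)
  have e42: "adj n 4 2 = 2*(n6_1 + (b + u*d)*n5_2 + b*n6_2 + b*(u*d)*n5_3) - 4*((a + u)*n4_3 + d*n3_4 + a*u*n5_3 + a*d*n4_4)"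
    by (simp add: lie_adjoint_def n_def)
  have e33: "adj n 3 3 = 3*(n5_2 + (b + u*d)*n4_3 + b*n5_3 + b*(u*d)*n4_4) - 3*((a + u)*n3_4 + d*n2_5 + a*u*n4_4 + a*d*n3_5)"
    by (simp add: lie_adjoint_def n_def)
  have e24: "adj n 2 4 = 4*(n4_3 + (b + u*d)*n3_4 + b*n4_4 + b*(u*d)*n3_5) - 2*((a + u)*n2_5 + d*n1_6 + a*u*n3_5 + a*d*n2_6)"
    by (simp add: lie_adjoint_def n_def)
  have e15: "adj n 1 5 = 5*(n3_4 + (b + u*d)*n2_5 + b*n3_5 + b*(u*d)*n2_6) - 1*((a + u)*n1_6 + d*n0_7 + a*u*n2_6 + a*d*n1_7)"
    by (simp add: lie_adjoint_def n_def)
  have e06: "adj n 0 6 = 6*(n2_5 + (b + u*d)*n1_6 + b*n2_6 + b*(u*d)*n1_7)"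
    by (simp add: lie_adjoint_def n_def)
  have "6*(15*c 5 0)*adj n 5 0 + 30*(3*c 3 2)*adj n 3 2 + 30*(3*c 2 3)*adj n 2 3 + 6*(15*c 0 5)*adj n 0 5 + 30*(3*c 4 2)*adj n 4 2 + 10*(9*c 3 3)*adj n 3 3 + 15*(6*c 2 4)*adj n 2 4 + 6*(15*c 1 5)*adj n 1 5 + 5*(18*c 0 6)*adj n 0 6 = 0" (is "?s = 0")
    using S by algebra
  moreover have "?s - 1440*?v = 0"
    unfolding e50 e32 e23 e05 e42 e33 e24 e15 e06 unfolding c50 c32 c23 c05 c42 c33 c24 c15 c06 n_defs unfolding a_eq u_eq by algebra
  ultimately show ?thesis by simp
qed

section \<open>Weight for the fifth focal value\<close>

definition "k7_0 = 7430280*a^5 + 38624520*a^4*u - 53159040*a^4 + 78802350*a^3*u^2 - 213865740*a^3*u + 145278210*a^3 + 78802350*a^2*u^3 + 4101570*a^2*u^2*d^2 - 321253020*a^2*u^2 - 3421170*a^2*u*d^2 + 430346070*a^2*u - 190390200*a^2 + 793710*a*b*u^2*d - 793710*a*b*u*d + 38624520*a*u^4 + 9143865*a*u^3*d^2 - 213865740*a*u^3 - 19833750*a*u^2*d^2 + 430346070*a*u^2 + 10258335*a*u*d^2 - 375375000*a*u + 120270150*a - 793710*b^2*u^2*d^2 + 793710*b^2*u*d^2 - 312210*b*u^3*d^3 - 396855*b*u^3*d + 3475620*b*u^2*d^3 - 1587420*b*u^2*d - 3135060*b*u*d^3 + 1984275*b*u*d + 7430280*u^5 + 312210*u^4*d^4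 + 3704715*u^4*d^2 - 53159040*u^4 + 1105920*u^3*d^4 - 15615990*u^3*d^2 + 145278210*u^3 - 4112235*u^2*d^4 + 20299050*u^2*d^2 - 190390200*u^2 + 2646855*u*d^4 - 8453925*u*d^2 + 120270150*u - 29429400"
definition "k6_1 = - 399420*a^4*d - 2212560*a^3*u*d + 2346300*a^3*d + 25650*a^2*b*u*d^2 - 76950*a^2*b*d^2 - 4056885*a^2*u^2*d - 76950*a^2*u*d^3 + 9257490*a^2*u*d + 128250*a^2*d^3 - 4865355*a^2*d + 71550*a*b*u^2*d^2 - 310950*a*b*u*d^2 + 232200*a*b*d^2 - 2730735*a*u^3*d - 326295*a*u^2*d^3 + 10782090*a*u^2*d + 725895*a*u*d^3 - 12362130*a*u*d - 387000*a*d^3 + 4214925*a*d - 675*b^2*u^2*d^3 + 6750*b^2*u*d^3 - 10125*b^2*d^3 + 30375*b*u^3*d^2 + 6750*b*u^2*d^4 - 176625*b*u^2*d^2 - 39825*b*u*d^4 + 351450*b*u*d^2 + 43875*b*d^4 - 163350*b*d^2 - 614565*u^4*d - 254340*u^3*d^3 + 3621420*u^3*d - 10125*u^2*d^5 + 681345*u^2*d^3 - 7117605*u^2*d + 43875*u*d^5 - 781605*u*d^3 + 5341050*u*d - 40500*d^5 + 272250*d^3 - 1287000*d"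
definition "k5_2 = 838960*a^5 + 4624280*a^4*u - 6513540*a^4 - 40920*a^3*b*u*d + 122760*a^3*b*d + 9750940*a^3*u^2 + 122760*a^3*u*d^2 - 27560940*a^3*u - 204600*a^3*d^2 + 19347680*a^3 - 138420*a^2*b*u^2*d + 561030*a^2*b*u*d - 591210*a^2*b*d + 9750940*a^2*u^3 + 935910*a^2*u^2*d^2 - 42161625*a^2*u^2 - 1606860*a^2*u*d^2 + 59451810*a^2*u + 985350*a^2*d^2 - 27516775*a^2 + 900*a*b^2*u^2*d^2 - 9000*a*b^2*u*d^2 + 13500*a*b^2*d^2 - 138420*a*b*u^3*d - 9000*a*b*u^2*d^3 + 808440*a*b*u^2*d + 53100*a*b*u*d^3 - 1518720*a*b*u*d - 58500*a*b*d^3 + 910800*a*b*d + 4624280*a*u^4 + 1629480*a*u^3*d^2 - 27560940*a*u^3 + 13500*a*u^2*d^4 - 4297035*a*u^2*d^2 + 59451810*a*u^2 - 58500*a*u*d^4 + 4055505*a*u*d^2 - 55258775*a*u + 54000*a*d^4 - 1518000*a*d^2 + 18758025*a + 900*b^2*u^3*d^2 - 137235*b^2*u^2*d^2 + 147810*b^2*u*d^2 - 23625*b^2*d^2 - 40920*b*u^4*d - 67380*b*u^3*d^3 + 187200*b*u^3*d + 631650*b*u^2*d^3 - 944505*b*u^2*d - 616695*b*u*d^3 + 1256775*b*u*d + 102375*b*d^3 - 450450*b*d + 838960*u^5 + 52035*u^4*d^4 + 562080*u^4*d^2 - 6513540*u^4 + 216855*u^3*d^4 - 2734875*u^3*d^2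 + 19347680*u^3 - 755145*u^2*d^4 + 4302195*u^2*d^2 - 27516775*u^2 + 537555*u*d^4 - 2927400*u*d^2 + 18758025*u - 94500*d^4 + 750750*d^2 - 4904900"
definition "k4_3 = 241608*a^4*b + 241608*a^4*u*d - 604020*a^4*d + 1135236*a^3*b*u - 1492428*a^3*b + 1135236*a^3*u^2*d - 4453278*a^3*u*d + 3731070*a^3*d - 36180*a^2*b^2*u*d + 72360*a^2*b^2*d - 36180*a^2*b*u^2*d^2 + 1825866*a^2*b*u^2 + 289440*a^2*b*u*d^2 - 4901616*a^2*b*u - 361800*a^2*b*d^2 + 3257430*a^2*b + 1825866*a^2*u^3*d + 72360*a^2*u^2*d^3 - 9733581*a^2*u^2*d - 361800*a^2*u*d^3 + 16031670*a^2*u*d + 361800*a^2*d^3 - 8143575*a^2*d - 89370*a*b^2*u^2*d + 297810*a*b^2*u*d - 227340*a*b^2*d - 89370*a*b*u^3*d^2 + 1135236*a*b*u^3 + 923868*a*b*u^2*d^2 - 4901616*a*b*u^2 - 1921338*a*b*u*d^2 + 6722760*a*b*u + 1136700*a*b*d^2 - 2977260*a*b + 1135236*a*u^4*d + 251163*a*u^3*d^3 - 7737951*a*u^3*d - 1416798*a*u^2*d^3 + 19609050*a*u^2*d + 2272095*a*u*d^3 - 20511315*a*u*d - 1136700*a*d^3 + 7443150*a*d + 1890*b^3*u^2*d^2 - 10800*b^3*u*d^2 + 12150*b^3*d^2 + 1890*b^2*u^3*d^3 - 36180*b^2*u^3*d - 33615*b^2*u^2*d^3 + 181170*b^2*u^2*d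 + 115290*b^2*u*d^3 - 312930*b^2*u*d - 99765*b^2*d^3 + 164700*b^2*d - 36180*b*u^4*d^2 + 241608*b*u^4 - 10800*b*u^3*d^4 + 457308*b*u^3*d^2 - 1492428*b*u^3 + 115290*b*u^2*d^4 - 1478808*b*u^2*d^2 + 3257430*b*u^2 - 305640*b*u*d^4 + 1921950*b*u*d^2 - 2977260*b*u + 225450*b*d^4 - 823500*b*d^2 + 965250*b + 241608*u^5*d + 134523*u^4*d^3 - 2042898*u^4*d + 12150*u^3*d^5 - 890703*u^3*d^3 + 6973785*u^3*d - 99765*u^2*d^5 + 2117340*u^2*d^3 - 11532180*u^2*d + 225450*u*d^5 - 2243790*u*d^3 + 8768760*u*d - 149175*d^5 + 823500*d^3 - 2413125*d"
definition "k3_4 = 266808*a^5 + 1525704*a^4*u - 2346948*a^4 - 25200*a^3*b^2 - 100800*a^3*b*u*d + 184800*a^3*b*d - 25200*a^3*u^2*d^2 + 3286812*a^3*u^2 + 184800*a^3*u*d^2 - 10310994*a^3*u - 210000*a^3*d^2 + 7864890*a^3 - 87480*a^2*b^2*u + 143460*a^2*b^2 - 349920*a^2*b*u^2*d + 1094760*a^2*b*u*d - 1052040*a^2*b*d - 87480*a^2*u^3*d^2 + 3286812*a^2*u^3 + 931788*a^2*u^2*d^2 - 16014357*a^2*u^2 - 1733988*a^2*u*d^2 + 24906420*a^2*u + 1195500*a^2*d^2 - 12522675*a^2 + 3240*a*b^3*u*d - 5400*a*b^3*d + 9990*a*b^2*u^2*d^2 - 87480*a*b^2*u^2 - 50940*a*b^2*u*d^2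 + 314190*a*b^2*u + 52110*a*b^2*d^2 - 256950*a*b^2 + 3240*a*b*u^3*d^3 - 349920*a*b*u^3*d - 50940*a*b*u^2*d^3 + 1642410*a*b*u^2*d + 158940*a*b*u*d^3 - 3012990*a*b*u*d - 127800*a*b*d^3 + 1884300*a*b*d - 87480*a*u^4*d^2 + 1525704*a*u^4 - 5400*a*u^3*d^4 + 1312011*a*u^3*d^2 - 10310994*a*u^3 + 52110*a*u^2*d^4 - 3685506*a*u^2*d^2 + 24906420*a*u^2 - 127800*a*u*d^4 + 4429155*a*u*d^2 - 25549260*a*u + 88650*a*d^4 - 2141250*a*d^2 + 9459450*a + 3240*b^3*u^2*d - 10260*b^3*u*d + 13500*b^3*d + 9990*b^2*u^3*d^2 - 25200*b^2*u^3 - 143775*b^2*u^2*d^2 + 143460*b^2*u^2 + 212220*b^2*u*d^2 - 256950*b^2*u - 130275*b^2*d^2 + 143550*b^2 + 3240*b*u^4*d^3 - 100800*b*u^4*d - 106740*b*u^3*d^3 + 578415*b*u^3*d + 577530*b*u^2*d^3 - 1764390*b*u^2*d - 686340*b*u*d^3 + 2334075*b*u*d + 319500*b*d^3 - 1052700*b*d - 25200*u^5*d^2 + 266808*u^5 + 23130*u^4*d^4 + 415443*u^4*d^2 - 2346948*u^4 + 216360*u^3*d^4 - 1986018*u^3*d^2 + 7864890*u^3 - 601290*u^2*d^4 + 3609360*u^2*d^2 - 12522675*u^2 + 519435*u*d^4 - 3228465*u*d^2 + 9459450*u - 221625*d^4 + 1196250*d^2 - 2713425"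
definition "k2_5 = 889360*a^4*b + 889360*a^4*u*d - 1556380*a^4*d + 4280320*a^3*b*u - 5725760*a^3*b + 4280320*a^3*u^2*d - 13279320*a^3*u*d + 10020080*a^3*d - 50400*a^2*b^3 - 470400*a^2*b^2*u*d + 743400*a^2*b^2*d - 470400*a^2*b*u^2*d^2 + 6967320*a^2*b*u^2 + 2265900*a^2*b*u*d^2 - 19165920*a^2*b*u - 2194500*a^2*b*d^2 + 13028400*a^2*b - 50400*a^2*u^3*d^3 + 6967320*a^2*u^3*d + 743400*a^2*u^2*d^3 - 31256760*a^2*u^2*d - 2194500*a^2*u*d^3 + 46697190*a^2*u*d + 1690500*a^2*d^3 - 22799700*a^2*d - 126720*a*b^3*u + 164160*a*b^3 - 1182720*a*b^2*u^2*d + 3412980*a*b^2*u*d - 2421360*a*b^2*d - 1182720*a*b*u^3*d^2 + 4280320*a*b*u^3 + 7568670*a*b*u^2*d^2 - 19165920*a*b*u^2 - 13231950*a*b*u*d^2 + 27175500*a*b*u + 7147800*a*b*d^2 - 12426700*a*b - 126720*a*u^4*d^3 + 4280320*a*u^4*d + 2336850*a*u^3*d^3 - 26023645*a*u^3*d - 8798685*a*u^2*d^3 + 59931540*a*u^2*d + 11948955*a*u*d^3 - 59955190*a*u*d - 5506200*a*d^3 + 21746725*a*d + 10800*b^4*u*d - 16200*b^4*d + 69300*b^3*u^2*d^2 - 50400*b^3*u^2 - 283950*b^3*u*d^2 + 164160*b^3*u + 255150*b^3*d^2 - 122400*b^3 + 69300*b^2*u^3*d^3 - 470400*b^2*u^3*d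 - 657450*b^2*u^2*d^3 + 2204550*b^2*u^2*d + 1608750*b^2*u*d^3 - 3527850*b^2*u*d - 1120050*b^2*d^3 + 1805400*b^2*d + 10800*b*u^4*d^4 - 470400*b*u^4*d^2 + 889360*b*u^4 - 283950*b*u^3*d^4 + 3884865*b*u^3*d^2 - 5725760*b*u^3 + 1608750*b*u^2*d^4 - 10914585*b*u^2*d^2 + 13028400*b*u^2 - 3051225*b*u*d^4 + 12862470*b*u*d^2 - 12426700*b*u + 1816425*b*d^4 - 5329500*b*d^2 + 4218500*b - 50400*u^5*d^3 + 889360*u^5*d - 16200*u^4*d^5 + 1128420*u^4*d^3 - 7011645*u^4*d + 255150*u^3*d^5 - 5493180*u^3*d^3 + 22067690*u^3*d - 1120050*u^2*d^5 + 11614035*u^2*d^3 - 34463710*u^2*d + 1816425*u*d^5 - 11365125*u*d^3 + 25916880*u*d - 971775*d^5 + 4105500*d^3 - 7382375*d"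
definition "k1_6 = - 667020*a^4 - 3210240*a^3*u + 4294320*a^3 + 273000*a^2*b^2 + 388500*a^2*b*u*d - 1270500*a^2*b*d + 52500*a^2*u^2*d^2 - 5225490*a^2*u^2 - 609000*a^2*u*d^2 + 14374440*a^2*u + 1186500*a^2*d^2 - 9771300*a^2 + 686400*a*b^2*u - 889200*a*b^2 + 1063200*a*b*u^2*d - 4565100*a*b*u*d + 4138200*a*b*d + 218400*a*u^3*d^2 - 3210240*a*u^3 - 2019945*a*u^2*d^2 + 14374440*a*u^2 + 5194095*a*u*d^2 - 20381625*a*u - 3864600*a*d^2 + 9320025*a - 5400*b^4 - 51570*b^3*u*d + 134730*b^3*d - 149220*b^2*u^2*d^2 + 273000*b^2*u^2 + 565200*b^2*u*d^2 - 889200*b^2*u - 731430*b^2*d^2 + 663000*b^2 - 53820*b*u^3*d^3 + 345300*b*u^3*d + 514350*b*u^2*d^3 - 2582925*b*u^2*d - 1365705*b*u*d^3 + 5228625*b*u*d + 1338525*b*d^3 - 3085500*b*d + 43155*u^4*d^4 + 9300*u^4*d^2 - 667020*u^4 + 188775*u^3*d^4 - 1116015*u^3*d^2 + 4294320*u^3 - 443430*u^2*d^4 + 3768345*u^2*d^2 - 9771300*u^2 + 787275*u*d^4 - 5503980*u*d^2 + 9320025*u - 772875*d^4 + 2881500*d^2 - 3163875"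
definition "k0_7 = 9338280*a^4*b + 9338280*a^4*u*d - 14007420*a^4*d + 45384360*a^3*b*u - 61443480*a^3*b + 45384360*a^3*u^2*d - 129520020*a^3*u*d + 92165220*a^3*d - 1940400*a^2*b^3 - 12083400*a^2*b^2*u*d + 17081400*a^2*b^2*d - 12083400*a^2*b*u^2*d^2 + 74265660*a^2*b*u^2 + 46334400*a^2*b*u*d^2 - 207290160*a^2*b*u - 39102000*a^2*b*d^2 + 143255700*a^2*b - 1940400*a^2*u^3*d^3 + 74265660*a^2*u^3*d + 17081400*a^2*u^2*d^3 - 316467180*a^2*u^2*d - 39102000*a^2*u*d^3 + 452410470*a^2*u*d + 25725000*a^2*d^3 - 214883550*a^2*d - 4920300*a*b^3*u + 6444900*a*b^3 - 30640050*a*b^2*u^2*d + 83447700*a*b^2*u*d - 56734650*a*b^2*d - 30640050*a*b*u^3*d^2 + 45384360*a*b*u^3 + 160976460*a*b*u^2*d^2 - 207290160*a*b*u^2 - 255945810*a*b*u*d^2 + 300283200*a*b*u + 129874500*a*b*d^2 - 140544600*a*b - 4920300*a*u^4*d^3 + 45384360*a*u^4*d + 53068515*a*u^3*d^3 - 269592795*a*u^3*d - 163797510*a*u^2*d^3 + 599661090*a*u^2*d + 199480245*a*u*d^3 - 585504105*a*u*d - 85443750*a*d^3 + 210816900*a*d + 32400*b^5 + 905580*b^4*u*d - 1234440*b^4*d + 3816180*b^3*u^2*d^2 - 1940400*b^3*u^2 - 13282560*b^3*u*d^2 + 6444900*b^3*u + 10614240*b^3*d^2 - 4920300*b^3 +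 3816180*b^2*u^3*d^3 - 12083400*b^2*u^3*d - 27196110*b^2*u^2*d^3 + 55744140*b^2*u^2*d + 55396530*b^2*u*d^3 - 86117490*b^2*u*d - 33875100*b^2*d^3 + 43313550*b^2*d + 905580*b*u^4*d^4 - 12083400*b*u^4*d^2 + 9338280*b*u^4 - 13282560*b*u^3*d^4 + 85819380*b*u^3*d^2 - 61443480*b*u^3 + 55396530*b*u^2*d^4 - 222115290*b*u^2*d^2 + 143255700*b*u^2 - 86332050*b*u*d^4 + 246633060*b*u*d^2 - 140544600*b*u + 44730000*b*d^4 - 99151500*b*d^2 + 49318500*b + 32400*u^5*d^5 - 1940400*u^5*d^3 + 9338280*u^5*d - 1234440*u^4*d^5 + 25364955*u^4*d^3 - 73272630*u^4*d + 10614240*u^3*d^5 - 105902295*u^3*d^3 + 226056195*u^3*d - 33875100*u^2*d^5 + 204228990*u^2*d^3 - 344557275*u^2*d + 44730000*u*d^5 - 186765150*u*d^3 + 256498230*u*d - 20682900*d^5 + 65231250*d^3 - 73977750*d"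
definition "k7_1 = 399420*a^3*d + 1186920*a^2*u*d - 1760220*a^2*d - 9450*a*b*u*d^2 + 28350*a*b*d^2 + 917595*a*u^2*d + 28350*a*u*d^3 - 3284820*a*u*d - 47250*a*d^3 + 2477475*a*d - 4725*b*u^2*d^2 + 18900*b*u*d^2 - 42525*b*d^2 + 215145*u^3*d + 81270*u^2*d^3 - 1275120*u^2*d - 104895*u*d^3 + 2252250*u*d + 70875*d^3 - 1126125*d"
definition "k6_2 = 399420*a^4 + 1813140*a^3*u - 2346300*a^3 - 25650*a^2*b*u*d + 76950*a^2*b*d + 2869965*a^2*u^2 + 76950*a^2*u*d^2 - 7497270*a^2*u - 128250*a^2*d^2 + 4865355*a^2 - 62100*a*b*u^2*d + 282600*a*b*u*d - 232200*a*b*d + 1813140*a*u^3 + 297945*a*u^2*d^2 - 7497270*a*u^2 - 678645*a*u*d^2 + 9884655*a*u + 387000*a*d^2 - 4214925*a + 675*b^2*u^2*d^2 - 6750*b^2*u*d^2 + 10125*b^2*d^2 - 25650*b*u^3*d - 6750*b*u^2*d^3 + 157725*b*u^2*d + 39825*b*u*d^3 - 308925*b*u*d - 43875*b*d^3 + 163350*b*d + 399420*u^4 + 173070*u^3*d^2 - 2346300*u^3 + 10125*u^2*d^4 - 576450*u^2*d^2 + 4865355*u^2 - 43875*u*d^4 + 710730*u*d^2 - 4214925*u + 40500*d^4 - 272250*d^2 + 1287000"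
definition "k5_3 = - 81840*a^3*b - 81840*a^3*u*d + 204600*a^3*d - 276840*a^2*b*u + 394140*a^2*b - 276840*a^2*u^2*d + 1009290*a^2*u*d - 985350*a^2*d + 5400*a*b^2*u*d - 10800*a*b^2*d + 5400*a*b*u^2*d^2 - 276840*a*b*u^2 - 43200*a*b*u*d^2 + 833640*a*b*u + 54000*a*b*d^2 - 607200*a*b - 276840*a*u^3*d - 10800*a*u^2*d^3 + 1285440*a*u^2*d + 54000*a*u*d^3 - 2433450*a*u*d - 54000*a*d^3 + 1518000*a*d + 5400*b^2*u^2*d - 16200*b^2*u*d + 18900*b^2*d + 5400*b*u^3*d^2 - 81840*b*u^3 - 54090*b*u^2*d^2 + 394140*b*u^2 + 104040*b*u*d^2 - 607200*b*u - 94500*b*d^2 + 300300*b - 81840*u^4*d - 29115*u^3*d^3 + 496140*u^3*d + 96165*u^2*d^3 - 1254375*u^2*d - 125100*u*d^3 + 1602975*u*d + 94500*d^3 - 750750*d"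
definition "k4_4 = 362412*a^4 + 1702854*a^3*u - 2238642*a^3 - 36180*a^2*b^2 - 144720*a^2*b*u*d + 265320*a^2*b*d - 36180*a^2*u^2*d^2 + 2738799*a^2*u^2 + 265320*a^2*u*d^2 - 7352424*a^2*u - 301500*a^2*d^2 + 4886145*a^2 - 89370*a*b^2*u + 113670*a*b^2 - 357480*a*b*u^2*d + 1128060*a*b*u*d - 833580*a*b*d - 89370*a*u^3*d^2 + 1702854*a*u^3 + 890892*a*u^2*d^2 - 7352424*a*u^2 - 1707732*a*u*d^2 + 10084140*a*u + 947250*a*d^2 - 4465890*a + 4860*b^3*u*d - 8100*b^3*d + 14985*b^2*u^2*d^2 - 36180*b^2*u^2 - 76410*b^2*u*d^2 + 113670*b^2*u + 78165*b^2*d^2 - 82350*b^2 + 4860*b*u^3*d^3 - 144720*b*u^3*d - 76410*b*u^2*d^3 + 699390*b*u^2*d + 238410*b*u*d^3 - 1169370*b*u*d - 191700*b*d^3 + 603900*b*d - 36180*u^4*d^2 + 362412*u^4 - 8100*u^3*d^4 + 462222*u^3*d^2 - 2238642*u^3 + 78165*u^2*d^4 - 1402902*u^2*d^2 + 4886145*u^2 - 191700*u*d^4 + 1685790*u*d^2 - 4465890*u + 132975*d^4 - 686250*d^2 + 1447875"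
definition "k3_5 = - 84000*a^3*b - 84000*a^3*u*d + 147000*a^3*d - 291600*a^2*b*u + 478200*a^2*b - 291600*a^2*u^2*d + 898050*a^2*u*d - 836850*a^2*d + 2160*a*b^3 + 20160*a*b^2*u*d - 31860*a*b^2*d + 20160*a*b*u^2*d^2 - 291600*a*b*u^2 - 97110*a*b*u*d^2 + 1047300*a*b*u + 94050*a*b*d^2 - 856500*a*b + 2160*a*u^3*d^3 - 291600*a*u^3*d - 31860*a*u^2*d^3 + 1287735*a*u^2*d + 94050*a*u*d^3 - 2372160*a*u*d - 72450*a*d^3 + 1498875*a*d + 2160*b^3*u - 5400*b^3 + 20160*b^2*u^2*d - 64710*b^2*u*d + 79650*b^2*d + 20160*b*u^3*d^2 - 84000*b*u^3 - 119385*b*u^2*d^2 + 478200*b*u^2 + 252000*b*u*d^2 - 856500*b*u - 235125*b*d^2 + 478500*b + 2160*u^4*d^3 - 84000*u^4*d - 59760*u^3*d^3 + 526785*u^3*d + 140400*u^2*d^3 - 1298610*u^2*d - 211275*u*d^3 + 1689150*u*d + 181125*d^3 - 837375*d"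
definition "k2_6 = 667020*a^4 + 3210240*a^3*u - 4294320*a^3 - 273000*a^2*b^2 - 829500*a^2*b*u*d + 1270500*a^2*b*d - 273000*a^2*u^2*d^2 + 5225490*a^2*u^2 + 1270500*a^2*u*d^2 - 14374440*a^2*u - 1186500*a^2*d^2 + 9771300*a^2 - 686400*a*b^2*u + 889200*a*b^2 - 2085600*a*b*u^2*d + 5915100*a*b*u*d - 4138200*a*b*d - 686400*a*u^3*d^2 + 3210240*a*u^3 + 4324395*a*u^2*d^2 - 14374440*a*u^2 - 7348695*a*u*d^2 + 20381625*a*u + 3864600*a*d^2 - 9320025*a + 5400*b^4 + 93150*b^3*u*d - 134730*b^3*d + 214650*b^2*u^2*d^2 - 273000*b^2*u^2 - 844830*b^2*u*d^2 + 889200*b^2*u + 731430*b^2*d^2 - 663000*b^2 + 93150*b*u^3*d^3 - 829500*b*u^3*d - 844830*b*u^2*d^3 + 3846525*b*u^2*d + 1987605*b*u*d^3 - 6083625*b*u*d - 1338525*b*d^3 + 3085500*b*d + 5400*u^4*d^4 - 273000*u^4*d^2 + 667020*u^4 - 134730*u^3*d^4 + 2255820*u^3*d^2 - 4294320*u^3 + 731430*u^2*d^4 - 6203700*u^2*d^2 + 9771300*u^2 - 1338525*u*d^4 + 7110480*u*d^2 - 9320025*u + 772875*d^4 - 2881500*d^2 + 3163875"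
definition "k1_7 = 441000*a^2*b + 220500*a^2*u*d - 661500*a^2*d + 1108800*a*b*u - 1436400*a*b + 468000*a*u^2*d - 2304450*a*u*d + 2154600*a*d - 41580*b^3 - 151830*b^2*u*d + 366030*b^2*d + 3870*b*u^2*d^2 + 441000*b*u^2 + 503280*b*u*d^2 - 1436400*b*u - 837900*b*d^2 + 1071000*b - 48555*u^3*d^3 + 263700*u^3*d - 54045*u^2*d^3 - 1139805*u^2*d - 288000*u*d^3 + 2435355*u*d + 551250*d^3 - 1606500*d"
definition "k0_8 = 4669140*a^4 + 22692180*a^3*u - 30721740*a^3 - 4998000*a^2*b^2 - 13524000*a^2*b*u*d + 18816000*a^2*b*d - 4998000*a^2*u^2*d^2 + 37132830*a^2*u^2 + 18816000*a^2*u*d^2 - 103645080*a^2*u - 15582000*a^2*d^2 + 71627850*a^2 - 12673500*a*b^2*u + 16600500*a*b^2 - 34293000*a*b*u^2*d + 92631000*a*b*u*d - 62496000*a*b*d - 12673500*a*u^3*d^2 + 22692180*a*u^3 + 65974440*a*u^2*d^2 - 103645080*a*u^2 - 103442640*a*u*d^2 + 150141600*a*u + 51754500*a*d^2 - 70272300*a + 328860*b^4 + 3505320*b^3*u*d - 4694760*b^3*d + 7156170*b^2*u^2*d^2 - 4998000*b^2*u^2 - 24402420*b^2*u*d^2 + 16600500*b^2*u + 19123650*b^2*d^2 - 12673500*b^2 + 3505320*b*u^3*d^3 - 13524000*b*u^3*d - 24402420*b*u^2*d^3 + 62073060*b*u^2*d + 48654900*b*u*d^3 - 95353860*b*u*d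 - 29194200*b*d^3 + 47712000*b*d + 328860*u^4*d^4 - 4998000*u^4*d^2 + 4669140*u^4 - 4694760*u^3*d^4 + 35416500*u^3*d^2 - 30721740*u^3 + 19123650*u^2*d^4 - 90751500*u^2*d^2 + 71627850*u^2 - 29194200*u*d^4 + 99466500*u*d^2 - 70272300*u + 14852250*d^4 - 39511500*d^2 + 24659250"
definition "k9_0 = - 4102560*a^3 - 12557160*a^2*u + 16715160*a^2 - 12557160*a*u^2 + 32931360*a*u - 21621600*a - 4102560*u^3 - 654885*u^2*d^2 + 16715160*u^2 + 569835*u*d^2 - 21621600*u + 9009000"
definition "k8_1 = 113400*a^2*d + 382725*a*u*d - 329175*a*d - 4725*b*u*d^2 + 14175*b*d^2 + 184275*u^2*d + 14175*u*d^3 - 485100*u*d - 23625*d^3 + 225225*d"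
definition "k7_2 = - 399420*a^3 - 1300320*a^2*u + 1760220*a^2 + 9450*a*b*u*d - 28350*a*b*d - 1300320*a*u^2 - 28350*a*u*d^2 + 3613995*a*u + 47250*a*d^2 - 2477475*a + 9450*b*u^2*d - 33075*b*u*d + 42525*b*d - 399420*u^3 - 95445*u^2*d^2 + 1760220*u^2 + 128520*u*d^2 - 2477475*u - 70875*d^2 + 1126125"
definition "k6_3 = - 51300*a^2*b - 51300*a^2*u*d + 128250*a^2*d - 124200*a*b*u + 154800*a*b - 124200*a*u^2*d + 493650*a*u*d - 387000*a*d + 4050*b^2*u*d - 8100*b^2*d + 4050*b*u^2*d^2 - 51300*b*u^2 - 32400*b*u*d^2 + 154800*b*u + 40500*b*d^2 - 108900*b - 51300*u^3*d - 8100*u^2*d^3 + 285075*u^2*d + 40500*u*d^3 - 526275*u*d - 40500*d^3 + 272250*d"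
definition "k5_4 = - 122760*a^3 - 415260*a^2*u + 591210*a^2 + 5400*a*b^2 + 21600*a*b*u*d - 39600*a*b*d + 5400*a*u^2*d^2 - 415260*a*u^2 - 39600*a*u*d^2 + 1250460*a*u + 45000*a*d^2 - 910800*a + 5400*b^2*u - 9450*b^2 + 21600*b*u^2*d - 63900*b*u*d + 69300*b*d + 5400*u^3*d^2 - 122760*u^3 - 66735*u^2*d^2 + 591210*u^2 + 111735*u*d^2 - 910800*u - 78750*d^2 + 450450"
definition "k4_5 = - 120600*a^2*b - 120600*a^2*u*d + 211050*a^2*d - 297900*a*b*u + 378900*a*b - 297900*a*u^2*d + 913725*a*u*d - 663075*a*d + 3240*b^3 + 30240*b^2*u*d - 47790*b^2*d + 30240*b*u^2*d^2 - 120600*b*u^2 - 145665*b*u*d^2 + 378900*b*u + 141075*b*d^2 - 274500*b + 3240*u^3*d^3 - 120600*u^3*d - 47790*u^2*d^3 + 572265*u^2*d + 141075*u*d^3 - 940140*u*d - 108675*d^3 + 480375*d"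
definition "k3_6 = - 63000*a^3 - 218700*a^2*u + 358650*a^2 + 11700*a*b^2 + 35550*a*b*u*d - 54450*a*b*d + 11700*a*u^2*d^2 - 218700*a*u^2 - 54450*a*u*d^2 + 785475*a*u + 50850*a*d^2 - 642375*a + 11700*b^2*u - 29250*b^2 + 35550*b*u^2*d - 114975*b*u*d + 136125*b*d + 11700*u^3*d^2 - 63000*u^3 - 81675*u^2*d^2 + 358650*u^2 + 156600*u*d^2 - 642375*u - 127125*d^2 + 358875"
definition "k2_7 = - 441000*a^2*b - 441000*a^2*u*d + 661500*a^2*d - 1108800*a*b*u + 1436400*a*b - 1108800*a*u^2*d + 3109050*a*u*d - 2154600*a*d + 41580*b^3 + 258930*b^2*u*d - 366030*b^2*d + 258930*b*u^2*d^2 - 441000*b*u^2 - 992880*b*u*d^2 + 1436400*b*u + 837900*b*d^2 - 1071000*b + 41580*u^3*d^3 - 441000*u^3*d - 366030*u^2*d^3 + 2030805*u^2*d + 837900*u*d^3 - 3186855*u*d - 551250*d^3 + 1606500*d"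
definition "k1_8 = 220500*a^2 + 554400*a*u - 718200*a - 107100*b^2 - 176400*b*u*d + 403200*b*d - 36225*u^2*d^2 + 220500*u^2 + 247275*u*d^2 - 718200*u - 333900*d^2 + 535500"
definition "k0_9 = - 5292000*a^2*b - 5292000*a^2*u*d + 7276500*a^2*d - 13419000*a*b*u + 17577000*a*b - 13419000*a*u^2*d + 36028125*a*u*d - 24168375*a*d + 1189440*b^3 + 6153840*b^2*u*d - 8138340*b^2*d + 6153840*b*u^2*d^2 - 5292000*b*u^2 - 20673765*b*u*d^2 + 17577000*b*u + 15965775*b*d^2 - 13419000*b + 1189440*u^3*d^3 - 5292000*u^3*d - 8138340*u^2*d^3 + 24198615*u^2*d + 15965775*u*d^3 - 37017540*u*d - 9442125*d^3 + 18451125*d"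
definition "k9_1 = - 113400*a*d - 70875*u*d + 155925*d"
definition "k8_2 = - 113400*a^2 - 269325*a*u + 329175*a + 4725*b*u*d - 14175*b*d - 113400*u^2 - 14175*u*d^2 + 329175*u + 23625*d^2 - 225225"
definition "k7_3 = 18900*a*b + 18900*a*u*d - 47250*a*d + 18900*b*u - 28350*b + 18900*u^2*d - 61425*u*d + 70875*d"
definition "k6_4 = - 76950*a^2 - 186300*a*u + 232200*a + 4050*b^2 + 16200*b*u*d - 29700*b*d + 4050*u^2*d^2 - 76950*u^2 - 29700*u*d^2 + 232200*u + 33750*d^2 - 163350"
definition "k5_5 = 18000*a*b + 18000*a*u*d - 31500*a*d + 18000*b*u - 31500*b + 18000*u^2*d - 52875*u*d + 55125*d"
definition "k4_6 = - 90450*a^2 - 223425*a*u + 284175*a + 17550*b^2 + 53325*b*u*d - 81675*b*d + 17550*u^2*d^2 - 90450*u^2 - 81675*u*d^2 + 284175*u + 76275*d^2 - 205875"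
definition "k3_7 = 18900*a*b + 18900*a*u*d - 28350*a*d + 18900*b*u - 47250*b + 18900*u^2*d - 61425*u*d + 70875*d"
definition "k2_8 = - 220500*a^2 - 554400*a*u + 718200*a + 107100*b^2 + 289800*b*u*d - 403200*b*d + 107100*u^2*d^2 - 220500*u^2 - 403200*u*d^2 + 718200*u + 333900*d^2 - 535500"
definition "k1_9 = - 113400*b - 70875*u*d + 155925*d"
definition "k0_10 = - 1984500*a^2 - 5032125*a*u + 6591375*a + 1984500*b^2 + 5032125*b*u*d - 6591375*b*d + 1984500*u^2*d^2 - 1984500*u^2 - 6591375*u*d^2 + 6591375*u + 5032125*d^2 - 5032125"
definition "k11_0 = 1559250*a + 1559250*u - 2027025"
definition "k10_1 = - 42525*d"
definition "k9_2 = 113400*a + 113400*u - 155925"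
definition "k8_3 = 9450*b + 9450*u*d - 23625*d"
definition "k7_4 = 28350*a + 28350*u - 42525"
definition "k6_5 = 13500*b + 13500*u*d - 23625*d"
definition "k5_6 = 13500*a + 13500*u - 23625"
definition "k4_7 = 28350*b + 28350*u*d - 42525*d"
definition "k3_8 = 9450*a + 9450*u - 23625"
definition "k2_9 = 113400*b + 113400*u*d - 155925*d"
definition "k1_10 = - 42525"
definition "k0_11 = 1559250*b + 1559250*u*d - 2027025*d"
definition "k12_0 = 467775"
definition "k10_2 = 42525"
definition "k8_4 = 14175"
definition "k6_6 = 10125"
definition "k4_8 = 14175"
definition "k2_10 = 42525"
definition "k0_12 = 467775"

lemmas k_defs = k7_0_def k6_1_def k5_2_def k4_3_def k3_4_def k2_5_def k1_6_def k0_7_def k7_1_def k6_2_def k5_3_def k4_4_def k3_5_def k2_6_def k1_7_def k0_8_def k9_0_def k8_1_def k7_2_def k6_3_def k5_4_def k4_5_def k3_6_def k2_7_def k1_8_def k0_9_def k9_1_def k8_2_def k7_3_def k6_4_def k5_5_def k4_6_def k3_7_def k2_8_def k1_9_def k0_10_def k11_0_def k10_1_def k9_2_def k8_3_def k7_4_def k6_5_def k5_6_def k4_7_def k3_8_def k2_9_def k1_10_def k0_11_def k12_0_def k10_2_def k8_4_def k6_6_def k4_8_def k2_10_def k0_12_def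

text \<open>The top row carries the factor 45, for the same reason as the factor 3 in the weight
  \<open>n\<close>.\<close>

definition "k p q = (if 7 \<le> p + q \<and> p + q \<le> 12 then
    [[k7_0, k6_1, k5_2, k4_3, k3_4, k2_5, k1_6, k0_7],
     [0, k7_1, k6_2, k5_3, k4_4, k3_5, k2_6, k1_7, k0_8],
     [k9_0, k8_1, k7_2, k6_3, k5_4, k4_5, k3_6, k2_7, k1_8, k0_9],
     [0, k9_1, k8_2, k7_3, k6_4, k5_5, k4_6, k3_7, k2_8, k1_9, k0_10],
     [k11_0, k10_1, k9_2, k8_3, k7_4, k6_5, k5_6, k4_7, k3_8, k2_9, k1_10, k0_11],
     [k12_0, 0, k10_2, 0, k8_4, 0, k6_6, 0, k4_8, 0, k2_10, 0, k0_12]] ! (p + q - 7) ! q else 0)"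

lemma k_adj12_0:
  "adj k 12 0 = 0"
  by (simp add: lie_adjoint_def k_def)

lemma k_adj11_1:
  "adj k 11 1 = 0"
proof -
  have "adj k 11 1 = 1*(k12_0) - 11*(k10_2)"
    by (simp add: lie_adjoint_def k_def)
  also have "\<dots> = 0"
    unfolding k_defs by algebra
  finally show ?thesis .
qed

lemma k_adj10_2:
  "adj k 10 2 = 0"
  by (simp add: lie_adjoint_def k_def)

lemma k_adj9_3:
  "adj k 9 3 = 0"
proof -
  have "adj k 9 3 = 3*(k10_2) - 9*(k8_4)"
    by (simp add: lie_adjoint_def k_def)
  also have "\<dots> = 0"
    unfolding k_defs by algebra
  finally show ?thesis .
qed

lemma k_adj8_4:
  "adj k 8 4 = 0"
  by (simp add: lie_adjoint_def k_def)

lemma k_adj7_5: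
  "adj k 7 5 = 0"
proof -
  have "adj k 7 5 = 5*(k8_4) - 7*(k6_6)"
    by (simp add: lie_adjoint_def k_def)
  also have "\<dots> = 0"
    unfolding k_defs by algebra
  finally show ?thesis .
qed

lemma k_adj6_6:
  "adj k 6 6 = 0"
  by (simp add: lie_adjoint_def k_def)

lemma k_adj5_7:
  "adj k 5 7 = 0"
proof -
  have "adj k 5 7 = 7*(k6_6) - 5*(k4_8)"
    by (simp add: lie_adjoint_def k_def)
  also have "\<dots> = 0"
    unfolding k_defs by algebra
  finally show ?thesis .
qed

lemma k_adj4_8:
  "adj k 4 8 = 0"
  by (simp add: lie_adjoint_def k_def)

lemma k_adj3_9:
  "adj k 3 9 = 0"
proof -
  have "adj k 3 9 = 9*(k4_8) - 3*(k2_10)"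
    by (simp add: lie_adjoint_def k_def)
  also have "\<dots> = 0"
    unfolding k_defs by algebra
  finally show ?thesis .
qed

lemma k_adj2_10:
  "adj k 2 10 = 0"
  by (simp add: lie_adjoint_def k_def)

lemma k_adj1_11:
  "adj k 1 11 = 0"
proof -
  have "adj k 1 11 = 11*(k2_10) - 1*(k0_12)"
    by (simp add: lie_adjoint_def k_def)
  also have "\<dots> = 0"
    unfolding k_defs by algebra
  finally show ?thesis .
qed

lemma k_adj0_12:
  "adj k 0 12 = 0"
  by (simp add: lie_adjoint_def k_def)

lemma k_adj11_0:
  "adj k 11 0 = 0"
proof -
  have "adj k 11 0 = - 11*(k10_1 + d*k10_2)"
    by (simp add: lie_adjoint_def k_def)
  also have "\<dots> = 0"
    unfolding k_defs by algebra
  finally show ?thesis .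
qed

lemma k_adj10_1:
  "adj k 10 1 = 0"
proof -
  have "adj k 10 1 = 1*(k11_0 + k12_0) - 10*(k9_2 + (a + u)*k10_2)"
    by (simp add: lie_adjoint_def k_def)
  also have "\<dots> = 0"
    unfolding k_defs by algebra
  finally show ?thesis .
qed

lemma k_adj9_2:
  "adj k 9 2 = 0"
proof -
  have "adj k 9 2 = 2*(k10_1 + (b + u*d)*k10_2) - 9*(k8_3 + d*k8_4)"
    by (simp add: lie_adjoint_def k_def)
  also have "\<dots> = 0"
    unfolding k_defs by algebra
  finally show ?thesis .
qed

lemma k_adj8_3:
  "adj k 8 3 = 0"
proof -
  have "adj k 8 3 = 3*(k9_2 + k10_2) - 8*(k7_4 + (a + u)*k8_4)"
    by (simp add: lie_adjoint_def k_def)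
  also have "\<dots> = 0"
    unfolding k_defs by algebra
  finally show ?thesis .
qed

lemma k_adj7_4:
  "adj k 7 4 = 0"
proof -
  have "adj k 7 4 = 4*(k8_3 + (b + u*d)*k8_4) - 7*(k6_5 + d*k6_6)"
    by (simp add: lie_adjoint_def k_def)
  also have "\<dots> = 0"
    unfolding k_defs by algebra
  finally show ?thesis .
qed

lemma k_adj6_5:
  "adj k 6 5 = 0"
proof -
  have "adj k 6 5 = 5*(k7_4 + k8_4) - 6*(k5_6 + (a + u)*k6_6)"
    by (simp add: lie_adjoint_def k_def)
  also have "\<dots> = 0"
    unfolding k_defs by algebra
  finally show ?thesis .
qed

lemma k_adj5_6:
  "adj k 5 6 = 0"
proof -
  have "adj k 5 6 = 6*(k6_5 + (b + u*d)*k6_6) - 5*(k4_7 + d*k4_8)"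
    by (simp add: lie_adjoint_def k_def)
  also have "\<dots> = 0"
    unfolding k_defs by algebra
  finally show ?thesis .
qed

lemma k_adj4_7:
  "adj k 4 7 = 0"
proof -
  have "adj k 4 7 = 7*(k5_6 + k6_6) - 4*(k3_8 + (a + u)*k4_8)"
    by (simp add: lie_adjoint_def k_def)
  also have "\<dots> = 0"
    unfolding k_defs by algebra
  finally show ?thesis .
qed

lemma k_adj3_8:
  "adj k 3 8 = 0"
proof -
  have "adj k 3 8 = 8*(k4_7 + (b + u*d)*k4_8) - 3*(k2_9 + d*k2_10)"
    by (simp add: lie_adjoint_def k_def)
  also have "\<dots> = 0"
    unfolding k_defs by algebra
  finally show ?thesis .
qed

lemma k_adj2_9:
  "adj k 2 9 = 0"
proof -
  have "adj k 2 9 = 9*(k3_8 + k4_8) - 2*(k1_10 + (a + u)*k2_10)"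
    by (simp add: lie_adjoint_def k_def)
  also have "\<dots> = 0"
    unfolding k_defs by algebra
  finally show ?thesis .
qed

lemma k_adj1_10:
  "adj k 1 10 = 0"
proof -
  have "adj k 1 10 = 10*(k2_9 + (b + u*d)*k2_10) - 1*(k0_11 + d*k0_12)"
    by (simp add: lie_adjoint_def k_def)
  also have "\<dots> = 0"
    unfolding k_defs by algebra
  finally show ?thesis .
qed

lemma k_adj0_11:
  "adj k 0 11 = 0"
proof -
  have "adj k 0 11 = 11*(k1_10 + k2_10)"
    by (simp add: lie_adjoint_def k_def)
  also have "\<dots> = 0"
    unfolding k_defs by algebra
  finally show ?thesis .
qed

lemma k_adj10_0:
  "adj k 10 0 = 0"
proof -
  have "adj k 10 0 = - 10*(k9_1 + (a + u)*k10_1 + d*k9_2 + a*d*k10_2)"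
    by (simp add: lie_adjoint_def k_def)
  also have "\<dots> = 0"
    unfolding k_defs by algebra
  finally show ?thesis .
qed

lemma k_adj9_1:
  "adj k 9 1 = 0"
proof -
  have "adj k 9 1 = 1*(k11_0 + (b + u*d)*k10_1 + b*(u*d)*k10_2) - 9*(k8_2 + (a + u)*k9_2 + d*k8_3 + a*u*k10_2)"
    by (simp add: lie_adjoint_def k_def)
  also have "\<dots> = 0"
    unfolding k_defs by algebra
  finally show ?thesis .
qed

lemma k_adj8_2:
  "adj k 8 2 = 0"
proof -
  have "adj k 8 2 = 2*(k9_1 + k10_1 + (b + u*d)*k9_2 + b*k10_2) - 8*(k7_3 + (a + u)*k8_3 + d*k7_4 + a*d*k8_4)"
    by (simp add: lie_adjoint_def k_def)
  also have "\<dots> = 0"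
    unfolding k_defs by algebra
  finally show ?thesis .
qed

lemma k_adj7_3:
  "adj k 7 3 = 0"
proof -
  have "adj k 7 3 = 3*(k8_2 + k9_2 + (b + u*d)*k8_3 + b*(u*d)*k8_4) - 7*(k6_4 + (a + u)*k7_4 + d*k6_5 + a*u*k8_4)"
    by (simp add: lie_adjoint_def k_def)
  also have "\<dots> = 0"
    unfolding k_defs by algebra
  finally show ?thesis .
qed

lemma k_adj6_4:
  "adj k 6 4 = 0"
proof -
  have "adj k 6 4 = 4*(k7_3 + k8_3 + (b + u*d)*k7_4 + b*k8_4) - 6*(k5_5 + (a + u)*k6_5 + d*k5_6 + a*d*k6_6)"
    by (simp add: lie_adjoint_def k_def)
  also have "\<dots> = 0"
    unfolding k_defs by algebra
  finally show ?thesis .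
qed

lemma k_adj5_5:
  "adj k 5 5 = 0"
proof -
  have "adj k 5 5 = 5*(k6_4 + k7_4 + (b + u*d)*k6_5 + b*(u*d)*k6_6) - 5*(k4_6 + (a + u)*k5_6 + d*k4_7 + a*u*k6_6)"
    by (simp add: lie_adjoint_def k_def)
  also have "\<dots> = 0"
    unfolding k_defs by algebra
  finally show ?thesis .
qed

lemma k_adj4_6:
  "adj k 4 6 = 0"
proof -
  have "adj k 4 6 = 6*(k5_5 + k6_5 + (b + u*d)*k5_6 + b*k6_6) - 4*(k3_7 + (a + u)*k4_7 + d*k3_8 + a*d*k4_8)"
    by (simp add: lie_adjoint_def k_def)
  also have "\<dots> = 0"
    unfolding k_defs by algebra
  finally show ?thesis .
qed

lemma k_adj3_7:
  "adj k 3 7 = 0"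
proof -
  have "adj k 3 7 = 7*(k4_6 + k5_6 + (b + u*d)*k4_7 + b*(u*d)*k4_8) - 3*(k2_8 + (a + u)*k3_8 + d*k2_9 + a*u*k4_8)"
    by (simp add: lie_adjoint_def k_def)
  also have "\<dots> = 0"
    unfolding k_defs by algebra
  finally show ?thesis .
qed

lemma k_adj2_8:
  "adj k 2 8 = 0"
proof -
  have "adj k 2 8 = 8*(k3_7 + k4_7 + (b + u*d)*k3_8 + b*k4_8) - 2*(k1_9 + (a + u)*k2_9 + d*k1_10 + a*d*k2_10)"
    by (simp add: lie_adjoint_def k_def)
  also have "\<dots> = 0"
    unfolding k_defs by algebra
  finally show ?thesis .
qed

lemma k_adj1_9:
  "adj k 1 9 = 0"
proof -
  have "adj k 1 9 = 9*(k2_8 + k3_8 + (b + u*d)*k2_9 + b*(u*d)*k2_10) - 1*(k0_10 + (a + u)*k1_10 + d*k0_11 + a*u*k2_10)"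
    by (simp add: lie_adjoint_def k_def)
  also have "\<dots> = 0"
    unfolding k_defs by algebra
  finally show ?thesis .
qed

lemma k_adj0_10:
  "adj k 0 10 = 0"
proof -
  have "adj k 0 10 = 10*(k1_9 + k2_9 + (b + u*d)*k1_10 + b*k2_10)"
    by (simp add: lie_adjoint_def k_def)
  also have "\<dots> = 0"
    unfolding k_defs by algebra
  finally show ?thesis .
qed

lemma k_adj9_0:
  "adj k 9 0 = 0"
proof -
  have "adj k 9 0 = - 9*(k8_1 + (a + u)*k9_1 + d*k8_2 + a*u*k10_1 + a*d*k9_2)"
    by (simp add: lie_adjoint_def k_def)
  also have "\<dots> = 0"
    unfolding k_defs by algebra
  finally show ?thesis .
qed

lemma k_adj8_1:
  "adj k 8 1 = 0"
proof -
  have "adj k 8 1 = 1*(k9_0 + (b + u*d)*k9_1 + b*k10_1 + b*(u*d)*k9_2) - 8*(k7_2 + (a + u)*k8_2 + d*k7_3 + a*u*k9_2 + a*d*k8_3)"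
    by (simp add: lie_adjoint_def k_def)
  also have "\<dots> = 0"
    unfolding k_defs by algebra
  finally show ?thesis .
qed

lemma k_adj7_2:
  "adj k 7 2 = 0"
proof -
  have "adj k 7 2 = 2*(k8_1 + k9_1 + (b + u*d)*k8_2 + b*k9_2 + b*(u*d)*k8_3) - 7*(k6_3 + (a + u)*k7_3 + d*k6_4 + a*u*k8_3 + a*d*k7_4)"
    by (simp add: lie_adjoint_def k_def)
  also have "\<dots> = 0"
    unfolding k_defs by algebra
  finally show ?thesis .
qed

lemma k_adj6_3:
  "adj k 6 3 = 0"
proof -
  have "adj k 6 3 = 3*(k7_2 + k8_2 + (b + u*d)*k7_3 + b*k8_3 + b*(u*d)*k7_4) - 6*(k5_4 + (a + u)*k6_4 + d*k5_5 + a*u*k7_4 + a*d*k6_5)"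
    by (simp add: lie_adjoint_def k_def)
  also have "\<dots> = 0"
    unfolding k_defs by algebra
  finally show ?thesis .
qed

lemma k_adj5_4:
  "adj k 5 4 = 0"
proof -
  have "adj k 5 4 = 4*(k6_3 + k7_3 + (b + u*d)*k6_4 + b*k7_4 + b*(u*d)*k6_5) - 5*(k4_5 + (a + u)*k5_5 + d*k4_6 + a*u*k6_5 + a*d*k5_6)"
    by (simp add: lie_adjoint_def k_def)
  also have "\<dots> = 0"
    unfolding k_defs by algebra
  finally show ?thesis .
qed

lemma k_adj4_5:
  "adj k 4 5 = 0"
proof -
  have "adj k 4 5 = 5*(k5_4 + k6_4 + (b + u*d)*k5_5 + b*k6_5 + b*(u*d)*k5_6) - 4*(k3_6 + (a + u)*k4_6 + d*k3_7 + a*u*k5_6 + a*d*k4_7)"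
    by (simp add: lie_adjoint_def k_def)
  also have "\<dots> = 0"
    unfolding k_defs by algebra
  finally show ?thesis .
qed

lemma k_adj3_6:
  "adj k 3 6 = 0"
proof -
  have "adj k 3 6 = 6*(k4_5 + k5_5 + (b + u*d)*k4_6 + b*k5_6 + b*(u*d)*k4_7) - 3*(k2_7 + (a + u)*k3_7 + d*k2_8 + a*u*k4_7 + a*d*k3_8)"
    by (simp add: lie_adjoint_def k_def)
  also have "\<dots> = 0"
    unfolding k_defs by algebra
  finally show ?thesis .
qed

lemma k_adj2_7:
  "adj k 2 7 = 0"
proof -
  have "adj k 2 7 = 7*(k3_6 + k4_6 + (b + u*d)*k3_7 + b*k4_7 + b*(u*d)*k3_8) - 2*(k1_8 + (a + u)*k2_8 + d*k1_9 + a*u*k3_8 + a*d*k2_9)"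
    by (simp add: lie_adjoint_def k_def)
  also have "\<dots> = 0"
    unfolding k_defs by algebra
  finally show ?thesis .
qed

lemma k_adj1_8:
  "adj k 1 8 = 0"
proof -
  have "adj k 1 8 = 8*(k2_7 + k3_7 + (b + u*d)*k2_8 + b*k3_8 + b*(u*d)*k2_9) - 1*(k0_9 + (a + u)*k1_9 + d*k0_10 + a*u*k2_9 + a*d*k1_10)"
    by (simp add: lie_adjoint_def k_def)
  also have "\<dots> = 0"
    unfolding k_defs by algebra
  finally show ?thesis .
qed

lemma k_adj0_9:
  "adj k 0 9 = 0"
proof -
  have "adj k 0 9 = 9*(k1_8 + k2_8 + (b + u*d)*k1_9 + b*k2_9 + b*(u*d)*k1_10)"
    by (simp add: lie_adjoint_def k_def)
  also have "\<dots> = 0"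
    unfolding k_defs by algebra
  finally show ?thesis .
qed

lemma k_adj8_0:
  "adj k 8 0 = 0"
proof -
  have "adj k 8 0 = - 8*(k7_1 + (a + u)*k8_1 + d*k7_2 + a*u*k9_1 + a*d*k8_2)"
    by (simp add: lie_adjoint_def k_def)
  also have "\<dots> = 0"
    unfolding k_defs by algebra
  finally show ?thesis .
qed

lemma k_adj7_1:
  "adj k 7 1 = 0"
proof -
  have "adj k 7 1 = 1*(k9_0 + (b + u*d)*k8_1 + b*k9_1 + b*(u*d)*k8_2) - 7*(k6_2 + (a + u)*k7_2 + d*k6_3 + a*u*k8_2 + a*d*k7_3)"
    by (simp add: lie_adjoint_def k_def)
  also have "\<dots> = 0"
    unfolding k_defs by algebra
  finally show ?thesis .
qed

lemma k_adj6_2: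
  "adj k 6 2 = 0"
proof -
  have "adj k 6 2 = 2*(k7_1 + k8_1 + (b + u*d)*k7_2 + b*k8_2 + b*(u*d)*k7_3) - 6*(k5_3 + (a + u)*k6_3 + d*k5_4 + a*u*k7_3 + a*d*k6_4)"
    by (simp add: lie_adjoint_def k_def)
  also have "\<dots> = 0"
    unfolding k_defs by algebra
  finally show ?thesis .
qed

lemma k_adj5_3:
  "adj k 5 3 = 0"
proof -
  have "adj k 5 3 = 3*(k6_2 + k7_2 + (b + u*d)*k6_3 + b*k7_3 + b*(u*d)*k6_4) - 5*(k4_4 + (a + u)*k5_4 + d*k4_5 + a*u*k6_4 + a*d*k5_5)"
    by (simp add: lie_adjoint_def k_def)
  also have "\<dots> = 0"
    unfolding k_defs by algebra
  finally show ?thesis .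
qed

lemma k_adj4_4:
  "adj k 4 4 = 0"
proof -
  have "adj k 4 4 = 4*(k5_3 + k6_3 + (b + u*d)*k5_4 + b*k6_4 + b*(u*d)*k5_5) - 4*(k3_5 + (a + u)*k4_5 + d*k3_6 + a*u*k5_5 + a*d*k4_6)"
    by (simp add: lie_adjoint_def k_def)
  also have "\<dots> = 0"
    unfolding k_defs by algebra
  finally show ?thesis .
qed

lemma k_adj3_5:
  "adj k 3 5 = 0"
proof -
  have "adj k 3 5 = 5*(k4_4 + k5_4 + (b + u*d)*k4_5 + b*k5_5 + b*(u*d)*k4_6) - 3*(k2_6 + (a + u)*k3_6 + d*k2_7 + a*u*k4_6 + a*d*k3_7)"
    by (simp add: lie_adjoint_def k_def)
  also have "\<dots> = 0"
    unfolding k_defs by algebra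
  finally show ?thesis .
qed

lemma k_adj2_6:
  "adj k 2 6 = 0"
proof -
  have "adj k 2 6 = 6*(k3_5 + k4_5 + (b + u*d)*k3_6 + b*k4_6 + b*(u*d)*k3_7) - 2*(k1_7 + (a + u)*k2_7 + d*k1_8 + a*u*k3_7 + a*d*k2_8)"
    by (simp add: lie_adjoint_def k_def)
  also have "\<dots> = 0"
    unfolding k_defs by algebra
  finally show ?thesis .
qed

lemma k_adj1_7:
  "adj k 1 7 = 0"
proof -
  have "adj k 1 7 = 7*(k2_6 + k3_6 + (b + u*d)*k2_7 + b*k3_7 + b*(u*d)*k2_8) - 1*(k0_8 + (a + u)*k1_8 + d*k0_9 + a*u*k2_8 + a*d*k1_9)"
    by (simp add: lie_adjoint_def k_def)
  also have "\<dots> = 0"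
    unfolding k_defs by algebra
  finally show ?thesis .
qed

text \<open>Four degrees below the top the downward system is compatible only modulo the second
  focal value, which appears as the residue of this equation. The assumption is precisely its
  vanishing.\<close>

lemma k_adj0_8: assumes v2: "2*a = 2*b*d - (d^2 - 1)*(u + 5)"
  shows "adj k 0 8 = 0"
proof -
  have "adj k 0 8 = 8*(k1_7 + k2_7 + (b + u*d)*k1_8 + b*k2_8 + b*(u*d)*k1_9)"
    by (simp add: lie_adjoint_def k_def)
  moreover have "8*(k1_7 + k2_7 + (b + u*d)*k1_8 + b*k2_8 + b*(u*d)*k1_9) - 345600*u*d*(u - 1)*(2*b*d - (d^2 - 1)*(u + 5) - 2*a) = 0"
    unfolding k_defs by algebra
  ultimately show ?thesis using v2 by simp
qed

lemma k_adj7_0: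
  "adj k 7 0 = 0"
proof -
  have "adj k 7 0 = - 7*(k6_1 + (a + u)*k7_1 + d*k6_2 + a*u*k8_1 + a*d*k7_2)"
    by (simp add: lie_adjoint_def k_def)
  also have "\<dots> = 0"
    unfolding k_defs by algebra
  finally show ?thesis .
qed

lemma k_adj6_1:
  "adj k 6 1 = 0"
proof -
  have "adj k 6 1 = 1*(k7_0 + (b + u*d)*k7_1 + b*k8_1 + b*(u*d)*k7_2) - 6*(k5_2 + (a + u)*k6_2 + d*k5_3 + a*u*k7_2 + a*d*k6_3)"
    by (simp add: lie_adjoint_def k_def)
  also have "\<dots> = 0"
    unfolding k_defs by algebra
  finally show ?thesis .
qed

lemma k_adj5_2:
  "adj k 5 2 = 0"
proof -
  have "adj k 5 2 = 2*(k6_1 + k7_1 + (b + u*d)*k6_2 + b*k7_2 + b*(u*d)*k6_3) - 5*(k4_3 + (a + u)*k5_3 + d*k4_4 + a*u*k6_3 + a*d*k5_4)"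
    by (simp add: lie_adjoint_def k_def)
  also have "\<dots> = 0"
    unfolding k_defs by algebra
  finally show ?thesis .
qed

lemma k_adj4_3:
  "adj k 4 3 = 0"
proof -
  have "adj k 4 3 = 3*(k5_2 + k6_2 + (b + u*d)*k5_3 + b*k6_3 + b*(u*d)*k5_4) - 4*(k3_4 + (a + u)*k4_4 + d*k3_5 + a*u*k5_4 + a*d*k4_5)"
    by (simp add: lie_adjoint_def k_def)
  also have "\<dots> = 0"
    unfolding k_defs by algebra
  finally show ?thesis .
qed

lemma k_adj3_4:
  "adj k 3 4 = 0"
proof -
  have "adj k 3 4 = 4*(k4_3 + k5_3 + (b + u*d)*k4_4 + b*k5_4 + b*(u*d)*k4_5) - 3*(k2_5 + (a + u)*k3_5 + d*k2_6 + a*u*k4_5 + a*d*k3_6)"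
    by (simp add: lie_adjoint_def k_def)
  also have "\<dots> = 0"
    unfolding k_defs by algebra
  finally show ?thesis .
qed

lemma k_adj2_5:
  "adj k 2 5 = 0"
proof -
  have "adj k 2 5 = 5*(k3_4 + k4_4 + (b + u*d)*k3_5 + b*k4_5 + b*(u*d)*k3_6) - 2*(k1_6 + (a + u)*k2_6 + d*k1_7 + a*u*k3_6 + a*d*k2_7)"
    by (simp add: lie_adjoint_def k_def)
  also have "\<dots> = 0"
    unfolding k_defs by algebra
  finally show ?thesis .
qed

lemma k_adj1_6:
  "adj k 1 6 = 0"
proof -
  have "adj k 1 6 = 6*(k2_5 + k3_5 + (b + u*d)*k2_6 + b*k3_6 + b*(u*d)*k2_7) - 1*(k0_7 + (a + u)*k1_7 + d*k0_8 + a*u*k2_7 + a*d*k1_8)"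
    by (simp add: lie_adjoint_def k_def)
  also have "\<dots> = 0"
    unfolding k_defs by algebra
  finally show ?thesis .
qed

lemma k_adj0_7:
  "adj k 0 7 = 0"
proof -
  have "adj k 0 7 = 7*(k1_6 + k2_6 + (b + u*d)*k1_7 + b*k2_7 + b*(u*d)*k1_8)"
    by (simp add: lie_adjoint_def k_def)
  also have "\<dots> = 0"
    unfolding k_defs by algebra
  finally show ?thesis .
qed

text \<open>Once more only degrees 5 and 6 of the integral enter and the factors of the third focal
  value split off; the cofactor has degree 5 in \<open>b\<close>. The formula for \<open>a\<close>
  is also what makes the weight annihilate degree 8.\<close>

lemma k_functional:
  assumes a_eq: "a = b*d - (d^2 - 1)*t" and u_eq: "u = 2*t - 5"
  shows "d*(d^2 - 1)*(2*t - 5)*(t - 3)*(143521*b^5*t^2*d^5 - 15*b^5*t^2*d^3 - 1148168*b^5*t*d^5 + 120*b^5*t*d^3 + 2152815*b^5*d^5 - 225*b^5*d^3 - 717605*b^4*t^3*d^6 + 1822023*b^4*t^3*d^4 - 60*b^4*t^3*d^2 + 5310277*b^4*t^2*d^6 - 18777928*b^4*t^2*d^4 + 615*b^4*t^2*d^2 - 8611260*b^4*t*d^6 + 59747783*b^4*t*d^4 - 1845*b^4*t*d^2 - 2152815*b^4*d^6 - 59006100*b^4*d^4 + 1575*b^4*d^2 + 1435210*b^3*t^4*d^7 - 7309107*b^3*t^4*d^5 + 8442066*b^3*t^4*d^3 - 105*b^3*t^4*d - 9759428*b^3*t^3*d^7 + 70109848*b^3*t^3*d^5 - 107788884*b^3*t^3*d^3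 + 1440*b^3*t^3*d + 12916890*b^3*t^2*d^7 - 203284229*b^3*t^2*d^5 + 480085434*b^3*t^2*d^3 - 6555*b^3*t^2*d + 8611260*b^3*t*d^7 + 159387810*b^3*t*d^5 - 895287420*b^3*t*d^3 + 12150*b^3*t*d + 50225640*b^3*d^5 + 596511600*b^3*d^3 - 8100*b^3*d - 1435210*b^2*t^5*d^8 + 10995333*b^2*t^5*d^6 - 25462098*b^2*t^5*d^4 + 16888383*b^2*t^5*d^2 + 8898302*b^2*t^4*d^8 - 97536321*b^2*t^4*d^6 + 301637733*b^2*t^4*d^4 - 264561021*b^2*t^4*d^2 + 315*b^2*t^4 - 8611260*b^2*t^3*d^8 + 249703824*b^2*t^3*d^6 - 1238333595*b^2*t^3*d^4 + 1533459018*b^2*t^3*d^2 - 2835*b^2*t^3 - 12916890*b^2*t^2*d^8 - 116772345*b^2*t^2*d^6 + 2034136581*b^2*t^2*d^4 - 4188888855*b^2*t^2*d^2 + 9225*b^2*t^2 - 163675170*b^2*t*d^6 - 905305680*b^2*t*d^4 + 5463073500*b^2*t*d^2 - 13050*b^2*t + 7768350*b^2*d^6 - 425259000*b^2*d^4 - 2746414800*b^2*d^2 + 6750*b^2 + 717605*b*t^6*d^9 - 7351362*b*t^6*d^7 + 25599318*b*t^6*d^5 - 33974766*b*t^6*d^3 + 12338325*b*t^6*d - 4018588*b*t^5*d^9 + 59854210*b*t^5*d^7 - 279144654*b*t^5*d^5 + 485216370*b*t^5*d^3 - 250507530*b*t^5*d + 2152815*b*t^4*d^9 - 128544968*b*t^4*d^7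 + 1024198446*b*t^4*d^5 - 2569860468*b*t^4*d^3 + 1874761515*b*t^4*d + 8611260*b*t^3*d^9 - 8594340*b*t^3*d^7 - 1311836286*b*t^3*d^5 + 6245818344*b*t^3*d^3 - 6919434450*b*t^3*d + 176673420*b*t^2*d^7 - 167759460*b*t^2*d^5 - 6519344940*b*t^2*d^3 + 13589999100*b*t^2*d - 15536700*b*t*d^7 + 1087033680*b*t*d^5 + 1091037600*b*t*d^3 - 13650644700*b*t*d - 111212100*b*d^5 + 1696829400*b*d^3 + 5527040400*b*d - 143521*t^7*d^10 + 1843128*t^7*d^8 - 8579226*t^7*d^6 + 17086488*t^7*d^4 - 12338325*t^7*d^2 + 717605*t^6*d^10 - 13649929*t^6*d^8 + 85283310*t^6*d^6 - 219486204*t^6*d^4 + 215064945*t^6*d^2 - 36425295*t^6 + 22377815*t^5*d^8 - 265662780*t^5*d^6 + 1014785604*t^5*d^4 - 1410433938*t^5*d^2 + 483002163*t^5 - 2152815*t^4*d^10 + 24984975*t^4*d^8 + 170437290*t^4*d^6 - 1903008366*t^4*d^4 + 4439432223*t^4*d^2 - 2616779655*t^4 - 63223890*t^3*d^8 + 487581960*t^3*d^6 + 505581780*t^3*d^4 - 6662030310*t^3*d^2 + 7432810560*t^3 + 7768350*t^2*d^8 - 686459430*t^2*d^6 + 2711096010*t^2*d^4 + 2957842080*t^2*d^2 - 11694673350*t^2 + 138461850*t*d^6 - 2731594950*t*d^4 + 3127443750*t*d^2 + 9674681850*t - 11632950*d^6 + 406286550*d^4 - 2871526950*d^2 - 3289446450)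 = 0" (is "?v = 0")
proof -
  have v2: "2*a = 2*b*d - (d^2 - 1)*(u + 5)" using a_eq u_eq by (simp add: algebra_simps)
  have lz: "k p q = 0" if "p + q < 7 \<or> 12 < p + q" for p q
    using that by (auto simp: k_def)
  have adj: "adj k p q = 0" if "7 \<le> p + q" "p + q \<le> 12" for p q
  proof -
    have "p + q = 7 \<or> p + q = 8 \<or> p + q = 9 \<or> p + q = 10 \<or> p + q = 11 \<or> p + q = 12"
      using that by linarith
    moreover have "q = 0 \<or> q = 1 \<or> q = 2 \<or> q = 3 \<or> q = 4 \<or> q = 5 \<or> q = 6 \<or> q = 7 \<or> q = 8 \<or> q = 9 \<or> q = 10 \<or> q = 11 \<or> q = 12"
      using that by presburger
    ultimately show ?thesis
      by (elim disjE) (simp_all add: k_adj7_0 k_adj6_1[unfolded One_nat_def] k_adj5_2 k_adj4_3 k_adj3_4 k_adj2_5 k_adj1_6[unfolded One_nat_def] k_adj0_7 k_adj8_0 k_adj7_1[unfolded One_nat_def] k_adj6_2 k_adj5_3 k_adj4_4 k_adj3_5 k_adj2_6 k_adj1_7[unfolded One_nat_def] k_adj0_8[OF v2] k_adj9_0 k_adj8_1[unfolded One_nat_def] k_adj7_2 k_adj6_3 k_adj5_4 k_adj4_5 k_adj3_6 k_adj2_7 k_adj1_8[unfolded One_nat_def] k_adj0_9 k_adj10_0 k_adj9_1[unfolded One_nat_def] k_adj8_2 k_adj7_3 k_adj6_4 k_adj5_5 k_adj4_6 k_adj3_7 k_adj2_8 k_adj1_9[unfolded One_nat_def] k_adj0_10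 k_adj11_0 k_adj10_1[unfolded One_nat_def] k_adj9_2 k_adj8_3 k_adj7_4 k_adj6_5 k_adj5_6 k_adj4_7 k_adj3_8 k_adj2_9 k_adj1_10[unfolded One_nat_def] k_adj0_11 k_adj12_0 k_adj11_1[unfolded One_nat_def] k_adj10_2 k_adj9_3 k_adj8_4 k_adj7_5 k_adj6_6 k_adj5_7 k_adj4_8 k_adj3_9 k_adj2_10 k_adj1_11[unfolded One_nat_def] k_adj0_12)
  qed
  have "(\<Sum>q\<le>5. c (5 - q) q * adj k (5 - q) q)
     + (\<Sum>q\<le>Suc 5. c (Suc 5 - q) q * adj k (Suc 5 - q) q) = 0"
    by (rule adjoint_functional[OF supp lie_zero, where N = 12]) (auto intro!: lz adj)
  then have "c 5 0 * adj k 5 0 + c 4 1 * adj k 4 1 + c 3 2 * adj k 3 2 + c 2 3 * adj k 2 3 + c 1 4 * adj k 1 4 + c 0 5 * adj k 0 5 + c 6 0 * adj k 6 0 + c 5 1 * adj k 5 1 + c 4 2 * adj k 4 2 + c 3 3 * adj k 3 3 + c 2 4 * adj k 2 4 + c 1 5 * adj k 1 5 + c 0 6 * adj k 0 6 = 0"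
    by (simp add: eval_nat_numeral add.assoc)
  then have S: "c 5 0 * adj k 5 0 + c 3 2 * adj k 3 2 + c 2 3 * adj k 2 3 + c 0 5 * adj k 0 5 + c 4 2 * adj k 4 2 + c 3 3 * adj k 3 3 + c 2 4 * adj k 2 4 + c 1 5 * adj k 1 5 + c 0 6 * adj k 0 6 = 0"
    unfolding low pure c14 c41 c51 by simp
  have e50: "adj k 5 0 = - 5*(a*u*k6_1 + a*d*k5_2)"
    by (simp add: lie_adjoint_def k_def)
  have e32: "adj k 3 2 = 2*(b*k5_2 + b*(u*d)*k4_3) - 3*(a*u*k4_3 + a*d*k3_4)"
    by (simp add: lie_adjoint_def k_def)
  have e23: "adj k 2 3 = 3*(b*k4_3 + b*(u*d)*k3_4) - 2*(a*u*k3_4 + a*d*k2_5)"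
    by (simp add: lie_adjoint_def k_def)
  have e05: "adj k 0 5 = 5*(b*k2_5 + b*(u*d)*k1_6)"
    by (simp add: lie_adjoint_def k_def)
  have e42: "adj k 4 2 = 2*(k6_1 + (b + u*d)*k5_2 + b*k6_2 + b*(u*d)*k5_3) - 4*((a + u)*k4_3 + d*k3_4 + a*u*k5_3 + a*d*k4_4)"
    by (simp add: lie_adjoint_def k_def)
  have e33: "adj k 3 3 = 3*(k5_2 + (b + u*d)*k4_3 + b*k5_3 + b*(u*d)*k4_4) - 3*((a + u)*k3_4 + d*k2_5 + a*u*k4_4 + a*d*k3_5)"
    by (simp add: lie_adjoint_def k_def)
  have e24: "adj k 2 4 = 4*(k4_3 + (b + u*d)*k3_4 + b*k4_4 + b*(u*d)*k3_5) - 2*((a + u)*k2_5 + d*k1_6 + a*u*k3_5 + a*d*k2_6)"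
    by (simp add: lie_adjoint_def k_def)
  have e15: "adj k 1 5 = 5*(k3_4 + (b + u*d)*k2_5 + b*k3_5 + b*(u*d)*k2_6) - 1*((a + u)*k1_6 + d*k0_7 + a*u*k2_6 + a*d*k1_7)"
    by (simp add: lie_adjoint_def k_def)
  have e06: "adj k 0 6 = 6*(k2_5 + (b + u*d)*k1_6 + b*k2_6 + b*(u*d)*k1_7)"
    by (simp add: lie_adjoint_def k_def)
  have "6*(15*c 5 0)*adj k 5 0 + 30*(3*c 3 2)*adj k 3 2 + 30*(3*c 2 3)*adj k 2 3 + 6*(15*c 0 5)*adj k 0 5 + 30*(3*c 4 2)*adj k 4 2 + 10*(9*c 3 3)*adj k 3 3 + 15*(6*c 2 4)*adj k 2 4 + 6*(15*c 1 5)*adj k 1 5 + 5*(18*c 0 6)*adj k 0 6 = 0" (is "?s = 0")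
    using S by algebra
  moreover have "?s - 720*?v = 0"
    unfolding e50 e32 e23 e05 e42 e33 e24 e15 e06 unfolding c50 c32 c23 c05 c42 c33 c24 c15 c06 k_defs unfolding a_eq u_eq by algebra
  ultimately show ?thesis by simp
qed

end

section \<open>Elimination\<close>

text \<open>Substitution of \<open>e = n / r\<close> with denominators cleared, in a form that needs
  no distinction whether \<open>r\<close> vanishes.\<close>

lemma homogenize_3:
  fixes e r n :: real
  assumes "r*e = n" and "v0*e^0 + v1*e^1 + v2*e^2 + v3*e^3 = 0"
  shows "v0*(n^0*r^3) + v1*(n^1*r^2) + v2*(n^2*r^1) + v3*(n^3*r^0) = 0"
proof -
  have "v0*(n^0*r^3) + v1*(n^1*r^2) + v2*(n^2*r^1) + v3*(n^3*r^0) = r^3*(v0*e^0 + v1*e^1 + v2*e^2 + v3*e^3)"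
    unfolding assms(1)[symmetric] by (simp add: algebra_simps eval_nat_numeral)
  then show ?thesis using assms(2) by simp
qed

text \<open>The cofactor of the third focal value is linear in the product \<open>b*d\<close>, and
  that of the fourth is a cubic in this product over \<open>t\<close> and \<open>d^2\<close>. After
  the substitution, the last factor is palindromic in \<open>d^2\<close>.\<close>

lemma eliminate_ten:
  fixes b t d :: real
  assumes n: "((t - 3)*(t - 5))*(b*d) = t^3*d^2 - 5*t^2*d^2 + 3*t^2 - 15*t + 15*d^2 + 15" (is "?r*_ = ?n")
    and v: "- 98*b^3*t^2*d^3 + 784*b^3*t*d^3 - 1470*b^3*d^3 + 294*b^2*t^3*d^4 - 624*b^2*t^3*d^2 - 2058*b^2*t^2*d^4 + 6552*b^2*t^2*d^2 + 2940*b^2*t*d^4 - 21012*b^2*t*d^2 + 1470*b^2*d^4 + 20622*b^2*d^2 - 294*b*t^4*d^5 + 1260*b*t^4*d^3 - 906*b*t^4*d + 1764*b*t^3*d^5 - 11496*b*t^3*d^3 + 12840*b*t^3*d - 1470*b*t^2*d^5 + 30534*b*t^2*d^3 - 60456*b*t^2*d - 2940*b*t*d^5 - 17016*b*t*d^3 + 115284*b*t*d - 15390*b*d^3 - 76770*b*d + 98*t^5*d^6 - 636*t^5*d^4 + 906*t^5*d^2 - 490*t^4*d^6 + 4872*t^4*d^4 - 10218*t^4*d^2 + 2682*t^4 - 8577*t^3*d^4 + 36768*t^3*d^2 - 24489*t^3 + 1470*t^2*d^6 - 7782*t^2*d^4 - 38742*t^2*d^2 + 80190*t^2 + 22770*t*d^4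 - 28746*t*d^2 - 112320*t - 4410*d^4 + 52560*d^2 + 56970 = 0" (is "?g = 0")
  shows "(t - 2)*(t - 3)*(t - 3)*(t - 5)*(- 12*t^6*d^4 - 20*t^6*d^2 - 12*t^6 + 219*t^5*d^4 + 346*t^5*d^2 + 219*t^5 - 1701*t^4*d^4 - 2566*t^4*d^2 - 1701*t^4 + 7095*t^3*d^4 + 10442*t^3*d^2 + 7095*t^3 - 16365*t^2*d^4 - 24450*t^2*d^2 - 16365*t^2 + 19050*t*d^4 + 30900*t*d^2 + 19050*t - 8100*d^4 - 16200*d^2 - 8100) = 0" (is "?c = 0")
proof -
  let ?av = "98*t^5*d^6 - 636*t^5*d^4 + 906*t^5*d^2 - 490*t^4*d^6 + 4872*t^4*d^4 - 10218*t^4*d^2 + 2682*t^4 - 8577*t^3*d^4 + 36768*t^3*d^2 - 24489*t^3 + 1470*t^2*d^6 - 7782*t^2*d^4 - 38742*t^2*d^2 + 80190*t^2 + 22770*t*d^4 - 28746*t*d^2 - 112320*t - 4410*d^4 + 52560*d^2 + 56970"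
  let ?bv = "- 294*t^4*d^4 + 1260*t^4*d^2 - 906*t^4 + 1764*t^3*d^4 - 11496*t^3*d^2 + 12840*t^3 - 1470*t^2*d^4 + 30534*t^2*d^2 - 60456*t^2 - 2940*t*d^4 - 17016*t*d^2 + 115284*t - 15390*d^2 - 76770"
  let ?cv = "294*t^3*d^2 - 624*t^3 - 2058*t^2*d^2 + 6552*t^2 + 2940*t*d^2 - 21012*t + 1470*d^2 + 20622"
  let ?dv = "- 98*t^2 + 784*t - 1470"
  have "?av*(b*d)^0 + ?bv*(b*d)^1 + ?cv*(b*d)^2 + ?dv*(b*d)^3 - ?g = 0"
    by algebra
  then have "?av*(b*d)^0 + ?bv*(b*d)^1 + ?cv*(b*d)^2 + ?dv*(b*d)^3 = 0"
    unfolding v by simp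
  note homogenize_3[OF n this]
  moreover have "?av*(?n^0*?r^3) + ?bv*(?n^1*?r^2) + ?cv*(?n^2*?r^1) + ?dv*(?n^3*?r^0) - 3*?c = 0"
    by algebra
  ultimately show ?thesis by simp
qed

lemma homogenize_5:
  fixes e r n :: real
  assumes "r*e = n" and "v0*e^0 + v1*e^1 + v2*e^2 + v3*e^3 + v4*e^4 + v5*e^5 = 0"
  shows "v0*(n^0*r^5) + v1*(n^1*r^4) + v2*(n^2*r^3) + v3*(n^3*r^2) + v4*(n^4*r^1) + v5*(n^5*r^0) = 0"
proof -
  have "v0*(n^0*r^5) + v1*(n^1*r^4) + v2*(n^2*r^3) + v3*(n^3*r^2) + v4*(n^4*r^1) + v5*(n^5*r^0) = r^5*(v0*e^0 + v1*e^1 + v2*e^2 + v3*e^3 + v4*e^4 + v5*e^5)"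
    unfolding assms(1)[symmetric] by (simp add: algebra_simps eval_nat_numeral)
  then show ?thesis using assms(2) by simp
qed

lemma eliminate_twelve:
  fixes b t d :: real
  assumes n: "((t - 3)*(t - 5))*(b*d) = t^3*d^2 - 5*t^2*d^2 + 3*t^2 - 15*t + 15*d^2 + 15" (is "?r*_ = ?n")
    and v: "143521*b^5*t^2*d^5 - 15*b^5*t^2*d^3 - 1148168*b^5*t*d^5 + 120*b^5*t*d^3 + 2152815*b^5*d^5 - 225*b^5*d^3 - 717605*b^4*t^3*d^6 + 1822023*b^4*t^3*d^4 - 60*b^4*t^3*d^2 + 5310277*b^4*t^2*d^6 - 18777928*b^4*t^2*d^4 + 615*b^4*t^2*d^2 - 8611260*b^4*t*d^6 + 59747783*b^4*t*d^4 - 1845*b^4*t*d^2 - 2152815*b^4*d^6 - 59006100*b^4*d^4 + 1575*b^4*d^2 + 1435210*b^3*t^4*d^7 - 7309107*b^3*t^4*d^5 + 8442066*b^3*t^4*d^3 - 105*b^3*t^4*d - 9759428*b^3*t^3*d^7 + 70109848*b^3*t^3*d^5 - 107788884*b^3*t^3*d^3 + 1440*b^3*t^3*d + 12916890*b^3*t^2*d^7 - 203284229*b^3*t^2*d^5 + 480085434*b^3*t^2*d^3 - 6555*b^3*t^2*d + 8611260*b^3*t*d^7 + 159387810*b^3*t*d^5 - 895287420*b^3*t*d^3 + 12150*b^3*t*d + 50225640*b^3*d^5 + 596511600*b^3*d^3 - 8100*b^3*d - 1435210*b^2*t^5*d^8 + 10995333*b^2*t^5*d^6 - 25462098*b^2*t^5*d^4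 + 16888383*b^2*t^5*d^2 + 8898302*b^2*t^4*d^8 - 97536321*b^2*t^4*d^6 + 301637733*b^2*t^4*d^4 - 264561021*b^2*t^4*d^2 + 315*b^2*t^4 - 8611260*b^2*t^3*d^8 + 249703824*b^2*t^3*d^6 - 1238333595*b^2*t^3*d^4 + 1533459018*b^2*t^3*d^2 - 2835*b^2*t^3 - 12916890*b^2*t^2*d^8 - 116772345*b^2*t^2*d^6 + 2034136581*b^2*t^2*d^4 - 4188888855*b^2*t^2*d^2 + 9225*b^2*t^2 - 163675170*b^2*t*d^6 - 905305680*b^2*t*d^4 + 5463073500*b^2*t*d^2 - 13050*b^2*t + 7768350*b^2*d^6 - 425259000*b^2*d^4 - 2746414800*b^2*d^2 + 6750*b^2 + 717605*b*t^6*d^9 - 7351362*b*t^6*d^7 + 25599318*b*t^6*d^5 - 33974766*b*t^6*d^3 + 12338325*b*t^6*d - 4018588*b*t^5*d^9 + 59854210*b*t^5*d^7 - 279144654*b*t^5*d^5 + 485216370*b*t^5*d^3 - 250507530*b*t^5*d + 2152815*b*t^4*d^9 - 128544968*b*t^4*d^7 + 1024198446*b*t^4*d^5 - 2569860468*b*t^4*d^3 + 1874761515*b*t^4*d + 8611260*b*t^3*d^9 - 8594340*b*t^3*d^7 - 1311836286*b*t^3*d^5 + 6245818344*b*t^3*d^3 - 6919434450*b*t^3*d + 176673420*b*t^2*d^7 - 167759460*b*t^2*d^5 - 6519344940*b*t^2*d^3 + 13589999100*b*t^2*d - 15536700*b*t*d^7 + 1087033680*b*t*d^5 + 1091037600*b*t*d^3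 - 13650644700*b*t*d - 111212100*b*d^5 + 1696829400*b*d^3 + 5527040400*b*d - 143521*t^7*d^10 + 1843128*t^7*d^8 - 8579226*t^7*d^6 + 17086488*t^7*d^4 - 12338325*t^7*d^2 + 717605*t^6*d^10 - 13649929*t^6*d^8 + 85283310*t^6*d^6 - 219486204*t^6*d^4 + 215064945*t^6*d^2 - 36425295*t^6 + 22377815*t^5*d^8 - 265662780*t^5*d^6 + 1014785604*t^5*d^4 - 1410433938*t^5*d^2 + 483002163*t^5 - 2152815*t^4*d^10 + 24984975*t^4*d^8 + 170437290*t^4*d^6 - 1903008366*t^4*d^4 + 4439432223*t^4*d^2 - 2616779655*t^4 - 63223890*t^3*d^8 + 487581960*t^3*d^6 + 505581780*t^3*d^4 - 6662030310*t^3*d^2 + 7432810560*t^3 + 7768350*t^2*d^8 - 686459430*t^2*d^6 + 2711096010*t^2*d^4 + 2957842080*t^2*d^2 - 11694673350*t^2 + 138461850*t*d^6 - 2731594950*t*d^4 + 3127443750*t*d^2 + 9674681850*t - 11632950*d^6 + 406286550*d^4 - 2871526950*d^2 - 3289446450 = 0" (is "?g = 0")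
  shows "(t - 2)*(t - 3)*(t - 3)*(t - 5)*d^2*(- 48*t^12*d^6 + 3216*t^12*d^4 + 5432*t^12*d^2 + 3276*t^12 + 8901*t^11*d^6 - 104953*t^11*d^4 - 184892*t^11*d^2 - 118902*t^11 + 3168*t^10*d^8 - 256821*t^10*d^6 + 1576374*t^10*d^4 + 2888112*t^10*d^2 + 1981485*t^10 - 89496*t^9*d^8 + 3602955*t^9*d^6 - 14392580*t^9*d^4 - 27400238*t^9*d^2 - 20030223*t^9 + 1138104*t^8*d^8 - 30911922*t^8*d^6 + 88735207*t^8*d^4 + 176018047*t^8*d^2 + 136607694*t^8 - 8545680*t^7*d^8 + 177859992*t^7*d^6 - 387584315*t^7*d^4 - 807630629*t^7*d^2 - 661070682*t^7 + 41738400*t^6*d^8 - 715380315*t^6*d^6 + 1222558900*t^6*d^4 + 2718652154*t^6*d^2 + 2322827955*t^6 - 137689200*t^5*d^8 + 2040452730*t^5*d^6 - 2782853125*t^5*d^4 - 6779731335*t^5*d^2 - 5957455920*t^5 + 308523600*t^4*d^8 - 4104020715*t^4*d^6 + 4481974690*t^4*d^4 + 12462999190*t^4*d^2 + 11039356485*t^4 - 460251000*t^3*d^8 + 5670735600*t^3*d^6 - 4883056725*t^3*d^4 - 16512617100*t^3*d^2 - 14367479775*t^3 + 434313000*t^2*d^8 - 5091732375*t^2*d^6 + 3286769625*t^2*d^4 + 14998060125*t^2*d^2 + 12414415125*t^2 - 232650000*t*d^8 + 2651109750*t*d^6 - 1110705750*t*d^4 - 8390895750*t*d^2 - 6356630250*t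 + 53460000*d^8 - 599602500*d^6 + 85657500*d^4 + 2183962500*d^2 + 1445242500) = 0" (is "?c = 0")
proof -
  let ?av = "- 143521*t^7*d^12 + 1843128*t^7*d^10 - 8579226*t^7*d^8 + 17086488*t^7*d^6 - 12338325*t^7*d^4 + 717605*t^6*d^12 - 13649929*t^6*d^10 + 85283310*t^6*d^8 - 219486204*t^6*d^6 + 215064945*t^6*d^4 - 36425295*t^6*d^2 + 22377815*t^5*d^10 - 265662780*t^5*d^8 + 1014785604*t^5*d^6 - 1410433938*t^5*d^4 + 483002163*t^5*d^2 - 2152815*t^4*d^12 + 24984975*t^4*d^10 + 170437290*t^4*d^8 - 1903008366*t^4*d^6 + 4439432223*t^4*d^4 - 2616779655*t^4*d^2 - 63223890*t^3*d^10 + 487581960*t^3*d^8 + 505581780*t^3*d^6 - 6662030310*t^3*d^4 + 7432810560*t^3*d^2 + 7768350*t^2*d^10 - 686459430*t^2*d^8 + 2711096010*t^2*d^6 + 2957842080*t^2*d^4 - 11694673350*t^2*d^2 + 138461850*t*d^8 - 2731594950*t*d^6 + 3127443750*t*d^4 + 9674681850*t*d^2 - 11632950*d^8 + 406286550*d^6 - 2871526950*d^4 - 3289446450*d^2"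
  let ?bv = "717605*t^6*d^10 - 7351362*t^6*d^8 + 25599318*t^6*d^6 - 33974766*t^6*d^4 + 12338325*t^6*d^2 - 4018588*t^5*d^10 + 59854210*t^5*d^8 - 279144654*t^5*d^6 + 485216370*t^5*d^4 - 250507530*t^5*d^2 + 2152815*t^4*d^10 - 128544968*t^4*d^8 + 1024198446*t^4*d^6 - 2569860468*t^4*d^4 + 1874761515*t^4*d^2 + 8611260*t^3*d^10 - 8594340*t^3*d^8 - 1311836286*t^3*d^6 + 6245818344*t^3*d^4 - 6919434450*t^3*d^2 + 176673420*t^2*d^8 - 167759460*t^2*d^6 - 6519344940*t^2*d^4 + 13589999100*t^2*d^2 - 15536700*t*d^8 + 1087033680*t*d^6 + 1091037600*t*d^4 - 13650644700*t*d^2 - 111212100*d^6 + 1696829400*d^4 + 5527040400*d^2"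
  let ?cv = "- 1435210*t^5*d^8 + 10995333*t^5*d^6 - 25462098*t^5*d^4 + 16888383*t^5*d^2 + 8898302*t^4*d^8 - 97536321*t^4*d^6 + 301637733*t^4*d^4 - 264561021*t^4*d^2 + 315*t^4 - 8611260*t^3*d^8 + 249703824*t^3*d^6 - 1238333595*t^3*d^4 + 1533459018*t^3*d^2 - 2835*t^3 - 12916890*t^2*d^8 - 116772345*t^2*d^6 + 2034136581*t^2*d^4 - 4188888855*t^2*d^2 + 9225*t^2 - 163675170*t*d^6 - 905305680*t*d^4 + 5463073500*t*d^2 - 13050*t + 7768350*d^6 - 425259000*d^4 - 2746414800*d^2 + 6750"
  let ?dv = "1435210*t^4*d^6 - 7309107*t^4*d^4 + 8442066*t^4*d^2 - 105*t^4 - 9759428*t^3*d^6 + 70109848*t^3*d^4 - 107788884*t^3*d^2 + 1440*t^3 + 12916890*t^2*d^6 - 203284229*t^2*d^4 + 480085434*t^2*d^2 - 6555*t^2 + 8611260*t*d^6 + 159387810*t*d^4 - 895287420*t*d^2 + 12150*t + 50225640*d^4 + 596511600*d^2 - 8100"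
  let ?ev = "- 717605*t^3*d^4 + 1822023*t^3*d^2 - 60*t^3 + 5310277*t^2*d^4 - 18777928*t^2*d^2 + 615*t^2 - 8611260*t*d^4 + 59747783*t*d^2 - 1845*t - 2152815*d^4 - 59006100*d^2 + 1575"
  let ?fv = "143521*t^2*d^2 - 15*t^2 - 1148168*t*d^2 + 120*t + 2152815*d^2 - 225"
  \<comment> \<open>The factor \<open>d^2\<close> gives every monomial at least as many factors
    \<open>d\<close> as factors \<open>b\<close>, so that the quintic becomes a polynomial in
    \<open>b*d\<close>.\<close>
  have "?av*(b*d)^0 + ?bv*(b*d)^1 + ?cv*(b*d)^2 + ?dv*(b*d)^3 + ?ev*(b*d)^4 + ?fv*(b*d)^5 - d^2*?g = 0"
    by algebra
  then have "?av*(b*d)^0 + ?bv*(b*d)^1 + ?cv*(b*d)^2 + ?dv*(b*d)^3 + ?ev*(b*d)^4 + ?fv*(b*d)^5 = 0"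
    unfolding v by simp
  note homogenize_5[OF n this]
  moreover have "?av*(?n^0*?r^5) + ?bv*(?n^1*?r^4) + ?cv*(?n^2*?r^3) + ?dv*(?n^3*?r^2) + ?ev*(?n^4*?r^1) + ?fv*(?n^5*?r^0) - 180*?c = 0"
    by algebra
  ultimately show ?thesis by simp
qed

section \<open>Sign certificates for polynomials in one variable\<close>

lemma pos_certificate:
  fixes p :: real
  assumes "k * p - (e + s) = 0" "0 \<le> s" "0 < e" "0 < k"
  shows "0 < p"
proof -
  have "0 < k * p" using assms by linarith
  then show ?thesis using assms(4) by (simp add: zero_less_mult_iff)
qed

lemma neg_certificate:
  fixes p :: real
  assumes "k * p + (e + s) = 0" "0 \<le> s" "0 < e" "0 < k"
  shows "p < 0"
  using pos_certificate[of k "- p" e s] assms by simp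

text \<open>On an interval, \<open>x\<close> and \<open>y\<close> are scaled distances to the two
  ends. A positive multiple of \<open>- ?p\<close>, less a positive constant, is written as a form
  in \<open>x\<close> and \<open>y\<close> with nonnegative coefficients, a Bernstein
  expansion.\<close>

lemma resultant_left:
  assumes "9/10 \<le> t" "t \<le> 6/5"
  shows "- 16*t^10 + 492*t^9 - 6809*t^8 + 55858*t^7 - 301212*t^6 + 1117238*t^5 - 2887627*t^4 + 5126274*t^3 - 5958530*t^2 + 4076700*t - 1247400 < (0::real)" (is "?p < _")
proof -
  define x y where "x = (10*t - 9)" and "y = (6 - 5*t)"
  have "0 \<le> x" "0 \<le> y" using assms by (simp_all add: x_def y_def field_simps)
  then have S: "0 \<le> 330443675391436*(x^0*y^10) + 1398145892721920*(x^1*y^9) + 2657791713437325*(x^2*y^8) + 2988735628165710*(x^3*y^7) + 2201376926745840*(x^4*y^6) + 1109503009638558*(x^5*y^5) + 387413453809155*(x^6*y^4) + 92512135807350*(x^7*y^3) + 14452536321090*(x^8*y^2) + 1333078742360*(x^9*y^1) + 55088984881*(x^10*y^0)" (is "_ \<le> ?s")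
    by (intro add_nonneg_nonneg mult_nonneg_nonneg zero_le_power) simp_all
  have "576650390625*?p + (3252949438359375 + ?s) = 0"
    unfolding x_def y_def by algebra
  then show ?thesis by (rule neg_certificate[OF _ S]) simp_all
qed

lemma resultant_right:
  assumes "43/11 \<le> t" "t \<le> 51/13"
  shows "- 16*t^10 + 492*t^9 - 6809*t^8 + 55858*t^7 - 301212*t^6 + 1117238*t^5 - 2887627*t^4 + 5126274*t^3 - 5958530*t^2 + 4076700*t - 1247400 < (0::real)" (is "?p < _")
proof -
  define x y where "x = (11*t - 43)" and "y = (51 - 13*t)"
  have "0 \<le> x" "0 \<le> y" using assms by (simp_all add: x_def y_def field_simps)
  then have S: "0 \<le> 5161623940901*(x^0*y^10) + 104478403089580*(x^1*y^9) + 789722682544755*(x^2*y^8) + 3235665804289440*(x^3*y^7) + 8255559246442410*(x^4*y^6) + 13952559317184936*(x^5*y^5) + 15978824838018990*(x^6*y^4) + 12320438202686240*(x^7*y^3) + 6146280068525345*(x^8*y^2) + 1796535865900780*(x^9*y^1) + 234129147298799*(x^10*y^0)" (is "_ \<le> ?s")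
    by (intro add_nonneg_nonneg mult_nonneg_nonneg zero_le_power) simp_all
  have "64000*?p + (203776 + ?s) = 0"
    unfolding x_def y_def by algebra
  then show ?thesis by (rule neg_certificate[OF _ S]) simp_all
qed

text \<open>The interval from 6/5 to 43/11 is cut at 5/2 and 13/4, and on each piece the Bernstein
  coefficients are nonnegative. For the second polynomial below, a single cut at 5/2 serves.\<close>

lemma outer_coeff_middle_1:
  assumes "6/5 \<le> t" "t \<le> 5/2"
  shows "- 12*t^6 + 219*t^5 - 1701*t^4 + 7095*t^3 - 16365*t^2 + 19050*t - 8100 > (0::real)" (is "_ < ?p")
proof -
  define x y where "x = (5*t - 6)" and "y = (5 - 2*t)"
  have "0 \<le> x" "0 \<le> y" using assms by (simp_all add: x_def y_def field_simps)
  then have S: "0 \<le> 379054797*(x^0*y^6) + 1304162412*(x^1*y^5) + 1128436524*(x^2*y^4) + 438714720*(x^3*y^3) + 85017840*(x^4*y^2) + 7708800*(x^5*y^1) + 235200*(x^6*y^0)" (is "_ \<le> ?s")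
    by (intro add_nonneg_nonneg mult_nonneg_nonneg zero_le_power) simp_all
  have "308915776*?p - (17738523075 + ?s) = 0"
    unfolding x_def y_def by algebra
  then show ?thesis by (rule pos_certificate[OF _ S]) simp_all
qed

lemma outer_coeff_middle_2:
  assumes "5/2 \<le> t" "t \<le> 13/4"
  shows "- 12*t^6 + 219*t^5 - 1701*t^4 + 7095*t^3 - 16365*t^2 + 19050*t - 8100 > (0::real)" (is "_ < ?p")
proof -
  define x y where "x = (2*t - 5)" and "y = (13 - 4*t)"
  have "0 \<le> x" "0 \<le> y" using assms by (simp_all add: x_def y_def field_simps)
  then have S: "0 \<le> 1187*(x^0*y^6) + 9219*(x^1*y^5) + 26910*(x^2*y^4) + 37250*(x^3*y^3) + 25521*(x^4*y^2) + 9747*(x^5*y^1) + 2432*(x^6*y^0)" (is "_ \<le> ?s")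
    by (intro add_nonneg_nonneg mult_nonneg_nonneg zero_le_power) simp_all
  have "7776*?p - (27702 + ?s) = 0"
    unfolding x_def y_def by algebra
  then show ?thesis by (rule pos_certificate[OF _ S]) simp_all
qed

lemma outer_coeff_middle_3:
  assumes "13/4 \<le> t" "t \<le> 43/11"
  shows "- 12*t^6 + 219*t^5 - 1701*t^4 + 7095*t^3 - 16365*t^2 + 19050*t - 8100 > (0::real)" (is "_ < ?p")
proof -
  define x y where "x = (4*t - 13)" and "y = (43 - 11*t)"
  have "0 \<le> x" "0 \<le> y" using assms by (simp_all add: x_def y_def field_simps)
  then have S: "0 \<le> 5636096*(x^0*y^6) + 78779784*(x^1*y^5) + 731877840*(x^2*y^4) + 3828083480*(x^3*y^3) + 9536837040*(x^4*y^2) + 9036597624*(x^5*y^1) + 87365111*(x^6*y^0)" (is "_ \<le> ?s")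
    by (intro add_nonneg_nonneg mult_nonneg_nonneg zero_le_power) simp_all
  have "118964664200*?p - (29146342729 + ?s) = 0"
    unfolding x_def y_def by algebra
  then show ?thesis by (rule pos_certificate[OF _ S]) simp_all
qed

lemma discr_coeff_middle_1:
  assumes "6/5 \<le> t" "t \<le> 5/2"
  shows "- 44*t^6 + 784*t^5 - 5968*t^4 + 24632*t^3 - 57180*t^2 + 69000*t - 32400 > (0::real)" (is "_ < ?p")
proof -
  define x y where "x = (5*t - 6)" and "y = (5 - 2*t)"
  have "0 \<le> x" "0 \<le> y" using assms by (simp_all add: x_def y_def field_simps)
  then have S: "0 \<le> 107986825*(x^0*y^6) + 7407575100*(x^1*y^5) + 7889459100*(x^2*y^4) + 3437791200*(x^3*y^3) + 744886000*(x^4*y^2) + 79445440*(x^5*y^1) + 3337696*(x^6*y^0)" (is "_ \<le> ?s")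
    by (intro add_nonneg_nonneg mult_nonneg_nonneg zero_le_power) simp_all
  have "965361800*?p - (33358076999 + ?s) = 0"
    unfolding x_def y_def by algebra
  then show ?thesis by (rule pos_certificate[OF _ S]) simp_all
qed

lemma discr_coeff_middle_2:
  assumes "5/2 \<le> t" "t \<le> 43/11"
  shows "- 44*t^6 + 784*t^5 - 5968*t^4 + 24632*t^3 - 57180*t^2 + 69000*t - 32400 > (0::real)" (is "_ < ?p")
proof -
  define x y where "x = (2*t - 5)" and "y = (43 - 11*t)"
  have "0 \<le> x" "0 \<le> y" using assms by (simp_all add: x_def y_def field_simps)
  then have S: "0 \<le> 1873424*(x^0*y^6) + 26792992*(x^1*y^5) + 70772640*(x^2*y^4) + 287714560*(x^3*y^3) + 3999604460*(x^4*y^2) + 21157927092*(x^5*y^1) + 459172901*(x^6*y^0)" (is "_ \<le> ?s")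
    by (intro add_nonneg_nonneg mult_nonneg_nonneg zero_le_power) simp_all
  have "88750368100*?p - (229863453379 + ?s) = 0"
    unfolding x_def y_def by algebra
  then show ?thesis by (rule pos_certificate[OF _ S]) simp_all
qed

text \<open>On a half-line the certificate is the Taylor expansion at the end point, whose
  coefficients all have the same sign.\<close>

lemma outer_coeff_left:
  assumes "t \<le> 9/10"
  shows "- 12*t^6 + 219*t^5 - 1701*t^4 + 7095*t^3 - 16365*t^2 + 19050*t - 8100 < (0::real)" (is "?p < _")
proof -
  define x where "x = 9 - 10*t"
  have "0 \<le> x" using assms by (simp add: x_def field_simps)
  then have S: "0 \<le> 127482411*x^1 + 19984740*x^2 + 1285170*x^3 + 43065*x^4 + 771*x^5 + 6*x^6" (is "_ \<le> ?s")
    by (intro add_nonneg_nonneg mult_nonneg_nonneg zero_le_power) simp_all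
  have "500000*?p + (15740541 + ?s) = 0"
    unfolding x_def by algebra
  then show ?thesis by (rule neg_certificate[OF _ S]) simp_all
qed

lemma discr_coeff_left:
  assumes "t \<le> 9/10"
  shows "- 44*t^6 + 784*t^5 - 5968*t^4 + 24632*t^3 - 57180*t^2 + 69000*t - 32400 < (0::real)" (is "?p < _")
proof -
  define x where "x = 9 - 10*t"
  have "0 \<le> x" using assms by (simp add: x_def field_simps)
  then have S: "0 \<le> 273627366*x^1 + 35989365*x^2 + 2214020*x^3 + 74365*x^4 + 1366*x^5 + 11*x^6" (is "_ \<le> ?s")
    by (intro add_nonneg_nonneg mult_nonneg_nonneg zero_le_power) simp_all
  have "250000*?p + (533779011 + ?s) = 0"
    unfolding x_def by algebra
  then show ?thesis by (rule neg_certificate[OF _ S]) simp_all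
qed

lemma outer_coeff_right:
  assumes "51/13 \<le> t"
  shows "- 12*t^6 + 219*t^5 - 1701*t^4 + 7095*t^3 - 16365*t^2 + 19050*t - 8100 < (0::real)" (is "?p < _")
proof -
  define x where "x = 13*t - 51"
  have "0 \<le> x" using assms by (simp add: x_def field_simps)
  then have S: "0 \<le> 42189348*x^1 + 9883794*x^2 + 841731*x^3 + 29664*x^4 + 825*x^5 + 12*x^6" (is "_ \<le> ?s")
    by (intro add_nonneg_nonneg mult_nonneg_nonneg zero_le_power) simp_all
  have "4826809*?p + (4976334 + ?s) = 0"
    unfolding x_def by algebra
  then show ?thesis by (rule neg_certificate[OF _ S]) simp_all
qed

lemma discr_coeff_right:
  assumes "51/13 \<le> t"
  shows "- 44*t^6 + 784*t^5 - 5968*t^4 + 24632*t^3 - 57180*t^2 + 69000*t - 32400 < (0::real)" (is "?p < _")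
proof -
  define x where "x = 13*t - 51"
  have "0 \<le> x" using assms by (simp add: x_def field_simps)
  then have S: "0 \<le> 182709120*x^1 + 38622360*x^2 + 3275224*x^3 + 126292*x^4 + 3272*x^5 + 44*x^6" (is "_ \<le> ?s")
    by (intro add_nonneg_nonneg mult_nonneg_nonneg zero_le_power) simp_all
  have "4826809*?p + (6950520 + ?s) = 0"
    unfolding x_def by algebra
  then show ?thesis by (rule neg_certificate[OF _ S]) simp_all
qed

text \<open>With \<open>D = d\<^sup>2\<close>, the fourth focal value reduces to \<open>P (D\<^sup>2 + 1) + Q D = P (D - 1)\<^sup>2 + (Q + 2 P) D\<close>;
  the polynomial in the conclusion is the essential factor of its resultant with the fifth focal value.\<close>

lemma resultant_nonzero:
  fixes t D :: real
  assumes D: "0 < D" "D \<noteq> 1" and w: "(- 12*t^6 + 219*t^5 - 1701*t^4 + 7095*t^3 - 16365*t^2 + 19050*t - 8100)*(D - 1)^2 + (- 44*t^6 + 784*t^5 - 5968*t^4 + 24632*t^3 - 57180*t^2 + 69000*t - 32400)*D = 0"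
  shows "- 16*t^10 + 492*t^9 - 6809*t^8 + 55858*t^7 - 301212*t^6 + 1117238*t^5 - 2887627*t^4 + 5126274*t^3 - 5958530*t^2 + 4076700*t - 1247400 \<noteq> 0"
proof -
  define P where "P = - 12*t^6 + 219*t^5 - 1701*t^4 + 7095*t^3 - 16365*t^2 + 19050*t - 8100"
  define Q where "Q = - 44*t^6 + 784*t^5 - 5968*t^4 + 24632*t^3 - 57180*t^2 + 69000*t - 32400"
  have w: "P*(D - 1)^2 + Q*D = 0" using w unfolding P_def Q_def .
  have D1: "0 < (D - 1)^2" using D by simp
  \<comment> \<open>Since \<open>D > 0\<close> and \<open>D \<noteq> 1\<close>, the equation is a
    combination of \<open>P\<close> and \<open>Q\<close> with positive factors, so the two cannot
    have the same strict sign. That confines \<open>t\<close> to two short intervals, on which the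
    polynomial in the conclusion is negative.\<close>
  have "\<not> (P < 0 \<and> Q < 0)"
    using w D D1 by (metis add_neg_neg less_irrefl mult_neg_pos)
  moreover have "\<not> (0 < P \<and> 0 < Q)"
    using w D D1 by (metis add_pos_pos less_irrefl mult_pos_pos)
  moreover have "P < 0 \<and> Q < 0" if "t \<le> 9/10 \<or> 51/13 \<le> t"
    using that outer_coeff_left discr_coeff_left outer_coeff_right discr_coeff_right unfolding P_def Q_def by blast
  moreover have "0 < P \<and> 0 < Q" if "6/5 \<le> t" "t \<le> 43/11"
    using that outer_coeff_middle_1[of t] outer_coeff_middle_2[of t] outer_coeff_middle_3[of t] discr_coeff_middle_1[of t] discr_coeff_middle_2[of t] unfolding P_def Q_def by (meson linear)
  ultimately have "9/10 \<le> t \<and> t \<le> 6/5 \<or> 43/11 \<le> t \<and> t \<le> 51/13" by linarith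
  then show ?thesis using resultant_left[of t] resultant_right[of t] by linarith
qed

lemma elimination:
  fixes b t d :: real
  assumes d: "d \<noteq> 0" "d^2 \<noteq> 1" and t3: "t \<noteq> 3"
    and v8: "b*t^2*d - 8*b*t*d + 15*b*d - t^3*d^2 + 5*t^2*d^2 - 3*t^2 + 15*t - 15*d^2 - 15 = 0"
    and v10: "- 98*b^3*t^2*d^3 + 784*b^3*t*d^3 - 1470*b^3*d^3 + 294*b^2*t^3*d^4 - 624*b^2*t^3*d^2 - 2058*b^2*t^2*d^4 + 6552*b^2*t^2*d^2 + 2940*b^2*t*d^4 - 21012*b^2*t*d^2 + 1470*b^2*d^4 + 20622*b^2*d^2 - 294*b*t^4*d^5 + 1260*b*t^4*d^3 - 906*b*t^4*d + 1764*b*t^3*d^5 - 11496*b*t^3*d^3 + 12840*b*t^3*d - 1470*b*t^2*d^5 + 30534*b*t^2*d^3 - 60456*b*t^2*d - 2940*b*t*d^5 - 17016*b*t*d^3 + 115284*b*t*d - 15390*b*d^3 - 76770*b*d + 98*t^5*d^6 - 636*t^5*d^4 + 906*t^5*d^2 - 490*t^4*d^6 + 4872*t^4*d^4 - 10218*t^4*d^2 + 2682*t^4 - 8577*t^3*d^4 + 36768*t^3*d^2 - 24489*t^3 + 1470*t^2*d^6 - 7782*t^2*d^4 - 38742*t^2*d^2 + 80190*t^2 + 22770*t*d^4 - 28746*t*d^2 - 112320*t - 4410*d^4 + 52560*d^2 + 56970 = 0"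
    and v12: "143521*b^5*t^2*d^5 - 15*b^5*t^2*d^3 - 1148168*b^5*t*d^5 + 120*b^5*t*d^3 + 2152815*b^5*d^5 - 225*b^5*d^3 - 717605*b^4*t^3*d^6 + 1822023*b^4*t^3*d^4 - 60*b^4*t^3*d^2 + 5310277*b^4*t^2*d^6 - 18777928*b^4*t^2*d^4 + 615*b^4*t^2*d^2 - 8611260*b^4*t*d^6 + 59747783*b^4*t*d^4 - 1845*b^4*t*d^2 - 2152815*b^4*d^6 - 59006100*b^4*d^4 + 1575*b^4*d^2 + 1435210*b^3*t^4*d^7 - 7309107*b^3*t^4*d^5 + 8442066*b^3*t^4*d^3 - 105*b^3*t^4*d - 9759428*b^3*t^3*d^7 + 70109848*b^3*t^3*d^5 - 107788884*b^3*t^3*d^3 + 1440*b^3*t^3*d + 12916890*b^3*t^2*d^7 - 203284229*b^3*t^2*d^5 + 480085434*b^3*t^2*d^3 - 6555*b^3*t^2*d + 8611260*b^3*t*d^7 + 159387810*b^3*t*d^5 - 895287420*b^3*t*d^3 + 12150*b^3*t*d + 50225640*b^3*d^5 + 596511600*b^3*d^3 - 8100*b^3*d - 1435210*b^2*t^5*d^8 + 10995333*b^2*t^5*d^6 - 25462098*b^2*t^5*d^4 + 16888383*b^2*t^5*d^2 + 8898302*b^2*t^4*d^8 - 97536321*b^2*t^4*d^6 + 301637733*b^2*t^4*d^4 - 264561021*b^2*t^4*d^2 + 315*b^2*t^4 - 8611260*b^2*t^3*d^8 + 249703824*b^2*t^3*d^6 - 1238333595*b^2*t^3*d^4 + 1533459018*b^2*t^3*d^2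 - 2835*b^2*t^3 - 12916890*b^2*t^2*d^8 - 116772345*b^2*t^2*d^6 + 2034136581*b^2*t^2*d^4 - 4188888855*b^2*t^2*d^2 + 9225*b^2*t^2 - 163675170*b^2*t*d^6 - 905305680*b^2*t*d^4 + 5463073500*b^2*t*d^2 - 13050*b^2*t + 7768350*b^2*d^6 - 425259000*b^2*d^4 - 2746414800*b^2*d^2 + 6750*b^2 + 717605*b*t^6*d^9 - 7351362*b*t^6*d^7 + 25599318*b*t^6*d^5 - 33974766*b*t^6*d^3 + 12338325*b*t^6*d - 4018588*b*t^5*d^9 + 59854210*b*t^5*d^7 - 279144654*b*t^5*d^5 + 485216370*b*t^5*d^3 - 250507530*b*t^5*d + 2152815*b*t^4*d^9 - 128544968*b*t^4*d^7 + 1024198446*b*t^4*d^5 - 2569860468*b*t^4*d^3 + 1874761515*b*t^4*d + 8611260*b*t^3*d^9 - 8594340*b*t^3*d^7 - 1311836286*b*t^3*d^5 + 6245818344*b*t^3*d^3 - 6919434450*b*t^3*d + 176673420*b*t^2*d^7 - 167759460*b*t^2*d^5 - 6519344940*b*t^2*d^3 + 13589999100*b*t^2*d - 15536700*b*t*d^7 + 1087033680*b*t*d^5 + 1091037600*b*t*d^3 - 13650644700*b*t*d - 111212100*b*d^5 + 1696829400*b*d^3 + 5527040400*b*d - 143521*t^7*d^10 + 1843128*t^7*d^8 - 8579226*t^7*d^6 + 17086488*t^7*d^4 - 12338325*t^7*d^2 + 717605*t^6*d^10 - 13649929*t^6*d^8 + 85283310*t^6*d^6 - 219486204*t^6*d^4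 + 215064945*t^6*d^2 - 36425295*t^6 + 22377815*t^5*d^8 - 265662780*t^5*d^6 + 1014785604*t^5*d^4 - 1410433938*t^5*d^2 + 483002163*t^5 - 2152815*t^4*d^10 + 24984975*t^4*d^8 + 170437290*t^4*d^6 - 1903008366*t^4*d^4 + 4439432223*t^4*d^2 - 2616779655*t^4 - 63223890*t^3*d^8 + 487581960*t^3*d^6 + 505581780*t^3*d^4 - 6662030310*t^3*d^2 + 7432810560*t^3 + 7768350*t^2*d^8 - 686459430*t^2*d^6 + 2711096010*t^2*d^4 + 2957842080*t^2*d^2 - 11694673350*t^2 + 138461850*t*d^6 - 2731594950*t*d^4 + 3127443750*t*d^2 + 9674681850*t - 11632950*d^6 + 406286550*d^4 - 2871526950*d^2 - 3289446450 = 0"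
  shows "t = 2"
proof (rule ccontr)
  assume t2: "t \<noteq> 2"
  have n: "((t - 3)*(t - 5))*(b*d) = t^3*d^2 - 5*t^2*d^2 + 3*t^2 - 15*t + 15*d^2 + 15"
    using v8 by algebra
  \<comment> \<open>At \<open>t = 5\<close> the left-hand side of \<open>n\<close> vanishes, while
    the right-hand side is \<open>15*d^2 + 15\<close>.\<close>
  have t5: "t \<noteq> 5"
  proof
    assume "t = 5"
    then have "d^2 = - 1" using n by simp
    then show False by (metis neg_0_le_iff_le not_one_le_zero zero_le_power2)
  qed
  have W: "- 12*t^6*d^4 - 20*t^6*d^2 - 12*t^6 + 219*t^5*d^4 + 346*t^5*d^2 + 219*t^5 - 1701*t^4*d^4 - 2566*t^4*d^2 - 1701*t^4 + 7095*t^3*d^4 + 10442*t^3*d^2 + 7095*t^3 - 16365*t^2*d^4 - 24450*t^2*d^2 - 16365*t^2 + 19050*t*d^4 + 30900*t*d^2 + 19050*t - 8100*d^4 - 16200*d^2 - 8100 = 0" (is "?w = 0")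
    using eliminate_ten[OF n v10] t2 t3 t5 by simp
  have Z: "- 48*t^12*d^6 + 3216*t^12*d^4 + 5432*t^12*d^2 + 3276*t^12 + 8901*t^11*d^6 - 104953*t^11*d^4 - 184892*t^11*d^2 - 118902*t^11 + 3168*t^10*d^8 - 256821*t^10*d^6 + 1576374*t^10*d^4 + 2888112*t^10*d^2 + 1981485*t^10 - 89496*t^9*d^8 + 3602955*t^9*d^6 - 14392580*t^9*d^4 - 27400238*t^9*d^2 - 20030223*t^9 + 1138104*t^8*d^8 - 30911922*t^8*d^6 + 88735207*t^8*d^4 + 176018047*t^8*d^2 + 136607694*t^8 - 8545680*t^7*d^8 + 177859992*t^7*d^6 - 387584315*t^7*d^4 - 807630629*t^7*d^2 - 661070682*t^7 + 41738400*t^6*d^8 - 715380315*t^6*d^6 + 1222558900*t^6*d^4 + 2718652154*t^6*d^2 + 2322827955*t^6 - 137689200*t^5*d^8 + 2040452730*t^5*d^6 - 2782853125*t^5*d^4 - 6779731335*t^5*d^2 - 5957455920*t^5 + 308523600*t^4*d^8 - 4104020715*t^4*d^6 + 4481974690*t^4*d^4 + 12462999190*t^4*d^2 + 11039356485*t^4 - 460251000*t^3*d^8 + 5670735600*t^3*d^6 - 4883056725*t^3*d^4 - 16512617100*t^3*d^2 - 14367479775*t^3 + 434313000*t^2*d^8 - 5091732375*t^2*d^6 + 3286769625*t^2*d^4 + 14998060125*t^2*d^2 + 12414415125*t^2 - 232650000*t*d^8 + 2651109750*t*d^6 - 1110705750*t*d^4 - 8390895750*t*d^2 - 6356630250*t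 + 53460000*d^8 - 599602500*d^6 + 85657500*d^4 + 2183962500*d^2 + 1445242500 = 0" (is "?z = 0")
    using eliminate_twelve[OF n v12] t2 t3 t5 d by simp
  let ?p = "- 12*t^6 + 219*t^5 - 1701*t^4 + 7095*t^3 - 16365*t^2 + 19050*t - 8100" and ?q = "- 44*t^6 + 784*t^5 - 5968*t^4 + 24632*t^3 - 57180*t^2 + 69000*t - 32400" and ?c = "- 16*t^10 + 492*t^9 - 6809*t^8 + 55858*t^7 - 301212*t^6 + 1117238*t^5 - 2887627*t^4 + 5126274*t^3 - 5958530*t^2 + 4076700*t - 1247400"
  \<comment> \<open>Division in the variable \<open>d^2\<close>. As \<open>?w\<close> is palindromic
    with outer coefficient \<open>?p\<close>, a quotient with the leading and the constant
    coefficient of \<open>?z\<close> matches both ends; the remainder is a multiple of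
    \<open>d^2*(d^2 + 1)\<close>.\<close>
  have "?p*?z - ?w*(- 48*t^12*d^2 + 3276*t^12 + 8901*t^11*d^2 - 118902*t^11 + 3168*t^10*d^4 - 262101*t^10*d^2 + 1981485*t^10 - 89496*t^9*d^4 + 3747099*t^9*d^2 - 20030223*t^9 + 1138104*t^8*d^4 - 32687586*t^8*d^2 + 136607694*t^8 - 8545680*t^7*d^4 + 190851960*t^7*d^2 - 661070682*t^7 + 41738400*t^6*d^4 - 777811035*t^6*d^2 + 2322827955*t^6 - 137689200*t^5*d^4 + 2245797210*t^5*d^2 - 5957455920*t^5 + 308523600*t^4*d^4 - 4570561515*t^4*d^2 + 11039356485*t^4 - 460251000*t^3*d^4 + 6390676800*t^3*d^2 - 14367479775*t^3 + 434313000*t^2*d^4 - 5810670375*t^2*d^2 + 12414415125*t^2 - 232650000*t*d^4 + 3068889750*t*d^2 - 6356630250*t + 53460000*d^4 - 706522500*d^2 + 1445242500) - 15*(t*(t - 3)*(t - 3)*(t - 3)*(t - 4)*(t - 5)*(t - 5)*(t - 5)*?c*(d^2*(d^2 + 1))) = 0"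
    by algebra
  then have C: "t*(t - 3)*(t - 3)*(t - 3)*(t - 4)*(t - 5)*(t - 5)*(t - 5)*?c*(d^2*(d^2 + 1)) = 0"
    unfolding W Z by simp
  have W2: "?p*(d^2 - 1)^2 + ?q*d^2 = 0"
  proof -
    have "?p*(d^2 - 1)^2 + ?q*d^2 - ?w = 0" by algebra
    then show ?thesis unfolding W by simp
  qed
  have d2: "0 < d^2" using d by simp
  have d21: "d^2 + 1 \<noteq> 0" using d2 by linarith
  \<comment> \<open>At \<open>t = 0\<close> and at \<open>t = 4\<close> the polynomial
    \<open>?w\<close> is a negative multiple of \<open>(d^2 + 1)^2\<close>.\<close>
  have "t \<noteq> 0"
  proof
    assume t: "t = 0"
    have "0 \<le> d^4" by simp
    then show False using W[unfolded t, simplified] d2 by linarith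
  qed
  moreover have "t \<noteq> 4"
  proof
    assume t: "t = 4"
    have "0 \<le> d^4" by simp
    then show False using W[unfolded t, simplified] d2 by linarith
  qed
  ultimately have "?c = 0" using C t3 t5 d d21 by (simp only: mult_eq_0_iff power_eq_0_iff) simp
  then show False using resultant_nonzero[OF d2 d(2) W2] by simp
qed

context normalized_integral
begin

text \<open>If \<open>u*d*(u - 1)\<close> is nonzero, the second focal value determines
  \<open>a\<close>; for \<open>d^2 = 1\<close> it reads \<open>a = b*d\<close>. For other
  \<open>d\<close> the elimination forces \<open>t = 2\<close>, that is \<open>u = - 1\<close>, and
  the third focal value then determines \<open>b*d\<close>.\<close>

lemma center_conditions:
  "d = 0 \<or> u = 0 \<or> u = 1 \<or> d^2 = 1 \<and> a = b*d \<or> u = - 1 \<and> a = 1 - d^2 \<and> b*d = d^2 - 1"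
proof -
  define t where "t = (u + 5) / 2"
  have u: "u = 2*t - 5" by (simp add: t_def field_simps)
  consider "d = 0 \<or> u = 0 \<or> u = 1" | "d \<noteq> 0" "u \<noteq> 0" "u \<noteq> 1" "d^2 = 1" | "d \<noteq> 0" "u \<noteq> 0" "u \<noteq> 1" "d^2 \<noteq> 1"
    by blast
  then show ?thesis
  proof cases
    case 1 then show ?thesis by blast
  next
    case 2 then show ?thesis using l_functional by simp
  next
    case 3
    have "2*b*d - (d^2 - 1)*(u + 5) - 2*a = 0" using l_functional 3 by simp
    then have a: "a = b*d - (d^2 - 1)*t" by (simp add: t_def field_simps)
    have t3: "t \<noteq> 3" "2*t - 5 \<noteq> 0" "t - 3 \<noteq> 0" "d^2 - 1 \<noteq> 0" using 3 u by auto
    note v8 = m_functional[OF a u, simplified mult_eq_0_iff t3 3 simp_thms]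
      and v10 = n_functional[OF a u, simplified mult_eq_0_iff t3 3 simp_thms]
      and v12 = k_functional[OF a u, simplified mult_eq_0_iff t3 3 simp_thms]
    have "t = 2" by (rule elimination[OF 3(1,4) t3(1) v8 v10 v12])
    then have "u = - 1" "b*d = d^2 - 1" using u v8 by simp_all
    then show ?thesis using a \<open>t = 2\<close> by simp
  qed
qed

end

section \<open>Global solutions of scalar equations\<close>

lemma antiderivative_exists:
  fixes h :: "real \<Rightarrow> real"
  assumes "continuous_on UNIV h"
  obtains H where "H 0 = 0" "\<And>x. (H has_real_derivative h x) (at x)"
proof -
  let ?H = "\<lambda>u. LBINT y=ereal 0..ereal u. h y"
  have 0: "?H 0 = 0" by (simp add: interval_lebesgue_integral_def einterval_def set_lebesgue_integral_def)
  have "(?H has_real_derivative h x) (at x)" for x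
  proof -
    have "(?H has_vector_derivative h x) (at x within {- \<bar>x\<bar> - 1..\<bar>x\<bar> + 1})"
      by (rule interval_integral_FTC2) (auto intro: continuous_on_subset[OF assms])
    moreover have "at x within {- \<bar>x\<bar> - 1..\<bar>x\<bar> + 1} = at x"
      by (rule at_within_interior) auto
    ultimately show ?thesis by (simp add: has_real_derivative_iff_has_vector_derivative)
  qed
  with 0 show ?thesis by (rule that)
qed

text \<open>Integrating an exponential gains the factor \<open>1 / k\<close>, later the source of
  the contraction. The two signs of \<open>s\<close> give the upper and the lower bound at
  once.\<close>

lemma exp_weighted_bound:
  fixes w w' :: "real \<Rightarrow> real"
  assumes w: "\<And>t. (w has_real_derivative w' t) (at t)" "w 0 = 0"
    and k: "0 < k" and bound: "\<And>t. \<bar>w' t\<bar> \<le> c * exp (k * \<bar>t\<bar>)" and c: "0 \<le> c"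
  shows "\<bar>w t\<bar> \<le> c / k * exp (k * \<bar>t\<bar>)"
proof -
  have ck: "0 \<le> c / k" using c k by simp
  have main: "s * w t \<le> c / k * exp (k * \<bar>t\<bar>)" if s: "\<bar>s\<bar> = 1" for s :: real
  proof (cases "0 \<le> t")
    case True
    have "c / k * exp (k * 0) - s * w 0 \<le> c / k * exp (k * t) - s * w t"
    proof (rule DERIV_nonneg_imp_nondecreasing[OF True])
      fix x assume x: "0 \<le> x" "x \<le> t"
      have "s * w' x \<le> \<bar>s * w' x\<bar>" by simp
      also have "\<dots> \<le> c * exp (k * x)" using bound[of x] x s by (simp add: abs_mult)
      finally show "\<exists>y. ((\<lambda>t. c / k * exp (k * t) - s * w t) has_real_derivative y) (at x) \<and> 0 \<le> y"
        using k by (intro exI[of _ "c * exp (k * x) - s * w' x"] conjI)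
          (auto intro!: derivative_eq_intros w(1))
    qed
    then show ?thesis using True ck w(2) by simp
  next
    case False
    have "c / k * exp (- k * t) - s * w t \<ge> c / k * exp (- k * 0) - s * w 0"
    proof (rule DERIV_nonpos_imp_nonincreasing[of t 0])
      show "t \<le> 0" using False by simp
      fix x assume x: "t \<le> x" "x \<le> 0"
      have "- (s * w' x) \<le> \<bar>s * w' x\<bar>" by simp
      also have "\<dots> \<le> c * exp (- k * x)" using bound[of x] x s by (simp add: abs_mult)
      finally show "\<exists>y. ((\<lambda>t. c / k * exp (- k * t) - s * w t) has_real_derivative y) (at x) \<and> y \<le> 0"
        using k by (intro exI[of _ "- c * exp (- k * x) - s * w' x"] conjI)
          (auto intro!: derivative_eq_intros w(1))
    qed
    then show ?thesis using False ck w(2) by simp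
  qed
  show ?thesis using main[of 1] main[of "-1"] by (simp add: abs_le_iff)
qed

lemma linear_growth_bound:
  fixes w w' :: "real \<Rightarrow> real"
  assumes w: "\<And>t. (w has_real_derivative w' t) (at t)" "w 0 = 0" and bound: "\<And>t. \<bar>w' t\<bar> \<le> c"
  shows "\<bar>w t\<bar> \<le> c * \<bar>t\<bar>"
  using field_differentiable_bound[of UNIV w w' c t 0] w bound by simp

text \<open>Picard iteration on the whole line in an exponentially weighted supremum norm: the fixed
  point is \<open>exp (- k * \<bar>t\<bar>)\<close> times the solution. With
  \<open>k = 2 * L + 1\<close> the contraction constant is at most 1/2 without shrinking any
  interval, and the bound \<open>B\<close> keeps the images in the space of bounded
  functions.\<close>

theorem global_ode_solution_at_0:
  fixes R :: "real \<Rightarrow> real \<Rightarrow> real"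
  assumes cont: "continuous_on UNIV (\<lambda>z. R (fst z) (snd z))"
    and lip: "\<And>t r s. \<bar>R t r - R t s\<bar> \<le> L * \<bar>r - s\<bar>"
    and bdd: "\<And>t r. \<bar>R t r\<bar> \<le> B"
  obtains r where "r 0 = r0" "\<And>t. (r has_real_derivative R t (r t)) (at t)"
proof -
  have L: "0 \<le> L" using lip[of 0 1 0] by (simp add: order_trans[OF abs_ge_zero])
  have B: "0 \<le> B" using bdd[of 0 0] abs_ge_zero order_trans by blast
  define k where "k = 2 * L + 1"
  have k: "1 \<le> k" using L by (simp add: k_def)
  define h where "h = (\<lambda>(g::real \<Rightarrow>\<^sub>C real) t. R t (exp (k * \<bar>t\<bar>) * g t))"
  have hc: "continuous_on UNIV (h g)" for g
  proof -
    have "continuous_on UNIV (\<lambda>t. (t, exp (k * \<bar>t\<bar>) * g t))"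
      by (intro continuous_intros) auto
    from continuous_on_compose[OF this continuous_on_subset[OF cont]]
    show ?thesis by (simp add: h_def o_def)
  qed
  have "\<exists>H. H 0 = 0 \<and> (\<forall>t. (H has_real_derivative h g t) (at t))" for g
    by (rule antiderivative_exists[OF hc[of g]]) blast
  then obtain H where H: "\<And>g. H g 0 = 0 \<and> (\<forall>t. (H g has_real_derivative h g t) (at t))"
    by metis
  define f where "f = (\<lambda>g t. exp (- k * \<bar>t\<bar>) * (r0 + H g t))"
  have f: "f g \<in> bcontfun" for g
  proof (rule bcontfun_normI)
    have "continuous_on UNIV (H g)"
      using H[of g] by (meson DERIV_isCont continuous_at_imp_continuous_on)
    then show "continuous_on UNIV (f g)"
      unfolding f_def by (intro continuous_intros)
    fix t
    have "\<bar>H g t\<bar> \<le> B * \<bar>t\<bar>"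
      by (rule linear_growth_bound[of _ "h g"]) (use H bdd in \<open>auto simp: h_def\<close>)
    also have "\<bar>t\<bar> \<le> exp (k * \<bar>t\<bar>)"
    proof -
      have "\<bar>t\<bar> \<le> k * \<bar>t\<bar>" using k by (simp add: mult_le_cancel_right1)
      also have "\<dots> \<le> exp (k * \<bar>t\<bar>)" using exp_ge_add_one_self[of "k * \<bar>t\<bar>"] by linarith
      finally show ?thesis .
    qed
    finally have Hb: "\<bar>H g t\<bar> \<le> B * exp (k * \<bar>t\<bar>)" using B by (simp add: mult_left_mono)
    have "\<bar>r0\<bar> \<le> \<bar>r0\<bar> * exp (k * \<bar>t\<bar>)" using k by (simp add: mult_le_cancel_left1)
    then have "\<bar>r0 + H g t\<bar> \<le> (\<bar>r0\<bar> + B) * exp (k * \<bar>t\<bar>)"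
      using Hb by (simp add: distrib_right abs_triangle_ineq[THEN order_trans])
    then have "norm (f g t) \<le> exp (- k * \<bar>t\<bar>) * ((\<bar>r0\<bar> + B) * exp (k * \<bar>t\<bar>))"
      unfolding f_def by (simp add: abs_mult)
    also have "\<dots> = \<bar>r0\<bar> + B" by (simp add: exp_minus field_simps)
    finally show "norm (f g t) \<le> \<bar>r0\<bar> + B" .
  qed
  define \<Phi> where "\<Phi> = (\<lambda>g. Bcontfun (f g))"
  have app: "\<Phi> g t = f g t" for g t
    unfolding \<Phi>_def using f by (simp add: Bcontfun_inverse)
  have "dist (\<Phi> g1) (\<Phi> g2) \<le> 1 / 2 * dist g1 g2" for g1 g2
  proof (rule dist_bound)
    fix t
    have d: "\<bar>h g1 t - h g2 t\<bar> \<le> L * dist g1 g2 * exp (k * \<bar>t\<bar>)" for t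
    proof -
      have "\<bar>h g1 t - h g2 t\<bar> \<le> L * \<bar>exp (k * \<bar>t\<bar>) * g1 t - exp (k * \<bar>t\<bar>) * g2 t\<bar>"
        unfolding h_def by (rule lip)
      also have "\<dots> = L * (exp (k * \<bar>t\<bar>) * dist (g1 t) (g2 t))"
        by (simp add: right_diff_distrib[symmetric] abs_mult dist_real_def)
      also have "\<dots> \<le> L * (exp (k * \<bar>t\<bar>) * dist g1 g2)"
        using L by (intro mult_left_mono dist_bounded) auto
      finally show ?thesis by (simp add: mult_ac)
    qed
    have "\<bar>H g1 t - H g2 t\<bar> \<le> L * dist g1 g2 / k * exp (k * \<bar>t\<bar>)"
      by (rule exp_weighted_bound[of _ "\<lambda>t. h g1 t - h g2 t"])
        (use H k L d in \<open>auto intro!: derivative_eq_intros\<close>)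
    then have "exp (- k * \<bar>t\<bar>) * \<bar>H g1 t - H g2 t\<bar> \<le> exp (- k * \<bar>t\<bar>) * (L * dist g1 g2 / k * exp (k * \<bar>t\<bar>))"
      by (rule mult_left_mono) simp
    then have "dist (\<Phi> g1 t) (\<Phi> g2 t) \<le> exp (- k * \<bar>t\<bar>) * (L * dist g1 g2 / k * exp (k * \<bar>t\<bar>))"
      unfolding app f_def dist_real_def right_diff_distrib[symmetric] abs_mult by simp
    also have "\<dots> = L / k * dist g1 g2" by (simp add: exp_minus field_simps)
    also have "\<dots> \<le> 1 / 2 * dist g1 g2"
      using L by (intro mult_right_mono) (auto simp: k_def field_simps)
    finally show "dist (\<Phi> g1 t) (\<Phi> g2 t) \<le> 1 / 2 * dist g1 g2" .
  qed
  then have "\<exists>!g. \<Phi> g = g" by (intro banach_fix_type[of "1/2"]) auto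
  then obtain g where g: "\<Phi> g = g" by blast
  define r where "r = (\<lambda>t. r0 + H g t)"
  have "exp (k * \<bar>t\<bar>) * g t = r t" for t
    using app[of g t] unfolding g f_def r_def by (simp add: exp_minus field_simps)
  then have "(r has_real_derivative R t (r t)) (at t)" for t
    using H[of g] unfolding r_def h_def by (auto intro!: derivative_eq_intros)
  moreover have "r 0 = r0" using H[of g] by (simp add: r_def)
  ultimately show ?thesis using that by blast
qed

theorem global_ode_solution:
  fixes R :: "real \<Rightarrow> real \<Rightarrow> real"
  assumes cont: "continuous_on UNIV (\<lambda>z. R (fst z) (snd z))"
    and lip: "\<And>t r s. \<bar>R t r - R t s\<bar> \<le> L * \<bar>r - s\<bar>"
    and bdd: "\<And>t r. \<bar>R t r\<bar> \<le> B"
  obtains r where "r t0 = r0" "\<And>t. (r has_real_derivative R t (r t)) (at t)"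
proof -
  have "continuous_on UNIV (\<lambda>z. R (fst z + t0) (snd z))"
    using continuous_on_compose[of UNIV "\<lambda>z. (fst z + t0, snd z)", OF _ continuous_on_subset[OF cont]]
    by (simp add: o_def continuous_intros)
  from global_ode_solution_at_0[of "\<lambda>t. R (t + t0)", OF this lip bdd]
  obtain r where r: "r 0 = r0" "\<And>t. (r has_real_derivative R (t + t0) (r t)) (at t)" by blast
  show ?thesis
  proof (rule that[of "\<lambda>t. r (t - t0)"])
    show "((\<lambda>t. r (t - t0)) has_real_derivative R t (r (t - t0))) (at t)" for t
    proof -
      have "((\<lambda>t. t - t0) has_real_derivative 1) (at t)" by (auto intro!: derivative_eq_intros)
      from DERIV_chain2[OF _ this, of r "R t (r (t - t0))"] r(2)[of "t - t0"] show ?thesis by simp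
    qed
  qed (simp add: r)
qed

section \<open>Gronwall estimate, uniqueness and sign of solutions\<close>

lemma mult_exp_minus_le_iff: "x * exp (- a) \<le> y \<longleftrightarrow> x \<le> y * exp (a::real)"
  by (simp add: exp_minus divide_inverse[symmetric] pos_divide_le_eq)

text \<open>Unlike the absolute value, the square is differentiable. Multiplied by an exponential
  with rate \<open>- 2 * K\<close> or \<open>2 * K\<close>, according to the direction of time, it
  is monotone.\<close>

lemma gronwall_square:
  fixes w w' :: "real \<Rightarrow> real"
  assumes w: "\<And>t. (w has_real_derivative w' t) (at t)" and bound: "\<And>t. \<bar>w' t\<bar> \<le> K * \<bar>w t\<bar>"
  shows "(w t)\<^sup>2 \<le> (w s)\<^sup>2 * exp (2 * K * \<bar>t - s\<bar>)"
proof -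
  have wb: "\<bar>2 * w x * w' x\<bar> \<le> 2 * K * (w x)\<^sup>2" for x
    using mult_left_mono[OF bound[of x], of "2 * \<bar>w x\<bar>"] by (simp add: abs_mult power2_eq_square mult_ac)
  show ?thesis
  proof (cases "s \<le> t")
    case True
    have "(w t)\<^sup>2 * exp (- 2 * K * (t - s)) \<le> (w s)\<^sup>2 * exp (- 2 * K * (s - s))"
    proof (rule DERIV_nonpos_imp_nonincreasing[OF True])
      fix x
      have "((\<lambda>t. (w t)\<^sup>2 * exp (- 2 * K * (t - s))) has_real_derivative
         (2 * w x * w' x - 2 * K * (w x)\<^sup>2) * exp (- 2 * K * (x - s))) (at x)"
        by (rule derivative_eq_intros w refl)+ (simp add: algebra_simps power2_eq_square)
      moreover have "(2 * w x * w' x - 2 * K * (w x)\<^sup>2) * exp (- 2 * K * (x - s)) \<le> 0"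
        using wb[of x] by (intro mult_nonpos_nonneg) auto
      ultimately show "\<exists>y. ((\<lambda>t. (w t)\<^sup>2 * exp (- 2 * K * (t - s))) has_real_derivative y) (at x) \<and> y \<le> 0" by blast
    qed
    then have "(w t)\<^sup>2 * exp (- (2 * K * (t - s))) \<le> (w s)\<^sup>2" by simp
    then show ?thesis unfolding mult_exp_minus_le_iff using True by simp
  next
    case False
    have "(w t)\<^sup>2 * exp (2 * K * (t - s)) \<le> (w s)\<^sup>2 * exp (2 * K * (s - s))"
    proof (rule DERIV_nonneg_imp_nondecreasing[of t s])
      show "t \<le> s" using False by simp
      fix x
      have "((\<lambda>t. (w t)\<^sup>2 * exp (2 * K * (t - s))) has_real_derivative
         (2 * w x * w' x + 2 * K * (w x)\<^sup>2) * exp (2 * K * (x - s))) (at x)"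
        by (rule derivative_eq_intros w refl)+ (simp add: algebra_simps power2_eq_square)
      moreover have "0 \<le> (2 * w x * w' x + 2 * K * (w x)\<^sup>2) * exp (2 * K * (x - s))"
        using wb[of x] by (intro mult_nonneg_nonneg) auto
      ultimately show "\<exists>y. ((\<lambda>t. (w t)\<^sup>2 * exp (2 * K * (t - s))) has_real_derivative y) (at x) \<and> 0 \<le> y" by blast
    qed
    then have "(w t)\<^sup>2 * exp (- (2 * K * (s - t))) \<le> (w s)\<^sup>2" by (simp add: algebra_simps)
    then show ?thesis unfolding mult_exp_minus_le_iff using False by simp
  qed
qed

lemma ode_solution_unique:
  fixes r1 r2 :: "real \<Rightarrow> real"
  assumes "\<And>t. (r1 has_real_derivative R t (r1 t)) (at t)" "\<And>t. (r2 has_real_derivative R t (r2 t)) (at t)"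
    and lip: "\<And>t r s. \<bar>R t r - R t s\<bar> \<le> L * \<bar>r - s\<bar>" and "r1 s = r2 s"
  shows "r1 t = r2 t"
proof -
  have "(r1 t - r2 t)\<^sup>2 \<le> (r1 s - r2 s)\<^sup>2 * exp (2 * L * \<bar>t - s\<bar>)"
    by (rule gronwall_square[of _ "\<lambda>t. R t (r1 t) - R t (r2 t)"]) (auto intro!: derivative_eq_intros assms)
  then show ?thesis using assms(4) by simp
qed

text \<open>A change of sign would produce a zero, and the Gronwall estimate started at that zero
  makes \<open>r s\<close> vanish.\<close>

lemma ode_solution_positive:
  fixes r r' :: "real \<Rightarrow> real"
  assumes r: "\<And>t. (r has_real_derivative r' t) (at t)" and bound: "\<And>t. \<bar>r' t\<bar> \<le> K * \<bar>r t\<bar>" and "0 < r s"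
  shows "0 < r t"
proof (rule ccontr)
  assume n: "\<not> 0 < r t"
  have c: "continuous_on A r" for A
    using r by (meson DERIV_isCont continuous_at_imp_continuous_on)
  have "\<exists>x. r x = 0"
  proof (cases "s \<le> t")
    case True
    then show ?thesis using IVT2'[of r t 0 s] n assms(3) c by force
  next
    case False
    then show ?thesis using IVT'[of r t 0 s] n assms(3) c by force
  qed
  then obtain x where "r x = 0" by blast
  then show False using gronwall_square[OF r bound, of s x] assms(3) by simp
qed

section \<open>Star-shaped curves\<close>

text \<open>\<open>I\<close> is the union of the segments from \<open>p\<close> to
  \<open>\<gamma>\<close>, and \<open>J m\<close> its continuation beyond \<open>\<gamma>\<close> up
  to the factor \<open>m\<close>. Both are compact and meet only in \<open>\<gamma>\<close>, so a
  path from \<open>p\<close> that avoids \<open>\<gamma>\<close> cannot leave \<open>I\<close>; the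
  component of \<open>p\<close> is bounded.\<close>

lemma star_shaped_curve_inside:
  fixes \<gamma> :: "'a::euclidean_space set"
  assumes \<gamma>: "compact \<gamma>" "p \<notin> \<gamma>"
    and hit: "\<And>z. z \<noteq> p \<Longrightarrow> \<exists>s>0. p + s *\<^sub>R (z - p) \<in> \<gamma>"
    and once: "\<And>z s. z \<in> \<gamma> \<Longrightarrow> 0 < s \<Longrightarrow> p + s *\<^sub>R (z - p) \<in> \<gamma> \<Longrightarrow> s = 1"
  shows "p \<in> inside \<gamma>"
proof -
  define I where "I = (\<lambda>(s, w). p + s *\<^sub>R (w - p)) ` ({0..1} \<times> \<gamma>)"
  define J where "J = (\<lambda>m. (\<lambda>(s, w). p + s *\<^sub>R (w - p)) ` ({1..m} \<times> \<gamma>))"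
  have cont: "continuous_on A (\<lambda>(s, w). p + s *\<^sub>R (w - p))" for A :: "(real \<times> 'a) set"
    by (auto simp: case_prod_unfold intro!: continuous_intros)
  have I: "compact I" and J: "compact (J m)" for m
    unfolding I_def J_def by (intro compact_continuous_image cont compact_Times compact_Icc \<gamma>)+
  have IJ: "I \<inter> J m \<subseteq> \<gamma>" for m
  proof
    fix z assume z: "z \<in> I \<inter> J m"
    then have "z \<in> I" by simp
    then obtain s w where 1: "z = p + s *\<^sub>R (w - p)" "0 \<le> s" "s \<le> 1" "w \<in> \<gamma>"
      unfolding I_def by auto
    have "z \<in> J m" using z by simp
    then obtain s' w' where 2: "z = p + s' *\<^sub>R (w' - p)" "1 \<le> s'" "w' \<in> \<gamma>"
      unfolding J_def by auto
    have "w' \<noteq> p" using 2 \<gamma>(2) by auto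
    then have "s \<noteq> 0" using 1 2 by auto
    then have s: "0 < s" using 1 by simp
    have "s *\<^sub>R (w - p) = s' *\<^sub>R (w' - p)" using 1 2 by simp
    then have "(1 / s') *\<^sub>R (s *\<^sub>R (w - p)) = (1 / s') *\<^sub>R (s' *\<^sub>R (w' - p))" by simp
    then have "(s / s') *\<^sub>R (w - p) = w' - p" using 2(2) by simp
    then have "p + (s / s') *\<^sub>R (w - p) \<in> \<gamma>" using 2 by simp
    then have "s / s' = 1" using once[OF 1(4), of "s / s'"] s 2 by simp
    then have "s = 1" using 1 2 by (simp add: field_simps)
    then show "z \<in> \<gamma>" using 1 by simp
  qed
  have "connected_component_set (- \<gamma>) p \<subseteq> I"
  proof
    fix x assume "x \<in> connected_component_set (- \<gamma>) p"
    moreover have "open (- \<gamma>)" using \<gamma>(1) by (simp add: compact_imp_closed open_Compl)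
    ultimately have "path_component (- \<gamma>) p x"
      by (simp add: open_path_connected_component)
    then obtain g where g: "path g" "path_image g \<subseteq> - \<gamma>" "pathstart g = p" "pathfinish g = x"
      unfolding path_component_def by blast
    show "x \<in> I"
    proof (rule ccontr)
      assume x: "x \<notin> I"
      obtain M where "path_image g \<subseteq> ball p M"
        using bounded_subset_ballD[OF compact_imp_bounded[OF compact_path_image[OF g(1)]]] by blast
      then have M: "norm (z - p) \<le> M" if "z \<in> path_image g" for z
        using that by (auto simp: dist_norm norm_minus_commute)
      obtain b :: 'a where "b \<in> Basis" using nonempty_Basis by blast
      then have "\<gamma> \<noteq> {}" using hit[of "p + b"] nonzero_Basis by auto
      have "continuous_on \<gamma> (\<lambda>w. norm (w - p))" by (intro continuous_intros)
      from continuous_attains_inf[OF \<gamma>(1) \<open>\<gamma> \<noteq> {}\<close> this]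
      obtain w0 where w0: "w0 \<in> \<gamma>" "\<And>w. w \<in> \<gamma> \<Longrightarrow> norm (w0 - p) \<le> norm (w - p)" by blast
      have d: "0 < norm (w0 - p)" using w0 \<gamma>(2) by auto
      \<comment> \<open>Path points have distance at most \<open>M\<close> from \<open>p\<close>,
        points of \<open>\<gamma>\<close> at least that of \<open>w0\<close>; hence no point of the
        path needs a factor larger than \<open>m\<close>.\<close>
      define m where "m = M / norm (w0 - p)"
      have cover: "z \<in> I \<union> J m" if z: "z \<in> path_image g" for z
      proof (cases "z = p")
        case True
        then show ?thesis using w0(1) unfolding I_def by (auto intro!: image_eqI[of _ _ "(0, w0)"])
      next
        case False
        from hit[OF this] obtain s where s: "0 < s" "p + s *\<^sub>R (z - p) \<in> \<gamma>" by blast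
        define w where "w = p + s *\<^sub>R (z - p)"
        have zw: "z = p + (1 / s) *\<^sub>R (w - p)" using s by (simp add: w_def)
        show ?thesis
        proof (cases "1 / s \<le> 1")
          case True
          then show ?thesis using s zw unfolding I_def w_def[symmetric]
            by (auto intro!: image_eqI[of _ _ "(1 / s, w)"])
        next
          case False
          have "1 / s * norm (w0 - p) \<le> 1 / s * norm (w - p)"
            using w0(2)[of w] s by (intro mult_left_mono) (auto simp: w_def)
          also have "\<dots> = norm (z - p)" using s zw by simp
          also have "\<dots> \<le> M" by (rule M[OF z])
          finally have "1 / s \<le> m" unfolding m_def using d by (simp add: pos_le_divide_eq)
          then show ?thesis using s zw False unfolding J_def w_def[symmetric]
            by (auto intro!: image_eqI[of _ _ "(1 / s, w)"])
        qed
      qed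
      have "connected (path_image g)" using g(1) by (rule connected_path_image)
      moreover have "closed I" "closed (J m)" using I J by (auto intro: compact_imp_closed)
      moreover have "path_image g \<subseteq> I \<union> J m" using cover by blast
      moreover have "I \<inter> J m \<inter> path_image g = {}" using IJ[of m] g(2) by blast
      moreover have "p \<in> path_image g" "x \<in> path_image g" using g by (metis pathstart_in_path_image, metis pathfinish_in_path_image)
      moreover have "p \<in> I" using w0(1) unfolding I_def by (auto intro!: image_eqI[of _ _ "(0, w0)"])
      moreover have "x \<in> J m" using cover[of x] x \<open>x \<in> path_image g\<close> by blast
      ultimately show False unfolding connected_closed by blast
    qed
  qed
  then have "bounded (connected_component_set (- \<gamma>) p)"
    using I bounded_subset compact_imp_bounded by blast
  then show ?thesis using \<gamma>(2) by (simp add: inside_def)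
qed

section \<open>Return maps in polar coordinates\<close>

text \<open>After an affine change of coordinates the field is \<open>X' = - Y A\<close>,
  \<open>Y' = X B\<close>. The Lipschitz bounds are along rays, as the equation for the radius
  requires.\<close>

locale perturbed_rotation =
  fixes F :: "real \<times> real \<Rightarrow> real \<times> real" and x0 y0 \<alpha> \<beta> K :: real and A B :: "real \<Rightarrow> real \<Rightarrow> real"
  assumes nz: "\<alpha> \<noteq> 0" "\<beta> \<noteq> 0"
    and F_eq: "\<And>X Y. F (x0 + \<alpha> * X, y0 + \<beta> * Y) = (\<alpha> * (- Y * A X Y), \<beta> * (X * B X Y))"
    and at_0: "A 0 0 = 1" "B 0 0 = 1"
    and cont: "continuous_on UNIV (\<lambda>z. A (fst z) (snd z))" "continuous_on UNIV (\<lambda>z. B (fst z) (snd z))"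
    and K: "1 \<le> K"
    and lip: "\<And>t r s. \<bar>r\<bar> \<le> 1 \<Longrightarrow> \<bar>s\<bar> \<le> 1 \<Longrightarrow> \<bar>A (r * cos t) (r * sin t) - A (s * cos t) (s * sin t)\<bar> \<le> K * \<bar>r - s\<bar>"
      "\<And>t r s. \<bar>r\<bar> \<le> 1 \<Longrightarrow> \<bar>s\<bar> \<le> 1 \<Longrightarrow> \<bar>B (r * cos t) (r * sin t) - B (s * cos t) (s * sin t)\<bar> \<le> K * \<bar>r - s\<bar>"
begin

text \<open>Up to this radius \<open>A\<close> and \<open>B\<close> differ from 1 by at most 1/2, so
  the polar angle advances with speed between 1/2 and 3/2.\<close>

definition "\<epsilon> = 1 / (2 * K)"

definition "clip r = max (- \<epsilon>) (min \<epsilon> r)"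

text \<open>Together with \<open>radial\<close> this is the field in polar coordinates: the time
  derivatives of the angle and of the radius.\<close>

definition "speed t r = (cos t)\<^sup>2 * B (r * cos t) (r * sin t) + (sin t)\<^sup>2 * A (r * cos t) (r * sin t)"

definition "radial t r = r * (cos t * sin t * (B (r * cos t) (r * sin t) - A (r * cos t) (r * sin t)))"

text \<open>The derivative of the radius with respect to the angle. Clipping makes it bounded and
  globally Lipschitz, and changes nothing for radii up to \<open>\<epsilon>\<close>.\<close>

definition "rate t r = radial t (clip r) / speed t (clip r)"

lemma eps: "0 < \<epsilon>" "\<epsilon> \<le> 1" "K * \<epsilon> = 1 / 2"
  using K by (auto simp: \<epsilon>_def field_simps)

lemma clip: "\<bar>clip r\<bar> \<le> \<epsilon>" "\<bar>clip r\<bar> \<le> \<bar>r\<bar>" "\<bar>clip r\<bar> \<le> 1" "\<bar>clip r - clip s\<bar> \<le> \<bar>r - s\<bar>"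
  "\<bar>r\<bar> \<le> \<epsilon> \<Longrightarrow> clip r = r"
  using eps by (auto simp: clip_def max_def min_def)

lemma near_one:
  assumes "\<bar>r\<bar> \<le> \<epsilon>"
  shows "\<bar>A (r * cos t) (r * sin t) - 1\<bar> \<le> 1 / 2" "\<bar>B (r * cos t) (r * sin t) - 1\<bar> \<le> 1 / 2"
proof -
  have "K * \<bar>r\<bar> \<le> 1 / 2" using assms mult_left_mono[OF assms, of K] K eps by simp
  then show "\<bar>A (r * cos t) (r * sin t) - 1\<bar> \<le> 1 / 2" "\<bar>B (r * cos t) (r * sin t) - 1\<bar> \<le> 1 / 2"
    using lip(1)[of r 0 t] lip(2)[of r 0 t] assms eps at_0 by auto
qed

lemma near_one':
  assumes "\<bar>r\<bar> \<le> \<epsilon>"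
  shows "1 / 2 \<le> A (r * cos t) (r * sin t)" "A (r * cos t) (r * sin t) \<le> 3 / 2"
    "1 / 2 \<le> B (r * cos t) (r * sin t)" "B (r * cos t) (r * sin t) \<le> 3 / 2"
  using near_one[OF assms, of t] unfolding abs_le_iff by linarith+

lemma convex_sq:
  fixes a b l u :: real
  assumes "l \<le> a" "a \<le> u" "l \<le> b" "b \<le> u"
  shows "l \<le> (cos t)\<^sup>2 * b + (sin t)\<^sup>2 * a" "(cos t)\<^sup>2 * b + (sin t)\<^sup>2 * a \<le> u"
proof -
  have e: "(cos t)\<^sup>2 * x + (sin t)\<^sup>2 * x = x" for x
    unfolding distrib_right[symmetric] sin_cos_squared_add2 by (rule mult_1)
  have "(cos t)\<^sup>2 * l + (sin t)\<^sup>2 * l \<le> (cos t)\<^sup>2 * b + (sin t)\<^sup>2 * a"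
    by (intro add_mono mult_left_mono assms zero_le_power2)
  then show "l \<le> (cos t)\<^sup>2 * b + (sin t)\<^sup>2 * a" unfolding e .
  have "(cos t)\<^sup>2 * b + (sin t)\<^sup>2 * a \<le> (cos t)\<^sup>2 * u + (sin t)\<^sup>2 * u"
    by (intro add_mono mult_left_mono assms zero_le_power2)
  then show "(cos t)\<^sup>2 * b + (sin t)\<^sup>2 * a \<le> u" unfolding e .
qed

lemma speed_bounds:
  assumes "\<bar>r\<bar> \<le> \<epsilon>" shows "1 / 2 \<le> speed t r" "speed t r \<le> 3 / 2"
  unfolding speed_def by (rule convex_sq; rule near_one'[OF assms])+

lemma cos_sin_le_1: "\<bar>cos t * sin t\<bar> \<le> (1::real)"
  using mult_mono[of "\<bar>cos t\<bar>" 1 "\<bar>sin t\<bar>" 1] by (simp add: abs_mult)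

lemma radial_bound:
  assumes "\<bar>r\<bar> \<le> \<epsilon>" shows "\<bar>radial t r\<bar> \<le> \<bar>r\<bar>"
proof -
  have "\<bar>B (r * cos t) (r * sin t) - A (r * cos t) (r * sin t)\<bar> \<le> 1"
    using near_one'[OF assms, of t] by (auto simp: abs_le_iff)
  then have "\<bar>cos t * sin t\<bar> * \<bar>B (r * cos t) (r * sin t) - A (r * cos t) (r * sin t)\<bar> \<le> 1"
    using mult_mono[OF cos_sin_le_1[of t]] by fastforce
  then show ?thesis unfolding radial_def abs_mult[of r] abs_mult[of "cos t * sin t"]
    by (simp add: mult_left_le)
qed

lemma rate_bound: "\<bar>rate t r\<bar> \<le> 2 * \<bar>r\<bar>" "\<bar>rate t r\<bar> \<le> 2"
proof -
  have "\<bar>rate t r\<bar> = \<bar>radial t (clip r)\<bar> / speed t (clip r)"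
    using speed_bounds(1)[OF clip(1), of t r] by (simp add: rate_def abs_divide)
  also have "\<dots> \<le> \<bar>clip r\<bar> / (1 / 2)"
    using speed_bounds(1)[OF clip(1), of t r] radial_bound[OF clip(1), of t r] by (intro frac_le) auto
  finally have "\<bar>rate t r\<bar> \<le> 2 * \<bar>clip r\<bar>" by simp
  then show "\<bar>rate t r\<bar> \<le> 2 * \<bar>r\<bar>" "\<bar>rate t r\<bar> \<le> 2" using clip(2,3)[of r] by auto
qed

lemma radial_lip:
  assumes "\<bar>r\<bar> \<le> \<epsilon>" "\<bar>s\<bar> \<le> \<epsilon>"
  shows "\<bar>radial t r - radial t s\<bar> \<le> (1 + 2 * K) * \<bar>r - s\<bar>"
proof -
  define g where "g = (\<lambda>r. B (r * cos t) (r * sin t) - A (r * cos t) (r * sin t))"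
  have g1: "\<bar>g r\<bar> \<le> 1" using near_one'[OF assms(1), of t] by (auto simp: g_def abs_le_iff)
  have "\<bar>g r - g s\<bar> \<le> \<bar>B (r * cos t) (r * sin t) - B (s * cos t) (s * sin t)\<bar>
      + \<bar>A (r * cos t) (r * sin t) - A (s * cos t) (s * sin t)\<bar>" by (simp add: g_def)
  also have "\<dots> \<le> K * \<bar>r - s\<bar> + K * \<bar>r - s\<bar>" using assms eps by (intro add_mono lip) auto
  finally have g2: "\<bar>g r - g s\<bar> \<le> 2 * K * \<bar>r - s\<bar>" by simp
  have "\<bar>r * g r - s * g s\<bar> = \<bar>(r - s) * g r + s * (g r - g s)\<bar>" by (simp add: algebra_simps)
  also have "\<dots> \<le> \<bar>r - s\<bar> * \<bar>g r\<bar> + \<bar>s\<bar> * \<bar>g r - g s\<bar>" by (metis abs_mult abs_triangle_ineq)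
  also have "\<dots> \<le> \<bar>r - s\<bar> * 1 + 1 * (2 * K * \<bar>r - s\<bar>)"
    using g1 g2 assms eps by (intro add_mono mult_mono) auto
  finally have rg: "\<bar>r * g r - s * g s\<bar> \<le> (1 + 2 * K) * \<bar>r - s\<bar>" by (simp add: algebra_simps)
  have "\<bar>radial t r - radial t s\<bar> = \<bar>cos t * sin t\<bar> * \<bar>r * g r - s * g s\<bar>"
    unfolding radial_def g_def abs_mult[symmetric] by (simp add: algebra_simps)
  also have "\<dots> \<le> 1 * \<bar>r * g r - s * g s\<bar>" by (intro mult_right_mono cos_sin_le_1) simp
  finally show ?thesis using rg by simp
qed

lemma speed_lip:
  assumes "\<bar>r\<bar> \<le> \<epsilon>" "\<bar>s\<bar> \<le> \<epsilon>"
  shows "\<bar>speed t r - speed t s\<bar> \<le> K * \<bar>r - s\<bar>"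
proof -
  have "speed t r - speed t s = (cos t)\<^sup>2 * (B (r * cos t) (r * sin t) - B (s * cos t) (s * sin t))
     + (sin t)\<^sup>2 * (A (r * cos t) (r * sin t) - A (s * cos t) (s * sin t))"
    by (simp add: speed_def algebra_simps)
  moreover have "\<bar>A (r * cos t) (r * sin t) - A (s * cos t) (s * sin t)\<bar> \<le> K * \<bar>r - s\<bar>"
    "\<bar>B (r * cos t) (r * sin t) - B (s * cos t) (s * sin t)\<bar> \<le> K * \<bar>r - s\<bar>"
    using assms eps by (intro lip; simp)+
  ultimately show ?thesis
    using convex_sq[of "- (K * \<bar>r - s\<bar>)" "A (r * cos t) (r * sin t) - A (s * cos t) (s * sin t)" "K * \<bar>r - s\<bar>"
        "B (r * cos t) (r * sin t) - B (s * cos t) (s * sin t)" t]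
    unfolding abs_le_iff by linarith
qed

text \<open>Lipschitz bound of a quotient: the cross difference contributes
  \<open>(1 + 2 * K) * (3 / 2) + K = 3 / 2 + 4 * K\<close>, and the product of the two denominators
  is at least 1/4.\<close>

lemma rate_lip: "\<bar>rate t r - rate t s\<bar> \<le> (6 + 16 * K) * \<bar>r - s\<bar>"
proof -
  let ?r = "clip r" and ?s = "clip s"
  have s: "1 / 2 \<le> speed t ?r" "1 / 2 \<le> speed t ?s" "speed t ?s \<le> 3 / 2"
    using speed_bounds clip(1) by auto
  have "\<bar>radial t ?r * speed t ?s - radial t ?s * speed t ?r\<bar>
      = \<bar>(radial t ?r - radial t ?s) * speed t ?s - radial t ?s * (speed t ?r - speed t ?s)\<bar>"
    by (simp add: algebra_simps)
  also have "\<dots> \<le> \<bar>radial t ?r - radial t ?s\<bar> * \<bar>speed t ?s\<bar> + \<bar>radial t ?s\<bar> * \<bar>speed t ?r - speed t ?s\<bar>"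
    unfolding abs_mult[symmetric] by (rule abs_triangle_ineq4)
  also have "\<dots> \<le> ((1 + 2 * K) * \<bar>?r - ?s\<bar>) * (3 / 2) + 1 * (K * \<bar>?r - ?s\<bar>)"
    using s radial_lip[OF clip(1) clip(1), of t r s] speed_lip[OF clip(1) clip(1), of t r s]
      radial_bound[OF clip(1), of t s] clip(3)[of s] K
    by (intro add_mono mult_mono) auto
  also have "\<dots> = (3 / 2 + 4 * K) * \<bar>?r - ?s\<bar>" by (simp add: algebra_simps)
  also have "\<dots> \<le> (3 / 2 + 4 * K) * \<bar>r - s\<bar>" using K clip(4) by (intro mult_left_mono) auto
  finally have num: "\<bar>radial t ?r * speed t ?s - radial t ?s * speed t ?r\<bar> \<le> (3 / 2 + 4 * K) * \<bar>r - s\<bar>" .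
  have den: "1 / 4 \<le> speed t ?r * speed t ?s"
    using mult_mono[OF s(1,2)] s by simp
  have "\<bar>rate t r - rate t s\<bar> = \<bar>radial t ?r * speed t ?s - radial t ?s * speed t ?r\<bar> / (speed t ?r * speed t ?s)"
    unfolding rate_def using s by (simp add: diff_frac_eq abs_divide abs_mult)
  also have "\<dots> \<le> ((3 / 2 + 4 * K) * \<bar>r - s\<bar>) / (1 / 4)"
    using num den by (intro frac_le) auto
  finally show ?thesis by (simp add: algebra_simps)
qed

lemma continuous_polar:
  fixes f g :: "'b::t2_space \<Rightarrow> real"
  assumes "continuous_on S f" "continuous_on S g"
  shows "continuous_on S (\<lambda>z. speed (f z) (g z))" "continuous_on S (\<lambda>z. radial (f z) (g z))"
proof -
  have "continuous_on S (\<lambda>z. (g z * cos (f z), g z * sin (f z)))"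
    by (intro continuous_intros assms)
  from continuous_on_compose[OF this continuous_on_subset[OF cont(1)]]
    continuous_on_compose[OF this continuous_on_subset[OF cont(2)]]
  have "continuous_on S (\<lambda>z. A (g z * cos (f z)) (g z * sin (f z)))"
    "continuous_on S (\<lambda>z. B (g z * cos (f z)) (g z * sin (f z)))"
    by (simp_all add: o_def)
  then show "continuous_on S (\<lambda>z. speed (f z) (g z))" "continuous_on S (\<lambda>z. radial (f z) (g z))"
    unfolding speed_def radial_def by (intro continuous_intros assms; simp)+
qed

lemma rate_continuous: "continuous_on UNIV (\<lambda>z. rate (fst z) (snd z))"
proof -
  have c: "continuous_on UNIV (\<lambda>z. clip (snd z))" for S :: "(real \<times> real) set"
    unfolding clip_def by (intro continuous_intros)
  have "speed t (clip r) \<noteq> 0" for t r using speed_bounds(1)[OF clip(1), of t r] by auto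
  then show ?thesis
    unfolding rate_def by (intro continuous_on_divide continuous_polar c continuous_on_fst continuous_on_id) auto
qed

definition "solution r \<longleftrightarrow> (\<forall>t. (r has_real_derivative rate t (r t)) (at t))"

lemma solution_exists: obtains r where "r t0 = r0" "solution r"
  using global_ode_solution[OF rate_continuous rate_lip rate_bound(2)] unfolding solution_def by metis

lemma solution_unique: "solution r \<Longrightarrow> solution r' \<Longrightarrow> r s = r' s \<Longrightarrow> r = r'"
  using ode_solution_unique[of r rate r' "6 + 16 * K" s] rate_lip unfolding solution_def by blast

lemma solution_positive: "solution r \<Longrightarrow> 0 < r s \<Longrightarrow> 0 < r t"
  using ode_solution_positive[of r "\<lambda>t. rate t (r t)" 2 s t] rate_bound(1) unfolding solution_def by blast

lemma rate_periodic: "rate (t + 2 * pi) r = rate t r"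
  by (simp add: rate_def speed_def radial_def)

lemma solution_shift: assumes "solution r" shows "solution (\<lambda>t. r (t + 2 * pi))"
  unfolding solution_def
proof
  fix t
  have "((\<lambda>t. t + 2 * pi) has_real_derivative 1) (at t)" by (auto intro!: derivative_eq_intros)
  moreover have "(r has_real_derivative rate (t + 2 * pi) (r (t + 2 * pi))) (at (t + 2 * pi))"
    using assms unfolding solution_def by blast
  ultimately show "((\<lambda>t. r (t + 2 * pi)) has_real_derivative rate t (r (t + 2 * pi))) (at t)"
    using DERIV_chain2[of r _ "\<lambda>t. t + 2 * pi" t 1] unfolding rate_periodic by fastforce
qed

text \<open>The equation is periodic in the angle, so the solution shifted by one turn is a solution
  as well; agreement at a single angle makes the two equal.\<close>

lemma solution_periodic:
  assumes "solution r" "r (t1 + 2 * pi) = r t1"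
  shows "r (t + 2 * pi) = r t"
  using solution_unique[OF solution_shift[OF assms(1)] assms(1), of t1] assms(2) by metis

end

section \<open>Auxiliary facts on periods, inverses and antiderivatives\<close>

lemma periodic_of_int:
  fixes r :: "real \<Rightarrow> 'a"
  assumes "\<And>t. r (t + 2 * pi) = r t"
  shows "r (t + 2 * pi * of_int n) = r t"
proof (induction n rule: int_induct[of _ 0])
  case (step1 i)
  then show ?case using assms[of "t + 2 * pi * of_int i"] by (simp add: algebra_simps)
next
  case (step2 i)
  then show ?case using assms[of "t + 2 * pi * of_int (i - 1)"] by (simp add: algebra_simps)
qed simp

lemma reduce_mod_2pi:
  obtains n :: int where "0 \<le> t + 2 * pi * of_int n" "t + 2 * pi * of_int n \<le> 2 * pi"
proof -
  define f where "f = \<lfloor>t / (2 * pi)\<rfloor>"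
  have "of_int f \<le> t / (2 * pi)" "t / (2 * pi) \<le> of_int f + 1"
    unfolding f_def by linarith+
  then have "of_int f * (2 * pi) \<le> t" "t \<le> (of_int f + 1) * (2 * pi)"
    by (simp_all only: pos_le_divide_eq pos_divide_le_eq pi_gt_zero zero_less_mult_iff zero_less_numeral simp_thms)
  then have "0 \<le> t + 2 * pi * of_int (- f)" "t + 2 * pi * of_int (- f) \<le> 2 * pi"
    by (simp_all add: algebra_simps)
  then show ?thesis by (rule that)
qed

text \<open>The lower bound \<open>m\<close> on the derivative makes \<open>\<tau>\<close> onto the
  line and its inverse Lipschitz. The intended \<open>\<tau>\<close> is time as a function of the
  angle.\<close>

lemma strictly_increasing_inverse:
  fixes \<tau> \<tau>' :: "real \<Rightarrow> real"
  assumes \<tau>: "\<And>t. (\<tau> has_real_derivative \<tau>' t) (at t)" and m: "0 < m" "\<And>t. m \<le> \<tau>' t"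
  obtains \<psi> where "\<And>s. \<tau> (\<psi> s) = s" "\<And>t. \<psi> (\<tau> t) = t"
    "\<And>s. (\<psi> has_real_derivative inverse (\<tau>' (\<psi> s))) (at s)"
proof -
  have grow: "m * (b - a) \<le> \<tau> b - \<tau> a" if "a \<le> b" for a b
  proof -
    have "\<tau> a - m * a \<le> \<tau> b - m * b"
    proof (rule DERIV_nonneg_imp_nondecreasing[OF that])
      show "\<exists>y. ((\<lambda>t. \<tau> t - m * t) has_real_derivative y) (at x) \<and> 0 \<le> y" for x
        using m(2)[of x] by (intro exI[of _ "\<tau>' x - m"]) (auto intro!: derivative_eq_intros \<tau>)
    qed
    then show ?thesis by (simp add: algebra_simps)
  qed
  have cont: "continuous_on S \<tau>" for S
    using \<tau> by (meson DERIV_isCont continuous_at_imp_continuous_on)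
  have lip: "m * \<bar>a - b\<bar> \<le> \<bar>\<tau> a - \<tau> b\<bar>" for a b
    using grow[of a b] grow[of b a] by (cases "a \<le> b") (auto simp: abs_if algebra_simps)
  then have inj: "\<tau> a = \<tau> b \<Longrightarrow> a = b" for a b
    using lip[of a b] m(1) by (auto simp: mult_le_0_iff)
  have surj: "\<exists>t. \<tau> t = s" for s
  proof -
    define h where "h = \<bar>s - \<tau> 0\<bar> / m"
    have h: "0 \<le> h" "m * h = \<bar>s - \<tau> 0\<bar>" using m by (auto simp: h_def)
    have "\<tau> (- h) \<le> s" "s \<le> \<tau> h" using grow[of 0 h] grow[of "- h" 0] h by auto
    then show ?thesis using IVT'[of \<tau> "- h" s h] h(1) cont by auto
  qed
  define \<psi> where "\<psi> = inv_into UNIV \<tau>"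
  have "inj \<tau>" "surj \<tau>" using inj surj by (auto simp: inj_def surj_def) metis
  then have 1: "\<tau> (\<psi> s) = s" "\<psi> (\<tau> t) = t" for s t
    by (auto simp: \<psi>_def surj_f_inv_f)
  have "isCont \<psi> s" for s
  proof -
    have "dist (\<psi> a) (\<psi> b) \<le> (1 / m) * dist a b" for a b
      using lip[of "\<psi> a" "\<psi> b"] m(1) by (simp add: 1 dist_real_def field_simps)
    then have "lipschitz_on (1 / m) UNIV \<psi>" using m(1) by (intro lipschitz_onI) auto
    then show ?thesis using lipschitz_on_continuous_on continuous_on_eq_continuous_at open_UNIV by blast
  qed
  then have "(\<psi> has_real_derivative inverse (\<tau>' (\<psi> s))) (at s)" for s
    using DERIV_inverse_function[where f = \<tau> and g = \<psi> and x = s and a = "s - 1" and b = "s + 1", OF \<tau>]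
      1(1) m(1) m(2)[of "\<psi> s"] by simp
  with 1 show ?thesis by (rule that)
qed

lemma local_antiderivative:
  fixes u :: "real \<Rightarrow> real"
  assumes \<delta>: "0 < \<delta>" and u: "continuous_on {-\<delta>..\<delta>} u"
  obtains U where "\<And>x. \<bar>x\<bar> \<le> \<delta> \<Longrightarrow> (U has_real_derivative x * u x) (at x)"
proof -
  define k where "k = (\<lambda>x. max (- \<delta>) (min \<delta> x))"
  have "continuous_on UNIV k" unfolding k_def by (intro continuous_intros)
  moreover have "range k \<subseteq> {-\<delta>..\<delta>}" using \<delta> by (auto simp: k_def)
  ultimately have "continuous_on UNIV (\<lambda>x. x * u (k x))"
    by (intro continuous_intros continuous_on_compose2[OF u])
  then obtain U where U: "\<And>x. (U has_real_derivative x * u (k x)) (at x)"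
    using antiderivative_exists by blast
  have "k x = x" if "\<bar>x\<bar> \<le> \<delta>" for x using that by (auto simp: k_def)
  then show ?thesis using U that by metis
qed

section \<open>From periodic solutions of the radial equation to centers\<close>

context perturbed_rotation
begin

text \<open>The curve is a positive periodic graph in polar coordinates: the direction of a ray
  fixes the angle modulo a full turn and with it the radius. Scaling by \<open>\<alpha>\<close> and
  \<open>\<beta>\<close> maps rays to rays.\<close>

lemma star_curve:
  fixes r :: "real \<Rightarrow> real"
  assumes per: "\<And>t. r (t + 2 * pi) = r t" and pos: "\<And>t. 0 < r t" and cr: "continuous_on UNIV r"
  shows "(x0, y0) \<in> inside (range (\<lambda>t. (x0 + \<alpha> * (r t * cos t), y0 + \<beta> * (r t * sin t))))"
proof -
  define c where "c = (\<lambda>t. (x0 + \<alpha> * (r t * cos t), y0 + \<beta> * (r t * sin t)))"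
  note perZ = periodic_of_int[of r, OF per]
  have trig: "cos (t + 2 * pi * of_int n) = cos t" "sin (t + 2 * pi * of_int n) = sin t" for t n
    using periodic_of_int[of cos t n] periodic_of_int[of sin t n] by simp_all
  have cc: "continuous_on S c" for S
    unfolding c_def by (intro continuous_intros continuous_on_subset[OF cr]) auto
  have "range c = c ` {0..2 * pi}"
  proof
    show "range c \<subseteq> c ` {0..2 * pi}"
    proof
      fix z assume "z \<in> range c"
      then obtain t where z: "z = c t" by blast
      obtain n where n: "0 \<le> t + 2 * pi * of_int n" "t + 2 * pi * of_int n \<le> 2 * pi" by (rule reduce_mod_2pi)
      have "c t = c (t + 2 * pi * of_int n)" by (simp add: c_def perZ trig)
      then show "z \<in> c ` {0..2 * pi}" using n z by auto
    qed
    show "c ` {0..2 * pi} \<subseteq> range c" by blast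
  qed
  then have "compact (range c)" using compact_continuous_image[OF cc, of "{0..2 * pi}"] by simp
  moreover have "(x0, y0) \<notin> range c"
  proof
    assume "(x0, y0) \<in> range c"
    then obtain t where "r t * cos t = 0" "r t * sin t = 0" using nz by (auto simp: c_def)
    then show False using pos[of t] sin_cos_squared_add[of t] by auto
  qed
  moreover have "\<exists>s>0. (x0, y0) + s *\<^sub>R (z - (x0, y0)) \<in> range c" if "z \<noteq> (x0, y0)" for z
  proof -
    define X Y where "X = (fst z - x0) / \<alpha>" and "Y = (snd z - y0) / \<beta>"
    have z: "z - (x0, y0) = (\<alpha> * X, \<beta> * Y)" using nz by (simp add: X_def Y_def prod_eq_iff)
    have "X \<noteq> 0 \<or> Y \<noteq> 0" using that nz by (auto simp: X_def Y_def prod_eq_iff)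
    define \<rho> where "\<rho> = sqrt (X\<^sup>2 + Y\<^sup>2)"
    have "0 < X\<^sup>2 + Y\<^sup>2" unfolding sum_power2_gt_zero_iff by (rule \<open>X \<noteq> 0 \<or> Y \<noteq> 0\<close>)
    then have \<rho>: "0 < \<rho>" unfolding \<rho>_def by (rule real_sqrt_gt_zero)
    have "(X / \<rho>)\<^sup>2 + (Y / \<rho>)\<^sup>2 = 1"
      using \<open>X \<noteq> 0 \<or> Y \<noteq> 0\<close> unfolding power_divide add_divide_distrib[symmetric] by (auto simp: \<rho>_def)
    then obtain t where t: "X / \<rho> = cos t" "Y / \<rho> = sin t" using sincos_total_2pi by metis
    have "(x0, y0) + (r t / \<rho>) *\<^sub>R (z - (x0, y0)) = c t"
      using t[symmetric] by (simp add: z c_def)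
    then show ?thesis using pos[of t] \<rho> by (intro exI[of _ "r t / \<rho>"]) auto
  qed
  moreover have "s = 1" if zs: "z \<in> range c" "0 < s" "(x0, y0) + s *\<^sub>R (z - (x0, y0)) \<in> range c" for z s
  proof -
    obtain t where t: "z = c t" using zs by auto
    obtain t' where t': "(x0, y0) + s *\<^sub>R (z - (x0, y0)) = c t'" using zs by auto
    have e: "s * r t * cos t = r t' * cos t'" "s * r t * sin t = r t' * sin t'"
      using t' nz by (simp_all add: t c_def algebra_simps)
    have "(s * r t)\<^sup>2 = (s * r t * cos t)\<^sup>2 + (s * r t * sin t)\<^sup>2"
      by (simp add: power_mult_distrib flip: distrib_left)
    also have "\<dots> = (r t')\<^sup>2"
      unfolding e by (simp add: power_mult_distrib flip: distrib_left)
    finally have sr: "s * r t = r t'"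
      using pos[of t] pos[of t'] zs(2) by (simp add: power2_eq_iff_nonneg)
    then have "cos t' = cos t" "sin t' = sin t" using e pos[of t'] by auto
    then obtain n :: int where "t' = t + 2 * pi * of_int n" using sin_cos_eq_iff[of t' t] by auto
    then have "r t' = r t" using perZ by simp
    then show ?thesis using sr pos[of t] by simp
  qed
  ultimately show ?thesis unfolding c_def[symmetric] by (rule star_shaped_curve_inside)
qed

text \<open>The angle parametrizes the curve, and \<open>\<tau>\<close>, an antiderivative of the
  reciprocal angular speed, is the elapsed time. Composition with its inverse \<open>\<psi>\<close>
  gives a solution of the field, whose period \<open>T\<close> is the time of one turn.\<close>

lemma periodic_solution_orbit:
  assumes sol: "solution r" and per: "\<And>t. r (t + 2 * pi) = r t" and pos: "\<And>t. 0 < r t" and small: "\<And>t. r t \<le> \<epsilon>"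
  defines "c \<equiv> \<lambda>t. (x0 + \<alpha> * (r t * cos t), y0 + \<beta> * (r t * sin t))"
  shows "periodic_orbit F (range c)" "(x0, y0) \<in> inside (range c)"
proof -
  have r': "(r has_real_derivative rate t (r t)) (at t)" for t using sol unfolding solution_def by blast
  have cr: "continuous_on S r" for S
    using r' by (meson DERIV_isCont continuous_at_imp_continuous_on)
  have r\<epsilon>: "\<bar>r t\<bar> \<le> \<epsilon>" for t using pos[of t] small[of t] by simp
  define \<Theta> where "\<Theta> = (\<lambda>t. speed t (r t))"
  have \<Theta>: "1 / 2 \<le> \<Theta> t" "\<Theta> t \<le> 3 / 2" for t unfolding \<Theta>_def by (rule speed_bounds[OF r\<epsilon>])+
  have \<Theta>0: "\<Theta> t \<noteq> 0" "0 < \<Theta> t" for t using \<Theta>(1)[of t] by auto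
  have rate: "rate t (r t) = radial t (r t) / \<Theta> t" for t
    by (simp add: rate_def \<Theta>_def clip(5)[OF r\<epsilon>])
  have "continuous_on UNIV \<Theta>" unfolding \<Theta>_def by (intro continuous_polar cr continuous_on_id)
  then have "continuous_on UNIV (\<lambda>t. 1 / \<Theta> t)" by (intro continuous_intros) (auto simp: \<Theta>0)
  then obtain \<tau> where \<tau>: "\<tau> 0 = 0" "\<And>t. (\<tau> has_real_derivative 1 / \<Theta> t) (at t)"
    using antiderivative_exists by metis
  have "2 / 3 \<le> 1 / \<Theta> t" for t
    using \<Theta>[of t] by (simp add: field_simps)
  then obtain \<psi> where \<psi>: "\<And>s. \<tau> (\<psi> s) = s" "\<And>t. \<psi> (\<tau> t) = t"
    "\<And>s. (\<psi> has_real_derivative inverse (1 / \<Theta> (\<psi> s))) (at s)"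
    using strictly_increasing_inverse[OF \<tau>(2), of "2 / 3"] by auto
  define T where "T = \<tau> (2 * pi)"
  have "\<Theta> (t + 2 * pi) = \<Theta> t" for t by (simp add: \<Theta>_def per speed_def)
  then have "((\<lambda>t. \<tau> (t + 2 * pi) - \<tau> t) has_real_derivative 0) (at t)" for t
  proof -
    have "((\<lambda>t. t + 2 * pi) has_real_derivative 1) (at t)" by (auto intro!: derivative_eq_intros)
    from DERIV_chain2[of \<tau> _ "\<lambda>t. t + 2 * pi", OF \<tau>(2) this]
    have "((\<lambda>t. \<tau> (t + 2 * pi)) has_real_derivative 1 / \<Theta> t) (at t)"
      by (simp add: \<open>\<And>t. \<Theta> (t + 2 * pi) = \<Theta> t\<close>)
    from DERIV_diff[OF this \<tau>(2)[of t]] show ?thesis by simp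
  qed
  from DERIV_isconst_all[OF allI[OF this]] have "\<tau> (t + 2 * pi) - \<tau> t = \<tau> (0 + 2 * pi) - \<tau> 0" for t .
  then have \<tau>T: "\<tau> (t + 2 * pi) = \<tau> t + T" for t
    using \<tau>(1) by (simp add: T_def algebra_simps)
  have "\<tau> 0 < \<tau> (2 * pi)"
    by (rule DERIV_pos_imp_increasing) (use \<tau>(2) \<Theta>0 in \<open>auto intro!: exI[of _ "1 / \<Theta> _"]\<close>)
  then have T: "0 < T" using \<tau>(1) by (simp add: T_def)
  have \<psi>T: "\<psi> (s + T) = \<psi> s + 2 * pi" for s
    using \<tau>T[of "\<psi> s"] \<psi>(1)[of s] \<psi>(2)[of "\<psi> s + 2 * pi"] by simp
  have cper: "c (t + 2 * pi) = c t" for t by (simp add: c_def per)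
  have c': "(c has_vector_derivative (1 / \<Theta> t) *\<^sub>R F (c t)) (at t)" for t
  proof -
    let ?X = "r t * cos t" and ?Y = "r t * sin t"
    have "(cos t)\<^sup>2 = 1 - (sin t)\<^sup>2" by (simp add: cos_squared_eq)
    then have X: "radial t (r t) * cos t - \<Theta> t * (r t * sin t) = - ?Y * A ?X ?Y"
      and Y: "radial t (r t) * sin t + \<Theta> t * (r t * cos t) = ?X * B ?X ?Y"
      unfolding \<Theta>_def radial_def speed_def by algebra+
    have "((\<lambda>t. x0 + \<alpha> * (r t * cos t)) has_real_derivative \<alpha> * (rate t (r t) * cos t - r t * sin t)) (at t)"
      "((\<lambda>t. y0 + \<beta> * (r t * sin t)) has_real_derivative \<beta> * (rate t (r t) * sin t + r t * cos t)) (at t)"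
      by (auto intro!: derivative_eq_intros r')
    then have "(c has_vector_derivative (\<alpha> * (rate t (r t) * cos t - r t * sin t), \<beta> * (rate t (r t) * sin t + r t * cos t))) (at t)"
      unfolding c_def by (intro has_vector_derivative_Pair) (simp_all add: has_real_derivative_iff_has_vector_derivative)
    moreover have "rate t (r t) * cos t - r t * sin t = (1 / \<Theta> t) * (- ?Y * A ?X ?Y)"
      "rate t (r t) * sin t + r t * cos t = (1 / \<Theta> t) * (?X * B ?X ?Y)"
      unfolding X[symmetric] Y[symmetric] rate using \<Theta>0[of t] by (simp_all add: field_simps)
    ultimately show ?thesis unfolding c_def F_eq by (simp add: mult_ac)
  qed
  have "((\<lambda>s. c (\<psi> s)) has_vector_derivative F (c (\<psi> s))) (at s)" for s
    using vector_diff_chain_at[OF \<psi>(3)[unfolded has_real_derivative_iff_has_vector_derivative] c', of s] \<Theta>0(1)[of "\<psi> s"]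
    by (simp add: o_def)
  moreover have "c (\<psi> (s + T)) = c (\<psi> s)" for s by (simp add: \<psi>T cper)
  \<comment> \<open>The solution is not constant: at the angles 0 and \<open>pi\<close> it lies on
    opposite sides of the equilibrium.\<close>
  moreover have "c (\<psi> (\<tau> 0)) \<noteq> c (\<psi> (\<tau> pi))"
  proof
    assume "c (\<psi> (\<tau> 0)) = c (\<psi> (\<tau> pi))"
    then have "\<alpha> * r 0 = \<alpha> * - r pi" by (simp add: \<psi> c_def)
    then have "r 0 = - r pi" using nz(1) by (metis mult_left_cancel)
    then show False using pos[of 0] pos[of pi] by simp
  qed
  moreover have "range c = range (\<lambda>s. c (\<psi> s))"
    using \<psi>(2) by (auto simp: image_iff) metis
  ultimately show "periodic_orbit F (range c)"
    unfolding periodic_orbit_def using T by (intro exI[of _ "\<lambda>s. c (\<psi> s)"] exI[of _ T]) blast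
  show "(x0, y0) \<in> inside (range c)"
    unfolding c_def by (rule star_curve[OF per pos cr])
qed

theorem center_if_return:
  assumes \<delta>: "0 < \<delta>"
    and return: "\<And>r. solution r \<Longrightarrow> (\<And>t. 0 < r t) \<Longrightarrow> (\<And>t. 0 \<le> t \<Longrightarrow> t \<le> 2 * pi \<Longrightarrow> r t < \<delta> \<and> r t \<le> \<epsilon>)
        \<Longrightarrow> \<exists>t. r (t + 2 * pi) = r t"
  shows "is_center F (x0, y0)"
proof -
  \<comment> \<open>Since the rate is at most twice the radius, a solution grows within one turn at
    most by \<open>exp (4 * pi)\<close>. Starting below \<open>\<eta>\<close> it stays below half of
    \<open>min \<delta> \<epsilon>\<close>, where clipping has no effect; \<open>\<mu>\<close>
    expresses this in the original coordinates.\<close>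
  define \<eta> where "\<eta> = min \<delta> \<epsilon> / 2 * exp (- (4 * pi))"
  define \<mu> where "\<mu> = \<eta> * min \<bar>\<alpha>\<bar> \<bar>\<beta>\<bar> / 2"
  have \<eta>: "0 < \<eta>" using \<delta> eps by (simp add: \<eta>_def)
  have \<mu>: "0 < \<mu>" using \<eta> nz by (simp add: \<mu>_def)
  have orbit: "\<exists>\<gamma>. periodic_orbit F \<gamma> \<and> (x0, y0) \<in> inside \<gamma> \<and> z \<in> \<gamma>"
    if z: "z \<noteq> (x0, y0)" "dist z (x0, y0) < \<mu>" for z
  proof -
    define X Y where "X = (fst z - x0) / \<alpha>" and "Y = (snd z - y0) / \<beta>"
    have zz: "z = (x0 + \<alpha> * X, y0 + \<beta> * Y)" using nz by (simp add: X_def Y_def prod_eq_iff)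
    have "X \<noteq> 0 \<or> Y \<noteq> 0" using z nz by (auto simp: X_def Y_def prod_eq_iff)
    define \<rho> where "\<rho> = sqrt (X\<^sup>2 + Y\<^sup>2)"
    have "0 < X\<^sup>2 + Y\<^sup>2" unfolding sum_power2_gt_zero_iff by (rule \<open>X \<noteq> 0 \<or> Y \<noteq> 0\<close>)
    then have \<rho>: "0 < \<rho>" unfolding \<rho>_def by (rule real_sqrt_gt_zero)
    have "\<bar>X\<bar> < \<eta> / 2" "\<bar>Y\<bar> < \<eta> / 2"
    proof -
      have "\<bar>fst z - x0\<bar> < \<mu>" "\<bar>snd z - y0\<bar> < \<mu>"
        using z(2) dist_fst_le[of z "(x0, y0)"] dist_snd_le[of z "(x0, y0)"] by (auto simp: dist_real_def)
      moreover have "\<mu> \<le> \<eta> / 2 * \<bar>\<alpha>\<bar>" "\<mu> \<le> \<eta> / 2 * \<bar>\<beta>\<bar>"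
        using \<eta> by (auto simp: \<mu>_def intro!: mult_left_mono)
      ultimately show "\<bar>X\<bar> < \<eta> / 2" "\<bar>Y\<bar> < \<eta> / 2"
        using nz by (auto simp: X_def Y_def abs_divide pos_divide_less_eq)
    qed
    moreover have "\<rho> \<le> \<bar>X\<bar> + \<bar>Y\<bar>" unfolding \<rho>_def by (rule sqrt_sum_squares_le_sum_abs)
    ultimately have \<rho>\<eta>: "\<rho> < \<eta>" by linarith
    have "(X / \<rho>)\<^sup>2 + (Y / \<rho>)\<^sup>2 = 1"
      using \<open>X \<noteq> 0 \<or> Y \<noteq> 0\<close> unfolding power_divide add_divide_distrib[symmetric] by (auto simp: \<rho>_def)
    then obtain t0 where t0: "0 \<le> t0" "t0 < 2 * pi" "X / \<rho> = cos t0" "Y / \<rho> = sin t0" using sincos_total_2pi by metis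
    obtain r where r: "r t0 = \<rho>" "solution r" by (rule solution_exists)
    have pos: "0 < r t" for t using solution_positive[OF r(2), of t0] r(1) \<rho> by simp
    have bnd: "r t < \<delta> \<and> r t \<le> \<epsilon>" if "0 \<le> t" "t \<le> 2 * pi" for t
    proof -
      have "(r t)\<^sup>2 \<le> (r t0)\<^sup>2 * exp (2 * 2 * \<bar>t - t0\<bar>)"
        by (rule gronwall_square[of r "\<lambda>t. rate t (r t)"]) (use r rate_bound in \<open>auto simp: solution_def\<close>)
      also have "\<dots> \<le> \<rho>\<^sup>2 * exp (2 * (4 * pi))"
        using that t0 unfolding r(1) by (intro mult_left_mono) auto
      also have "\<dots> = (\<rho> * exp (4 * pi))\<^sup>2" using exp_double[of "4 * pi"] by (simp add: power_mult_distrib)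
      finally have "r t \<le> \<rho> * exp (4 * pi)" using \<rho> by (simp add: power2_le_iff_abs_le pos less_imp_le abs_of_pos)
      also have "\<dots> < \<eta> * exp (4 * pi)" using \<rho>\<eta> by simp
      also have "\<dots> = min \<delta> \<epsilon> / 2" by (simp add: \<eta>_def exp_minus)
      finally show ?thesis using \<delta> eps by (auto simp: min_def split: if_splits)
    qed
    from return[OF r(2) pos bnd] obtain t1 where "r (t1 + 2 * pi) = r t1" by blast
    then have per: "r (t + 2 * pi) = r t" for t by (rule solution_periodic[OF r(2)])
    have small: "r t \<le> \<epsilon>" for t
    proof -
      obtain n where n: "0 \<le> t + 2 * pi * of_int n" "t + 2 * pi * of_int n \<le> 2 * pi" by (rule reduce_mod_2pi)
      then show ?thesis using bnd[OF n] periodic_of_int[of r t n, OF per] by simp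
    qed
    have "z = (x0 + \<alpha> * (r t0 * cos t0), y0 + \<beta> * (r t0 * sin t0))"
      using \<rho> by (simp add: zz r(1) t0(3,4)[symmetric])
    then show ?thesis using periodic_solution_orbit[OF r(2) per pos small] by blast
  qed
  define \<P> where "\<P> = {\<gamma>. periodic_orbit F \<gamma> \<and> (x0, y0) \<in> inside \<gamma>}"
  have not_mem: "(x0, y0) \<notin> \<Union>\<P>" by (auto simp: \<P>_def inside_def)
  have "ball (x0, y0) \<mu> \<subseteq> insert (x0, y0) (\<Union>\<P>)"
    using orbit by (force simp: \<P>_def dist_commute)
  then have "(x0, y0) \<in> interior (insert (x0, y0) (\<Union>\<P>))"
    using \<mu> by (meson mem_interior)
  moreover have "F (x0, y0) = 0" using F_eq[of 0 0] by (simp add: zero_prod_def)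
  moreover have "insert (x0, y0) (\<Union>\<P>) - {(x0, y0)} = \<Union>\<P>" using not_mem by blast
  moreover have "\<forall>\<gamma>\<in>\<P>. periodic_orbit F \<gamma> \<and> (x0, y0) \<in> inside \<gamma>" by (simp add: \<P>_def)
  ultimately show ?thesis unfolding is_center_def
    by (intro conjI exI[of _ "insert (x0, y0) (\<Union>\<P>)"] exI[of _ \<P>])
qed

text \<open>Under reflection of the angle about \<open>t0\<close> the rate changes sign, so the
  reflected solution is a solution with the same value at \<open>t0\<close>, hence the same
  solution. This symmetry at \<open>t0 - pi\<close> is the return condition.\<close>

theorem center_if_reversible:
  assumes "\<And>t r. speed (2 * t0 - t) r = speed t r" "\<And>t r. radial (2 * t0 - t) r = - radial t r"
  shows "is_center F (x0, y0)"
proof (rule center_if_return[of 1])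
  fix r assume r: "solution r"
  have rate: "rate (2 * t0 - t) r = - rate t r" for t r by (simp add: rate_def assms)
  have "solution (\<lambda>t. r (2 * t0 - t))"
    unfolding solution_def
  proof
    fix t
    have "((\<lambda>t. 2 * t0 - t) has_real_derivative - 1) (at t)" by (auto intro!: derivative_eq_intros)
    moreover have "(r has_real_derivative rate (2 * t0 - t) (r (2 * t0 - t))) (at (2 * t0 - t))"
      using r unfolding solution_def by blast
    ultimately have "((\<lambda>t. r (2 * t0 - t)) has_real_derivative rate (2 * t0 - t) (r (2 * t0 - t)) * - 1) (at t)"
      by (rule DERIV_chain2[of r _ "\<lambda>t. 2 * t0 - t" t "- 1", rotated])
    then show "((\<lambda>t. r (2 * t0 - t)) has_real_derivative rate t (r (2 * t0 - t))) (at t)"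
      by (simp add: rate)
  qed
  then have "(\<lambda>t. r (2 * t0 - t)) = r" using r by (rule solution_unique[of _ _ t0]) simp
  then have "r (2 * t0 - t) = r t" for t by (rule fun_cong)
  from this[of "t0 - pi"] show "\<exists>t. r (t + 2 * pi) = r t"
    by (intro exI[of _ "t0 - pi"]) (simp add: algebra_simps)
qed simp

text \<open>The form \<open>X B dX + Y A dY\<close> annihilates the field
  \<open>(- Y A, X B)\<close> and \<open>g\<close> is its integrating factor, so \<open>H\<close> is
  constant along orbits. On the positive \<open>X\<close>-axis \<open>H\<close> increases strictly
  with the radius, so the radius returns to its initial value after a turn.\<close>

theorem center_if_first_integral:
  assumes \<delta>: "0 < \<delta>"
    and H: "\<And>X Y. norm (X, Y) < \<delta> \<Longrightarrow> ((\<lambda>z. H (fst z) (snd z)) has_derivative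
        (\<lambda>h. g X Y * (X * B X Y * fst h + Y * A X Y * snd h))) (at (X, Y))"
    and g: "\<And>X Y. norm (X, Y) < \<delta> \<Longrightarrow> 0 < g X Y"
  shows "is_center F (x0, y0)"
proof (rule center_if_return[OF \<delta>])
  fix r assume r: "solution r" and pos: "\<And>t. 0 < r t"
    and small: "\<And>t. 0 \<le> t \<Longrightarrow> t \<le> 2 * pi \<Longrightarrow> r t < \<delta> \<and> r t \<le> \<epsilon>"
  have nrm: "norm (\<rho> * cos t, \<rho> * sin t) = \<bar>\<rho>\<bar>" for \<rho> t
    by (simp add: norm_Pair power_mult_distrib flip: distrib_left)
  have "((\<lambda>t. H (r t * cos t) (r t * sin t)) has_real_derivative 0) (at t)" if t: "0 \<le> t" "t \<le> 2 * pi" for t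
  proof -
    let ?X = "r t * cos t" and ?Y = "r t * sin t"
    have re: "\<bar>r t\<bar> \<le> \<epsilon>" using pos[of t] small[OF t] by simp
    have s: "speed t (r t) \<noteq> 0" using speed_bounds(1)[OF re, of t] by auto
    have r': "(r has_real_derivative radial t (r t) / speed t (r t)) (at t)"
      using r clip(5)[OF re] unfolding solution_def rate_def by metis
    define k where "k = radial t (r t) / speed t (r t)"
    have d: "((\<lambda>t. (r t * cos t, r t * sin t)) has_derivative (\<lambda>h. (h * (k * cos t - r t * sin t), h * (k * sin t + r t * cos t)))) (at t)"
      using r' unfolding k_def[symmetric]
      by (intro has_derivative_Pair) (auto simp: has_field_derivative_def[symmetric] mult.commute[of _ "_ - _"] mult.commute[of _ "_ + _"] intro!: derivative_eq_intros)
    have nd: "norm (?X, ?Y) < \<delta>" unfolding nrm using pos[of t] small[OF t] by simp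
    have "?X * B ?X ?Y * (k * cos t - r t * sin t) + ?Y * A ?X ?Y * (k * sin t + r t * cos t)
        = r t * (k * speed t (r t) - radial t (r t))"
      unfolding speed_def radial_def by algebra
    then have zero: "?X * B ?X ?Y * (k * cos t - r t * sin t) + ?Y * A ?X ?Y * (k * sin t + r t * cos t) = 0"
      using s by (simp add: k_def)
    have "g ?X ?Y * (?X * B ?X ?Y * (h * (k * cos t - r t * sin t)) + ?Y * A ?X ?Y * (h * (k * sin t + r t * cos t)))
      = g ?X ?Y * (h * (?X * B ?X ?Y * (k * cos t - r t * sin t) + ?Y * A ?X ?Y * (k * sin t + r t * cos t)))" for h
      by (simp add: algebra_simps)
    note z0 = this[unfolded zero mult_zero_right]
    have "((\<lambda>t. H (r t * cos t) (r t * sin t)) has_derivative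
      (\<lambda>h. g ?X ?Y * (?X * B ?X ?Y * (h * (k * cos t - r t * sin t)) + ?Y * A ?X ?Y * (h * (k * sin t + r t * cos t))))) (at t)"
      using has_derivative_compose[OF d, of "\<lambda>z. H (fst z) (snd z)", OF H[OF nd]] by simp
    then show ?thesis unfolding z0 has_field_derivative_def mult_zero_left .
  qed
  note D = this
  have "H (r (2 * pi) * cos (2 * pi)) (r (2 * pi) * sin (2 * pi)) = H (r 0 * cos 0) (r 0 * sin 0)"
    by (rule DERIV_isconst_end[of 0 "2 * pi" "\<lambda>t. H (r t * cos t) (r t * sin t)"])
      (auto intro!: D continuous_at_imp_continuous_on DERIV_isCont[OF D])
  then have eq: "H (r 0) 0 = H (r (2 * pi)) 0" by simp
  have incr: "H a 0 < H b 0" if ab: "0 < a" "a < b" "b < \<delta>" "b \<le> \<epsilon>" for a b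
  proof (rule DERIV_pos_imp_increasing[OF ab(2)])
    fix x assume x: "a \<le> x" "x \<le> b"
    have d0: "((\<lambda>x. (x, 0::real)) has_derivative (\<lambda>h. (h, 0))) (at x)"
      by (auto intro!: derivative_eq_intros)
    have nx: "norm (x, 0::real) < \<delta>" using x ab by (simp add: norm_Pair)
    have "((\<lambda>x. H x 0) has_derivative (\<lambda>h. g x 0 * (x * B x 0 * h))) (at x)"
      using has_derivative_compose[OF d0 H[OF nx]] by simp
    then have "((\<lambda>x. H x 0) has_real_derivative g x 0 * (x * B x 0)) (at x)"
      unfolding has_field_derivative_def by (rule has_derivative_eq_rhs) (simp add: fun_eq_iff)
    moreover have "0 < B x 0" using near_one'(3)[of x 0] x ab by simp
    ultimately show "\<exists>y. ((\<lambda>x. H x 0) has_real_derivative y) (at x) \<and> 0 < y"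
      using g[OF nx] x ab by (intro exI[of _ "g x 0 * (x * B x 0)"]) auto
  qed
  have "r 0 = r (2 * pi)"
    using incr[of "r 0" "r (2 * pi)"] incr[of "r (2 * pi)" "r 0"] eq pos small[of 0] small[of "2 * pi"]
    by (cases "r 0" "r (2 * pi)" rule: linorder_cases) auto
  then show "\<exists>t. r (t + 2 * pi) = r t" by (intro exI[of _ 0]) simp
qed

text \<open>The reversing reflection is the exchange of \<open>X\<close> and \<open>Y\<close>, with
  axis at the angle \<open>pi / 4\<close>; its counterpart below uses the axis
  \<open>X = - Y\<close>.\<close>

lemma center_if_swap:
  assumes "\<And>X Y. A Y X = B X Y"
  shows "is_center F (x0, y0)"
proof (rule center_if_reversible[of "pi / 4"])
  have c: "cos (2 * (pi / 4) - t) = sin t" "sin (2 * (pi / 4) - t) = cos t" for t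
    using sin_cos_eq[of t] cos_sin_eq[of t] by simp_all
  show "speed (2 * (pi / 4) - t) r = speed t r" "radial (2 * (pi / 4) - t) r = - radial t r" for t r
    unfolding speed_def radial_def c by (simp_all add: assms[symmetric] algebra_simps)
qed

lemma center_if_antiswap:
  assumes "\<And>X Y. A (- Y) (- X) = B X Y"
  shows "is_center F (x0, y0)"
proof (rule center_if_reversible[of "- pi / 4"])
  have c: "cos (2 * (- pi / 4) - t) = - sin t" "sin (2 * (- pi / 4) - t) = - cos t" for t
    by (simp_all add: cos_diff sin_diff)
  show "speed (2 * (- pi / 4) - t) r = speed t r" "radial (2 * (- pi / 4) - t) r = - radial t r" for t r
    unfolding speed_def radial_def c by (simp_all add: assms[symmetric] algebra_simps)
qed

text \<open>The integrating factor turns the annihilating form into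
  \<open>X u(X) dX + Y w(Y) dY\<close>, whose integral is a sum of two functions of one
  variable.\<close>

lemma center_if_separable:
  assumes \<delta>: "0 < \<delta>" and u: "continuous_on {-\<delta>..\<delta>} u" and w: "continuous_on {-\<delta>..\<delta>} w"
    and g: "\<And>X Y. \<bar>X\<bar> \<le> \<delta> \<Longrightarrow> \<bar>Y\<bar> \<le> \<delta> \<Longrightarrow> 0 < g X Y \<and> g X Y * B X Y = u X \<and> g X Y * A X Y = w Y"
  shows "is_center F (x0, y0)"
proof -
  obtain U where U: "\<And>x. \<bar>x\<bar> \<le> \<delta> \<Longrightarrow> (U has_real_derivative x * u x) (at x)"
    using local_antiderivative[OF \<delta> u] by blast
  obtain W where W: "\<And>x. \<bar>x\<bar> \<le> \<delta> \<Longrightarrow> (W has_real_derivative x * w x) (at x)"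
    using local_antiderivative[OF \<delta> w] by blast
  show ?thesis
  proof (rule center_if_first_integral[OF \<delta>, of "\<lambda>X Y. U X + W Y" g])
    fix X Y :: real assume n: "norm (X, Y) < \<delta>"
    have XY: "\<bar>X\<bar> \<le> \<delta>" "\<bar>Y\<bar> \<le> \<delta>" using norm_fst_le[of X Y] norm_snd_le[of Y X] n by simp_all
    note gXY = g[OF XY]
    show "0 < g X Y" using gXY by simp
    have "((\<lambda>z. U (fst z) + W (snd z)) has_derivative (\<lambda>h. X * u X * fst h + Y * w Y * snd h)) (at (X, Y))"
      using has_derivative_add[OF has_derivative_compose[OF has_derivative_fst[OF has_derivative_ident], of U] 
          has_derivative_compose[OF has_derivative_snd[OF has_derivative_ident], of W]]
        U[OF XY(1)] W[OF XY(2)] unfolding has_field_derivative_def by simp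
    moreover have "X * u X = g X Y * (X * B X Y)" "Y * w Y = g X Y * (Y * A X Y)"
      using gXY by (auto simp: mult_ac)
    ultimately show "((\<lambda>z. U (fst z) + W (snd z)) has_derivative
        (\<lambda>h. g X Y * (X * B X Y * fst h + Y * A X Y * snd h))) (at (X, Y))"
      by (simp add: algebra_simps)
  qed
qed

end

section \<open>Integrable and reversible cases\<close>

text \<open>The scale \<open>k\<close> multiplies all six coefficients. Sufficiency uses
  \<open>k = 1\<close>, and necessity uses \<open>k = 1 / b2\<close> to reach a system with
  \<open>b2 = 1\<close>.\<close>

lemma kolmogorov_field_coords:
  assumes "a1 \<noteq> 0" "b1 \<noteq> 0"
  shows "kolmogorov_field a1 a2 a3 b1 b2 b3 (1 + a1 * k * X, 1 + b1 * k * Y)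
    = (a1 * k * (- Y * (1 + a1 * k * X) * (1 + a2 * k * X + a3 * k * Y)),
       b1 * k * (X * (1 + b1 * k * Y) * (1 + b2 * k * X + b3 * k * Y)))"
  using assms by (simp add: kolmogorov_field_def field_simps power2_eq_square)

text \<open>The difference is \<open>r - s\<close> times \<open>u + v + (r + s) * (u * v)\<close>,
  and the second factor is at most \<open>2 * M + 2 * M^2 \<le> 4 * M^2\<close> in absolute
  value.\<close>

lemma product_lipschitz:
  fixes u v M r s :: real
  assumes "\<bar>u\<bar> \<le> M" "\<bar>v\<bar> \<le> M" "1 \<le> M" "\<bar>r\<bar> \<le> 1" "\<bar>s\<bar> \<le> 1"
  shows "\<bar>(1 + r * u) * (1 + r * v) - (1 + s * u) * (1 + s * v)\<bar> \<le> 4 * M\<^sup>2 * \<bar>r - s\<bar>"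
proof -
  have uv: "\<bar>u * v\<bar> \<le> M\<^sup>2" using mult_mono[OF assms(1,2)] assms(3) by (simp add: abs_mult power2_eq_square)
  have M: "M \<le> M\<^sup>2" using assms(3) by (simp add: power2_eq_square mult_le_cancel_left1)
  have "\<bar>(r + s) * (u * v)\<bar> \<le> 2 * M\<^sup>2"
    unfolding abs_mult[of "r + s"] using assms uv by (intro mult_mono) auto
  then have "\<bar>u + v + (r + s) * (u * v)\<bar> \<le> 4 * M\<^sup>2"
    using assms M by linarith
  then have "\<bar>r - s\<bar> * \<bar>u + v + (r + s) * (u * v)\<bar> \<le> \<bar>r - s\<bar> * (4 * M\<^sup>2)"
    by (rule mult_left_mono) simp
  moreover have "(1 + r * u) * (1 + r * v) - (1 + s * u) * (1 + s * v) = (r - s) * (u + v + (r + s) * (u * v))"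
    by (simp add: algebra_simps)
  ultimately show ?thesis by (simp add: abs_mult mult.commute)
qed

lemma ray_coeff_bound:
  fixes a b :: real
  shows "\<bar>a * cos t\<bar> \<le> \<bar>a\<bar>" "\<bar>a * sin t\<bar> \<le> \<bar>a\<bar>" "\<bar>a * cos t + b * sin t\<bar> \<le> \<bar>a\<bar> + \<bar>b\<bar>"
proof -
  have *: "\<bar>a * cos t\<bar> \<le> \<bar>a\<bar>" "\<bar>a * sin t\<bar> \<le> \<bar>a\<bar>" for a :: real
    by (simp_all add: abs_mult mult_left_le)
  then show "\<bar>a * cos t\<bar> \<le> \<bar>a\<bar>" "\<bar>a * sin t\<bar> \<le> \<bar>a\<bar>" .
  show "\<bar>a * cos t + b * sin t\<bar> \<le> \<bar>a\<bar> + \<bar>b\<bar>"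
    using *(1)[of a] *(2)[of b] by linarith
qed

lemma has_derivative_fst_compose:
  "(U has_real_derivative D) (at X) \<Longrightarrow> ((\<lambda>z. U (fst z)) has_derivative (\<lambda>h. D * fst h)) (at (X, Y))"
  using has_derivative_compose[OF bounded_linear_imp_has_derivative[OF bounded_linear_fst], of U "(*) D" "(X, Y)" UNIV]
  by (simp add: has_field_derivative_def)

lemma has_derivative_snd_compose:
  "(U has_real_derivative D) (at Y) \<Longrightarrow> ((\<lambda>z. U (snd z)) has_derivative (\<lambda>h. D * snd h)) (at (X, Y))"
  using has_derivative_compose[OF bounded_linear_imp_has_derivative[OF bounded_linear_snd], of U "(*) D" "(X, Y)" UNIV]
  by (simp add: has_field_derivative_def)

section \<open>The Kolmogorov field as a perturbed rotation\<close>

locale kolmogorov =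
  fixes a1 a2 a3 b1 b2 b3 :: real
  assumes nonzero: "a1 \<noteq> 0" "b1 \<noteq> 0"
begin

definition "M = 1 + \<bar>a1\<bar> + \<bar>a2\<bar> + \<bar>a3\<bar> + \<bar>b1\<bar> + \<bar>b2\<bar> + \<bar>b3\<bar>"

definition "A X Y = (1 + a1 * X) * (1 + a2 * X + a3 * Y)"

definition "B X Y = (1 + b1 * Y) * (1 + b2 * X + b3 * Y)"

lemma coeff_le: "\<bar>a1\<bar> \<le> M" "\<bar>a2\<bar> \<le> M" "\<bar>a3\<bar> \<le> M" "\<bar>b1\<bar> \<le> M" "\<bar>b2\<bar> \<le> M" "\<bar>b3\<bar> \<le> M" "1 \<le> M"
  by (simp_all add: M_def)

sublocale perturbed_rotation "kolmogorov_field a1 a2 a3 b1 b2 b3" 1 1 a1 b1 "4 * M\<^sup>2" A B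
proof
  show "a1 \<noteq> 0" "b1 \<noteq> 0" by (rule nonzero)+
  show "kolmogorov_field a1 a2 a3 b1 b2 b3 (1 + a1 * X, 1 + b1 * Y) = (a1 * (- Y * A X Y), b1 * (X * B X Y))" for X Y
    using kolmogorov_field_coords[OF nonzero, of a2 a3 b2 b3 1 X Y] by (simp add: A_def B_def mult.assoc)
  show "A 0 0 = 1" "B 0 0 = 1" by (simp_all add: A_def B_def)
  show "continuous_on UNIV (\<lambda>z. A (fst z) (snd z))" "continuous_on UNIV (\<lambda>z. B (fst z) (snd z))"
    unfolding A_def B_def by (intro continuous_intros)+
  show "1 \<le> 4 * M\<^sup>2" using one_le_power[OF coeff_le(7), of 2] by linarith
  fix t r s :: real assume rs: "\<bar>r\<bar> \<le> 1" "\<bar>s\<bar> \<le> 1"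
  have u: "\<bar>a1 * cos t\<bar> \<le> M" "\<bar>a2 * cos t + a3 * sin t\<bar> \<le> M"
    "\<bar>b1 * sin t\<bar> \<le> M" "\<bar>b2 * cos t + b3 * sin t\<bar> \<le> M"
    by (rule order_trans[OF ray_coeff_bound(1)] order_trans[OF ray_coeff_bound(2)]
        order_trans[OF ray_coeff_bound(3)]; simp add: M_def)+
  have "A (r * cos t) (r * sin t) = (1 + r * (a1 * cos t)) * (1 + r * (a2 * cos t + a3 * sin t))"
    "B (r * cos t) (r * sin t) = (1 + r * (b1 * sin t)) * (1 + r * (b2 * cos t + b3 * sin t))" for r
    unfolding A_def B_def by (simp_all add: algebra_simps)
  note AB = this
  show "\<bar>A (r * cos t) (r * sin t) - A (s * cos t) (s * sin t)\<bar> \<le> 4 * M\<^sup>2 * \<bar>r - s\<bar>"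
    unfolding AB by (rule product_lipschitz[OF u(1,2) coeff_le(7) rs])
  show "\<bar>B (r * cos t) (r * sin t) - B (s * cos t) (s * sin t)\<bar> \<le> 4 * M\<^sup>2 * \<bar>r - s\<bar>"
    unfolding AB by (rule product_lipschitz[OF u(3,4) coeff_le(7) rs])
qed

text \<open>Up to this size of \<open>X\<close> and \<open>Y\<close> each product with a coefficient
  is at most 1/4, so all linear factors of the field are positive.\<close>

definition "\<delta>0 = 1 / (4 * M)"

lemma \<delta>0: "0 < \<delta>0" "\<delta>0 \<le> 1"
  using coeff_le(7) by (auto simp: \<delta>0_def)

lemma small_product: "\<bar>k\<bar> \<le> M \<Longrightarrow> \<bar>X\<bar> \<le> \<delta>0 \<Longrightarrow> \<bar>k * X\<bar> \<le> 1 / 4"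
  using mult_mono[of "\<bar>k\<bar>" M "\<bar>X\<bar>" \<delta>0] coeff_le(7) by (simp add: abs_mult \<delta>0_def)

lemma factor_pos: "\<bar>k\<bar> \<le> M \<Longrightarrow> \<bar>X\<bar> \<le> \<delta>0 \<Longrightarrow> 0 < 1 + k * X"
  using small_product[of k X] by linarith

lemma factor_pos2: "\<bar>k\<bar> \<le> M \<Longrightarrow> \<bar>l\<bar> \<le> M \<Longrightarrow> \<bar>X\<bar> \<le> \<delta>0 \<Longrightarrow> \<bar>Y\<bar> \<le> \<delta>0 \<Longrightarrow> 0 < 1 + k * X + l * Y"
  using small_product[of k X] small_product[of l Y] by linarith

lemma quotient_continuous:
  assumes "\<bar>k\<bar> \<le> M" "\<bar>l\<bar> \<le> M"
  shows "continuous_on {-\<delta>0..\<delta>0} (\<lambda>X. (1 + j * X) / ((1 + k * X) * (1 + l * X)))"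
proof -
  have "1 + k * X \<noteq> 0" "1 + l * X \<noteq> 0" if "X \<in> {-\<delta>0..\<delta>0}" for X
  proof -
    have "\<bar>X\<bar> \<le> \<delta>0" using that by (simp add: abs_le_iff)
    from factor_pos[OF assms(1) this] factor_pos[OF assms(2) this]
    show "1 + k * X \<noteq> 0" "1 + l * X \<noteq> 0" by simp_all
  qed
  then show ?thesis by (intro continuous_intros) auto
qed

lemma center_if_rational_separable:
  assumes coeffs: "\<bar>k\<bar> \<le> M" "\<bar>l\<bar> \<le> M" "\<bar>m\<bar> \<le> M" "\<bar>n\<bar> \<le> M"
    and pos: "\<And>X Y. \<bar>X\<bar> \<le> \<delta>0 \<Longrightarrow> \<bar>Y\<bar> \<le> \<delta>0 \<Longrightarrow> 0 < G X Y"
    and eq: "\<And>X Y. B X Y * ((1 + k * X) * (1 + l * X)) = G X Y * (1 + i * X)"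
      "\<And>X Y. A X Y * ((1 + m * Y) * (1 + n * Y)) = G X Y * (1 + j * Y)"
  shows "is_center (kolmogorov_field a1 a2 a3 b1 b2 b3) (1, 1)"
proof (rule center_if_separable[OF \<delta>0(1) quotient_continuous[OF coeffs(1,2), of i] quotient_continuous[OF coeffs(3,4), of j]])
  fix X Y assume XY: "\<bar>X\<bar> \<le> \<delta>0" "\<bar>Y\<bar> \<le> \<delta>0"
  note p = pos[OF XY] factor_pos[OF coeffs(1) XY(1)] factor_pos[OF coeffs(2) XY(1)]
    factor_pos[OF coeffs(3) XY(2)] factor_pos[OF coeffs(4) XY(2)]
  have "1 / G X Y * B X Y = (1 + i * X) / ((1 + k * X) * (1 + l * X))"
    using eq(1)[of X Y] p by (simp add: frac_eq_eq mult.commute)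
  moreover have "1 / G X Y * A X Y = (1 + j * Y) / ((1 + m * Y) * (1 + n * Y))"
    using eq(2)[of X Y] p by (simp add: frac_eq_eq mult.commute)
  ultimately show "0 < 1 / G X Y \<and> 1 / G X Y * B X Y = (1 + i * X) / ((1 + k * X) * (1 + l * X))
      \<and> 1 / G X Y * A X Y = (1 + j * Y) / ((1 + m * Y) * (1 + n * Y))"
    using p(1) by simp
qed

theorem center_separable:
  assumes "a2 = 0 \<and> b2 = 0 \<or> a2 = 0 \<and> b3 = 0 \<or> a3 = 0 \<and> b2 = 0 \<or> a3 = 0 \<and> b3 = 0 \<or> a2 = b2 \<and> a3 = b3"
  shows "is_center (kolmogorov_field a1 a2 a3 b1 b2 b3) (1, 1)"
proof -
  have M0: "\<bar>0\<bar> \<le> M" using coeff_le(7) by simp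
  consider "a2 = 0" "b2 = 0" | "a2 = 0" "b3 = 0" | "a3 = 0" "b2 = 0" | "a3 = 0" "b3 = 0" | "a2 = b2" "a3 = b3"
    using assms by blast
  then show ?thesis
  proof cases
    case 1
    have "0 < (1 + a1 * X) * (1 + b1 * Y) * (1 + b3 * Y)" if "\<bar>X\<bar> \<le> \<delta>0" "\<bar>Y\<bar> \<le> \<delta>0" for X Y
      by (intro mult_pos_pos factor_pos factor_pos2 coeff_le that)
    moreover have "B X Y * ((1 + a1 * X) * (1 + 0 * X)) = (1 + a1 * X) * (1 + b1 * Y) * (1 + b3 * Y) * (1 + 0 * X)"
      "A X Y * ((1 + b1 * Y) * (1 + b3 * Y)) = (1 + a1 * X) * (1 + b1 * Y) * (1 + b3 * Y) * (1 + a3 * Y)" for X Y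
      using 1 unfolding A_def B_def by algebra+
    ultimately show ?thesis
      by (rule center_if_rational_separable[rotated 4]) (assumption | rule coeff_le M0)+
  next
    case 2
    have "0 < (1 + a1 * X) * (1 + b1 * Y)" if "\<bar>X\<bar> \<le> \<delta>0" "\<bar>Y\<bar> \<le> \<delta>0" for X Y
      by (intro mult_pos_pos factor_pos factor_pos2 coeff_le that)
    moreover have "B X Y * ((1 + a1 * X) * (1 + 0 * X)) = (1 + a1 * X) * (1 + b1 * Y) * (1 + b2 * X)"
      "A X Y * ((1 + b1 * Y) * (1 + 0 * Y)) = (1 + a1 * X) * (1 + b1 * Y) * (1 + a3 * Y)" for X Y
      using 2 unfolding A_def B_def by algebra+
    ultimately show ?thesis
      by (rule center_if_rational_separable[rotated 4]) (assumption | rule coeff_le M0)+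
  next
    case 3
    have "0 < (1 + a1 * X) * (1 + a2 * X) * (1 + b1 * Y) * (1 + b3 * Y)" if "\<bar>X\<bar> \<le> \<delta>0" "\<bar>Y\<bar> \<le> \<delta>0" for X Y
      by (intro mult_pos_pos factor_pos factor_pos2 coeff_le that)
    moreover have "B X Y * ((1 + a1 * X) * (1 + a2 * X)) = (1 + a1 * X) * (1 + a2 * X) * (1 + b1 * Y) * (1 + b3 * Y) * (1 + 0 * X)"
      "A X Y * ((1 + b1 * Y) * (1 + b3 * Y)) = (1 + a1 * X) * (1 + a2 * X) * (1 + b1 * Y) * (1 + b3 * Y) * (1 + 0 * Y)" for X Y
      using 3 unfolding A_def B_def by algebra+
    ultimately show ?thesis
      by (rule center_if_rational_separable[rotated 4]) (assumption | rule coeff_le M0)+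
  next
    case 4
    have "0 < (1 + a1 * X) * (1 + a2 * X) * (1 + b1 * Y)" if "\<bar>X\<bar> \<le> \<delta>0" "\<bar>Y\<bar> \<le> \<delta>0" for X Y
      by (intro mult_pos_pos factor_pos factor_pos2 coeff_le that)
    moreover have "B X Y * ((1 + a1 * X) * (1 + a2 * X)) = (1 + a1 * X) * (1 + a2 * X) * (1 + b1 * Y) * (1 + b2 * X)"
      "A X Y * ((1 + b1 * Y) * (1 + 0 * Y)) = (1 + a1 * X) * (1 + a2 * X) * (1 + b1 * Y) * (1 + 0 * Y)" for X Y
      using 4 unfolding A_def B_def by algebra+
    ultimately show ?thesis
      by (rule center_if_rational_separable[rotated 4]) (assumption | rule coeff_le M0)+
  next
    case 5
    \<comment> \<open>Here \<open>A\<close> and \<open>B\<close> share the factor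
      \<open>1 + b2 * X + b3 * Y\<close>, which \<open>G\<close> removes from both.\<close>
    have "0 < (1 + a1 * X) * (1 + b1 * Y) * (1 + b2 * X + b3 * Y)" if "\<bar>X\<bar> \<le> \<delta>0" "\<bar>Y\<bar> \<le> \<delta>0" for X Y
      by (intro mult_pos_pos factor_pos factor_pos2 coeff_le that)
    moreover have "B X Y * ((1 + a1 * X) * (1 + 0 * X)) = (1 + a1 * X) * (1 + b1 * Y) * (1 + b2 * X + b3 * Y) * (1 + 0 * X)"
      "A X Y * ((1 + b1 * Y) * (1 + 0 * Y)) = (1 + a1 * X) * (1 + b1 * Y) * (1 + b2 * X + b3 * Y) * (1 + 0 * Y)" for X Y
      unfolding A_def B_def unfolding 5 by (simp_all only: mult_zero_left add_0_right mult_1_right mult_ac)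
    ultimately show ?thesis
      by (rule center_if_rational_separable[rotated 4]) (assumption | rule coeff_le M0)+
  qed
qed

theorem center_symmetric:
  assumes "a3 = b2 \<and> b1 = a1 \<and> b3 = a2 \<or> a3 = - b2 \<and> b1 = - a1 \<and> b3 = - a2"
  shows "is_center (kolmogorov_field a1 a2 a3 b1 b2 b3) (1, 1)"
  using assms
proof (elim disjE)
  assume "a3 = b2 \<and> b1 = a1 \<and> b3 = a2"
  then have "A Y X = B X Y" for X Y unfolding A_def B_def by simp
  then show ?thesis by (rule center_if_swap)
next
  assume "a3 = - b2 \<and> b1 = - a1 \<and> b3 = - a2"
  then have "A (- Y) (- X) = B X Y" for X Y unfolding A_def B_def by simp
  then show ?thesis by (rule center_if_antiswap)
qed

text \<open>In this case the lines \<open>1 + a1 X = 0\<close>, \<open>1 + b1 Y = 0\<close>, \<open>1 + b2 X + a3 Y = 0\<close> and the conic \<open>f = 0\<close>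
  are invariant, which gives a Darboux first integral.\<close>

theorem center_Darboux:
  assumes nz: "a3 \<noteq> 0" "b2 \<noteq> 0"
    and cond: "a1 * b2 = b2\<^sup>2 - a3\<^sup>2" "b1 * a3 = a3\<^sup>2 - b2\<^sup>2" "a2 = - b2" "b3 = - a3"
  shows "is_center (kolmogorov_field a1 a2 a3 b1 b2 b3) (1, 1)"
proof -
  define \<Delta> where "\<Delta> = a3\<^sup>2 - b2\<^sup>2"
  have \<Delta>: "\<Delta> \<noteq> 0" "a1 * b2 = - \<Delta>" "b1 * a3 = \<Delta>" using cond nonzero nz by (auto simp: \<Delta>_def)
  define f where "f = (\<lambda>X Y. b2\<^sup>2 + a3\<^sup>2 + \<Delta> * (b2\<^sup>2 * X\<^sup>2 - a3\<^sup>2 * Y\<^sup>2))"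
  \<comment> \<open>On this square \<open>X^2\<close> and \<open>Y^2\<close> are at most
    \<open>\<delta>\<close>, so the variable part of \<open>f\<close> is below
    \<open>b2^2 + a3^2\<close> because \<open>\<bar>\<Delta>\<bar> * \<delta> < 1\<close>.\<close>
  define \<delta> where "\<delta> = min \<delta>0 (1 / (1 + \<bar>\<Delta>\<bar>))"
  have \<delta>: "0 < \<delta>" "\<delta> \<le> \<delta>0" "\<delta> \<le> 1" "\<bar>\<Delta>\<bar> * \<delta> < 1"
  proof -
    show "0 < \<delta>" "\<delta> \<le> \<delta>0" "\<delta> \<le> 1" using \<delta>0 by (auto simp: \<delta>_def)
    have "\<bar>\<Delta>\<bar> * \<delta> \<le> \<bar>\<Delta>\<bar> * (1 / (1 + \<bar>\<Delta>\<bar>))" by (intro mult_left_mono) (auto simp: \<delta>_def)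
    also have "\<dots> < 1" by (simp add: pos_divide_less_eq)
    finally show "\<bar>\<Delta>\<bar> * \<delta> < 1" .
  qed
  have fpos: "0 < f X Y" if XY: "\<bar>X\<bar> \<le> \<delta>" "\<bar>Y\<bar> \<le> \<delta>" for X Y
  proof -
    have sq: "X\<^sup>2 \<le> \<delta>" "Y\<^sup>2 \<le> \<delta>"
      using mult_mono[OF XY(1) order_trans[OF XY(1) \<delta>(3)]] mult_mono[OF XY(2) order_trans[OF XY(2) \<delta>(3)]] \<delta>
      by (simp_all add: power2_eq_square)
    have "\<bar>b2\<^sup>2 * X\<^sup>2 - a3\<^sup>2 * Y\<^sup>2\<bar> \<le> b2\<^sup>2 * X\<^sup>2 + a3\<^sup>2 * Y\<^sup>2"
      by (simp add: abs_le_iff)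
    also have "\<dots> \<le> b2\<^sup>2 * \<delta> + a3\<^sup>2 * \<delta>" using sq by (intro add_mono mult_left_mono) auto
    finally have "\<bar>\<Delta>\<bar> * \<bar>b2\<^sup>2 * X\<^sup>2 - a3\<^sup>2 * Y\<^sup>2\<bar> \<le> \<bar>\<Delta>\<bar> * (b2\<^sup>2 * \<delta> + a3\<^sup>2 * \<delta>)"
      by (rule mult_left_mono) simp
    also have "\<dots> = (\<bar>\<Delta>\<bar> * \<delta>) * (b2\<^sup>2 + a3\<^sup>2)" by (simp add: algebra_simps)
    also have "\<dots> < 1 * (b2\<^sup>2 + a3\<^sup>2)"
      using \<delta>(4) nz by (intro mult_strict_right_mono) (auto simp: sum_power2_gt_zero_iff)
    finally show ?thesis unfolding f_def abs_mult[symmetric] by (simp add: abs_less_iff)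
  qed
  obtain U where U: "\<And>x. \<bar>x\<bar> \<le> \<delta>0 \<Longrightarrow> (U has_real_derivative x * ((1 + 0 * x) / ((1 + a1 * x) * (1 + 0 * x)))) (at x)"
    using local_antiderivative[OF \<delta>0(1) quotient_continuous[of a1 0 0]] coeff_le by auto
  obtain W where W: "\<And>x. \<bar>x\<bar> \<le> \<delta>0 \<Longrightarrow> (W has_real_derivative x * ((1 + 0 * x) / ((1 + b1 * x) * (1 + 0 * x)))) (at x)"
    using local_antiderivative[OF \<delta>0(1) quotient_continuous[of b1 0 0]] coeff_le by auto
  \<comment> \<open>\<open>U\<close> and \<open>W\<close> integrate \<open>x / (1 + a1 * x)\<close>
    and \<open>x / (1 + b1 * x)\<close>: logarithms of the invariant lines plus linear terms, so
    that \<open>exp\<close> of \<open>H\<close> has exponential factors too. The outer division by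
    \<open>\<Delta>\<close> makes the integrating factor \<open>g\<close> positive.\<close>
  define H where "H = (\<lambda>X Y. ((U X - W Y) - ln (f X Y) * (1 / \<Delta>)) * (1 / \<Delta>))"
  define g where "g = (\<lambda>X Y. (1 + b2 * X + a3 * Y) / ((1 + a1 * X) * (1 + b1 * Y) * f X Y))"
  show ?thesis
  proof (rule center_if_first_integral[OF \<delta>(1), of H g])
    fix X Y :: real assume n: "norm (X, Y) < \<delta>"
    have XY: "\<bar>X\<bar> \<le> \<delta>" "\<bar>Y\<bar> \<le> \<delta>" using norm_fst_le[of X Y] norm_snd_le[of Y X] n by simp_all
    have XY0: "\<bar>X\<bar> \<le> \<delta>0" "\<bar>Y\<bar> \<le> \<delta>0" using XY \<delta>(2) by linarith+
    note p = factor_pos[OF coeff_le(1) XY0(1)] factor_pos[OF coeff_le(4) XY0(2)] fpos[OF XY]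
      factor_pos2[OF coeff_le(5,3) XY0]
    show "0 < g X Y" unfolding g_def using p by simp
    have U': "((\<lambda>z. U (fst z)) has_derivative (\<lambda>h. X / (1 + a1 * X) * fst h)) (at (X, Y))"
      using has_derivative_fst_compose[OF U[OF XY0(1)], of Y] by simp
    have W': "((\<lambda>z. W (snd z)) has_derivative (\<lambda>h. Y / (1 + b1 * Y) * snd h)) (at (X, Y))"
      using has_derivative_snd_compose[OF W[OF XY0(2)], of X] by simp
    have "((\<lambda>z. f (fst z) (snd z)) has_derivative (\<lambda>h. 2 * \<Delta> * b2\<^sup>2 * X * fst h - 2 * \<Delta> * a3\<^sup>2 * Y * snd h)) (at (X, Y))"
      unfolding f_def by (auto intro!: derivative_eq_intros simp: algebra_simps)
    then have F': "((\<lambda>z. ln (f (fst z) (snd z))) has_derivative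
        (\<lambda>h. (1 / f X Y) * (2 * \<Delta> * b2\<^sup>2 * X * fst h - 2 * \<Delta> * a3\<^sup>2 * Y * snd h))) (at (X, Y))"
      using has_derivative_compose[of "\<lambda>z. f (fst z) (snd z)" _ "(X, Y)" UNIV ln "(*) (1 / f X Y)"]
        DERIV_ln_divide[OF p(3)] unfolding has_field_derivative_def by simp
    \<comment> \<open>Modulo the line \<open>1 + a1 * X\<close>, the conic splits into the third
      invariant line and the second factor of \<open>B\<close>. This makes the
      \<open>X\<close>-derivative of \<open>H\<close> a multiple of \<open>B\<close>; the identity
      with \<open>b1\<close> does the same for \<open>A\<close>.\<close>
    have "f X Y - 2 * b2\<^sup>2 * (1 + a1 * X) = \<Delta> * (1 + b2 * X + a3 * Y) * (1 + b2 * X + b3 * Y)"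
      using \<Delta>(2) \<Delta>_def cond(4) unfolding f_def by algebra
    then have "X / (1 + a1 * X) - 2 * b2\<^sup>2 * X / f X Y
        = X * (\<Delta> * (1 + b2 * X + a3 * Y) * (1 + b2 * X + b3 * Y)) / ((1 + a1 * X) * f X Y)"
      using p by (simp add: diff_frac_eq flip: \<open>f X Y - 2 * b2\<^sup>2 * (1 + a1 * X) = _\<close>) (simp add: algebra_simps)
    also have "\<dots> = \<Delta> * (g X Y * (X * B X Y))"
      unfolding g_def B_def using p by (simp add: mult_ac)
    finally have X: "X / (1 + a1 * X) - 2 * b2\<^sup>2 * X / f X Y = \<Delta> * (g X Y * (X * B X Y))" .
    have "2 * a3\<^sup>2 * (1 + b1 * Y) - f X Y = \<Delta> * (1 + b2 * X + a3 * Y) * (1 + a2 * X + a3 * Y)"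
      using \<Delta>(3) \<Delta>_def cond(3) unfolding f_def by algebra
    then have "2 * a3\<^sup>2 * Y / f X Y - Y / (1 + b1 * Y)
        = Y * (\<Delta> * (1 + b2 * X + a3 * Y) * (1 + a2 * X + a3 * Y)) / ((1 + b1 * Y) * f X Y)"
      using p by (simp add: diff_frac_eq flip: \<open>2 * a3\<^sup>2 * (1 + b1 * Y) - f X Y = _\<close>) (simp add: algebra_simps)
    also have "\<dots> = \<Delta> * (g X Y * (Y * A X Y))"
      unfolding g_def A_def using p by (simp add: mult_ac)
    finally have Y: "2 * a3\<^sup>2 * Y / f X Y - Y / (1 + b1 * Y) = \<Delta> * (g X Y * (Y * A X Y))" .
    have "((\<lambda>z. H (fst z) (snd z)) has_derivative
        (\<lambda>h. ((X / (1 + a1 * X) * fst h - Y / (1 + b1 * Y) * snd h)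
            - (1 / f X Y) * (2 * \<Delta> * b2\<^sup>2 * X * fst h - 2 * \<Delta> * a3\<^sup>2 * Y * snd h) * (1 / \<Delta>)) * (1 / \<Delta>))) (at (X, Y))"
      unfolding H_def
      by (intro has_derivative_mult_left has_derivative_diff U' W' F')
    moreover have "((X / (1 + a1 * X) * k - Y / (1 + b1 * Y) * l)
            - (1 / f X Y) * (2 * \<Delta> * b2\<^sup>2 * X * k - 2 * \<Delta> * a3\<^sup>2 * Y * l) * (1 / \<Delta>)) * (1 / \<Delta>)
        = g X Y * (X * B X Y * k + Y * A X Y * l)" for k l
    proof -
      have "((X / (1 + a1 * X) * k - Y / (1 + b1 * Y) * l)
            - (1 / f X Y) * (2 * \<Delta> * b2\<^sup>2 * X * k - 2 * \<Delta> * a3\<^sup>2 * Y * l) * (1 / \<Delta>)) * (1 / \<Delta>)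
        = ((X / (1 + a1 * X) - 2 * b2\<^sup>2 * X / f X Y) * k + (2 * a3\<^sup>2 * Y / f X Y - Y / (1 + b1 * Y)) * l) / \<Delta>"
        using \<Delta>(1) p(3) by (simp add: diff_divide_distrib add_divide_distrib algebra_simps)
      also have "\<dots> = g X Y * (X * B X Y * k + Y * A X Y * l)"
        unfolding X Y using \<Delta>(1) by (simp add: field_simps)
      finally show ?thesis .
    qed
    ultimately show "((\<lambda>z. H (fst z) (snd z)) has_derivative
        (\<lambda>h. g X Y * (X * B X Y * fst h + Y * A X Y * snd h))) (at (X, Y))"
      by simp
  qed
qed

end

section \<open>The center problem\<close>

theorem kolmogorov_center_necessary:
  assumes nz: "a1 \<noteq> 0" "b1 \<noteq> 0" and center: "is_center (kolmogorov_field a1 a2 a3 b1 b2 b3) (1, 1)"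
  shows "(a2 = 0 \<and> b2 = 0)
    \<or> (a2 = 0 \<and> b3 = 0)
    \<or> (a3 = 0 \<and> b2 = 0)
    \<or> (a3 = 0 \<and> b3 = 0)
    \<or> (a2 = b2 \<and> a3 = b3)
    \<or> (a3 = b2 \<and> b1 = a1 \<and> b3 = a2)
    \<or> (a3 = - b2 \<and> b1 = - a1 \<and> b3 = - a2)
    \<or> (a3 \<noteq> 0 \<and> b2 \<noteq> 0 \<and> a1 * b2 = b2\<^sup>2 - a3\<^sup>2 \<and> b1 * a3 = a3\<^sup>2 - b2\<^sup>2 \<and> a2 = - b2 \<and> b3 = - a3)"
proof -
  have formal: "\<exists>c. normalized_to n c \<and> (\<forall>k>2. even k \<longrightarrow> c k 0 = 0) \<and>
     (\<forall>p q. p + q \<le> n \<longrightarrow> lie_coeff (a1 * k) (a2 * k) (a3 * k) (b1 * k) (b2 * k) (b3 * k) c p q = 0)"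
    if "k \<noteq> 0" "2 \<le> n" for k n
    using center_formal_integral[OF center, of "a1 * k" "b1 * k" "a1 * k" "a2 * k" "a3 * k" "b1 * k" "b2 * k" "b3 * k" n]
      kolmogorov_field_coords[OF nz, of a2 a3 b2 b3 k] nz that by simp
  obtain c where "normalized_to 4 c" "\<And>p q. p + q \<le> 4 \<Longrightarrow> lie_coeff a1 a2 a3 b1 b2 b3 c p q = 0"
    using formal[of 1 4] by auto
  then have first: "a2 * a3 = b2 * b3"
    unfolding normalized_to_def by (intro first_focal_value[of a1 a2 a3 b1 b2 b3 c]) auto
  show ?thesis
  proof (cases "b2 = 0")
    case True
    \<comment> \<open>For \<open>b2 = 0\<close> the first focal value reads
      \<open>a2 * a3 = 0\<close>, and either factor gives a listed case.\<close>
    then show ?thesis using first by auto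
  next
    case b2: False
    obtain c where c: "normalized_to 12 c" "\<And>k. 2 < k \<Longrightarrow> even k \<Longrightarrow> c k 0 = 0"
      "\<And>p q. p + q \<le> 12 \<Longrightarrow> lie_coeff (a1 / b2) (a2 / b2) (a3 / b2) (b1 / b2) (b2 / b2) (b3 / b2) c p q = 0"
      using formal[of "1 / b2" 12] b2 by auto
    have b3: "b3 / b2 = a2 / b2 * (a3 / b2)" using first b2 by (simp add: field_simps)
    interpret normalized_integral "a1 / b2" "b1 / b2" "a2 / b2" "a3 / b2" c
      using c b2 b3 unfolding normalized_to_def by unfold_locales auto
    consider "a3 = 0" | "a3 \<noteq> 0" "a2 = 0" | "a3 \<noteq> 0" "a2 = b2"
      | "a3 \<noteq> 0" "(a3 / b2)\<^sup>2 = 1" "a1 / b2 = b1 / b2 * (a3 / b2)"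
      | "a3 \<noteq> 0" "a2 = - b2" "a1 / b2 = 1 - (a3 / b2)\<^sup>2" "b1 / b2 * (a3 / b2) = (a3 / b2)\<^sup>2 - 1"
      using center_conditions b2 by (auto simp: divide_eq_eq)
    then show ?thesis
    proof cases
      case 1 then show ?thesis using first b2 by auto
    next
      case 2 then show ?thesis using first b2 by auto
    next
      case 3 then show ?thesis using first b2 by auto
    next
      case 4
      \<comment> \<open>The sign of \<open>a3 / b2\<close> separates the families reversible about
        the diagonal and about the antidiagonal.\<close>
      then have "a3 = b2 \<or> a3 = - b2" using b2 by (auto simp: power2_eq_1_iff divide_eq_eq)
      then show ?thesis
      proof
        assume "a3 = b2"
        then show ?thesis using 4 first b2 by auto
      next
        assume "a3 = - b2"
        moreover from this have "b2 * b3 = b2 * - a2" using first by (simp add: mult.commute[of a2])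
        then have "b3 = - a2" using b2 by (metis mult_left_cancel)
        ultimately show ?thesis using 4 b2 by (simp add: field_simps)
      qed
    next
      case 5
      then have "b2 * b3 = b2 * - a3" using first by simp
      then have "b3 = - a3" using b2 by (metis mult_left_cancel)
      moreover have "a1 * b2 = b2\<^sup>2 - a3\<^sup>2" "b1 * a3 = a3\<^sup>2 - b2\<^sup>2"
        using 5(3,4) b2 by (simp_all add: field_simps power2_eq_square)
      ultimately show ?thesis using 5 b2 by blast
    qed
  qed
qed

theorem proposition1p1:
  fixes a1 a2 a3 b1 b2 b3 :: real
  assumes "a1 \<noteq> 0" and "b1 \<noteq> 0"
  shows "is_center (kolmogorov_field a1 a2 a3 b1 b2 b3) (1, 1) \<longleftrightarrow>
      (a2 = 0 \<and> b2 = 0)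
    \<or> (a2 = 0 \<and> b3 = 0)
    \<or> (a3 = 0 \<and> b2 = 0)
    \<or> (a3 = 0 \<and> b3 = 0)
    \<or> (a2 - b2 = 0 \<and> b3 - a3 = 0)
    \<or> (a3 - b2 = 0 \<and> b1 - a1 = 0 \<and> b3 - a2 = 0)
    \<or> (a3 + b2 = 0 \<and> b1 + a1 = 0 \<and> a2 + b3 = 0)
    \<or> (a3 \<noteq> 0 \<and> b2 \<noteq> 0 \<and> a1 + (a3\<^sup>2 - b2\<^sup>2) / b2 = 0 \<and> a2 + b2 = 0 \<and>
       b1 - (a3\<^sup>2 - b2\<^sup>2) / a3 = 0 \<and> b3 + a3 = 0)"
  (is "?center \<longleftrightarrow> ?conditions")
proof -
  interpret kolmogorov a1 a2 a3 b1 b2 b3 by unfold_locales (rule assms)+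
  have Darboux: "a1 + (a3\<^sup>2 - b2\<^sup>2) / b2 = 0 \<longleftrightarrow> a1 * b2 = b2\<^sup>2 - a3\<^sup>2"
    "b1 - (a3\<^sup>2 - b2\<^sup>2) / a3 = 0 \<longleftrightarrow> b1 * a3 = a3\<^sup>2 - b2\<^sup>2" if "a3 \<noteq> 0" "b2 \<noteq> 0"
    using that by (auto simp: field_simps)
  show ?thesis
  proof
    assume ?center
    from kolmogorov_center_necessary[OF assms this] show ?conditions
      using Darboux by (elim disjE conjE) simp_all
  next
    assume ?conditions
    then have "(a2 = 0 \<and> b2 = 0 \<or> a2 = 0 \<and> b3 = 0 \<or> a3 = 0 \<and> b2 = 0 \<or> a3 = 0 \<and> b3 = 0 \<or> a2 = b2 \<and> a3 = b3)
      \<or> (a3 = b2 \<and> b1 = a1 \<and> b3 = a2 \<or> a3 = - b2 \<and> b1 = - a1 \<and> b3 = - a2)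
      \<or> (a3 \<noteq> 0 \<and> b2 \<noteq> 0 \<and> a1 * b2 = b2\<^sup>2 - a3\<^sup>2 \<and> b1 * a3 = a3\<^sup>2 - b2\<^sup>2 \<and> a2 = - b2 \<and> b3 = - a3)"
      using Darboux by (elim disjE conjE) (simp_all add: eq_neg_iff_add_eq_0)
    then show ?center
      using center_separable center_symmetric center_Darboux by blast
  qed
qed

end
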